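(* Let $\delta\ge p$ and suppose there are constants $C_1,C_2>0$ such that $C_1d(x)^{-\delta}\le f(x)\le C_2d(x)^{-\delta}$ for any $x\in\Omega$. Then the problem $$-\Delta_p u+(-\Delta)^s_q u=f(x)u^{-\alpha}+g(x)u^{\beta},\quad u>0\ \text{in }\Omega;\qquad u=0\ \text{in }\mathbb R^N\setminus\Omega$$ has no weak solution in either of the following senses: (a) assuming $g\in L^{\left(\frac{p^*}{\beta+1}\right)'}(\Omega)$, there is no positive function $u\in W^{1,p}_0(\Omega)$ satisfying (I) and (II) below; (b) for $\theta_0>\max\left\{1,\frac{\alpha+p-1}{p}\right\}$ and assuming $g\in L^{\left(\frac{\theta_0p^*}{p(\theta_0-1)+\beta+1}\right)'}(\Omega)$, there is no positive function $u\in W^{1,p}_{\mathrm{loc}}(\Omega)$ with $u^{\theta_0}\in W^{1,p}_0(\Omega)$ satisfying (I) and (II) below. (I) For every $\omega\Subset\Omega$ there is a constant $C=C(\omega)>0$ such that $u\ge C$ in $\omega$. (II) For all $\varphi\in C_c^\infty(\Omega)$, $$\int_\Omega[\nabla u]^{p-1}\nabla\varphi\,dx+\iint_{\mathbb R^{2N}}\frac{[u(x)-u(y)]^{q-1}(\varphi(x)-\varphi(y))}{|x-y|^{N+sq}}dx\,dy=\int_\Omega f(x)u^{-\alpha}\varphi\,dx+\int_\Omega g(x)u^{\beta}\varphi\,dx .$$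
   Context: Standing assumptions: $\Omega\subset\mathbb R^N$ is a bounded open domain with $C^2$ boundary, $0<s<1$, $1<q\le p<\infty$, $N>p$, $0<\beta<q-1$, $\alpha>0$; $f:\Omega\to[0,\infty)$ and $g:\Omega\to[0,\infty)$ are measurable. Notation: $[\xi]^{t-1}:=|\xi|^{t-2}\xi$ for $t>1$ and $\xi$ a real number or a vector; $t'$ is the conjugate exponent of $t$; $p^*=\frac{Np}{N-p}$; $d(x)=\mathrm{dist}(x,\partial\Omega)$. $\Delta_p u=\mathrm{div}(|\nabla u|^{p-2}\nabla u)$ and $(-\Delta)^s_q u(x)=2\,\mathrm{P.V.}\int_{\mathbb R^N}\frac{[u(x)-u(y)]^{q-1}}{|x-y|^{N+sq}}dy$. $W^{1,p}_0(\Omega)$ is the set of $u\in W^{1,p}(\mathbb R^N)$ with $u=0$ a.e. in $\mathbb R^N\setminus\Omega$, normed by $\|\nabla u\|_{L^p(\Omega)}$. Functions are extended by $0$ outside $\Omega$. *)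

theory Defs
  imports "HOL-Analysis.Analysis"
begin

text \<open>Euclidean space \<open>\<real>\<^sup>N\<close> is a type \<open>'a::euclidean_space\<close>, with \<open>N = DIM('a)\<close>.\<close>

subsection \<open>Smooth functions and test functions\<close>

primrec C_k :: "nat \<Rightarrow> ('a::euclidean_space \<Rightarrow> real) \<Rightarrow> bool" where
  "C_k 0 h \<longleftrightarrow> continuous_on UNIV h"
| "C_k (Suc k) h \<longleftrightarrow>
    (\<exists>h'. (\<forall>x. (h has_derivative h' x) (at x)) \<and> (\<forall>v. C_k k (\<lambda>x. h' x v)))"

definition compactly_contained :: "'a::euclidean_space set \<Rightarrow> 'a set \<Rightarrow> bool"
  (infix "\<Subset>" 50) where
  "\<omega> \<Subset> U \<longleftrightarrow> compact (closure \<omega>) \<and> closure \<omega> \<subseteq> U"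

text \<open>\<open>C\<^sub>c\<^sup>\<infinity>(U)\<close>; its elements are extended by zero to the whole space.\<close>

definition test_functions :: "'a::euclidean_space set \<Rightarrow> ('a \<Rightarrow> real) set" where
  "test_functions U = {\<phi>. (\<forall>k. C_k k \<phi>) \<and> {x. \<phi> x \<noteq> 0} \<Subset> U}"

definition grad :: "('a::euclidean_space \<Rightarrow> real) \<Rightarrow> 'a \<Rightarrow> 'a" where
  "grad \<phi> x = (\<Sum>b\<in>Basis. frechet_derivative \<phi> (at x) b *\<^sub>R b)"

subsection \<open>Domains with \<open>C\<^sup>2\<close> boundary\<close>

text \<open>
  Near every boundary point the domain is the part of a ball lying above the graph of a
  \<open>C\<^sup>2\<close> function over a hyperplane. The unit vector \<open>e\<close> is the vertical
  direction; the graph function is evaluated only at the orthogonal projection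
  \<open>x - (x \<bullet> e) e\<close> of \<open>x\<close> to the hyperplane \<open>e\<^sup>\<bottom>\<close>. A function on that hyperplane is
  \<open>C\<^sup>2\<close> iff it is the restriction of a \<open>C\<^sup>2\<close> function \<open>\<gamma>\<close> on the whole space.
\<close>

definition C2_boundary :: "'a::euclidean_space set \<Rightarrow> bool" where
  "C2_boundary U \<longleftrightarrow>
    (\<forall>x0\<in>frontier U. \<exists>r>0. \<exists>e \<gamma>. norm e = 1 \<and> C_k 2 \<gamma> \<and>
      U \<inter> ball x0 r = {x \<in> ball x0 r. x \<bullet> e > \<gamma> (x - (x \<bullet> e) *\<^sub>R e)})"

subsection \<open>Lebesgue and Sobolev spaces\<close>

definition in_Lp ::
  "real \<Rightarrow> 'a::euclidean_space set \<Rightarrow> ('a \<Rightarrow> 'b::euclidean_space) \<Rightarrow> bool" where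
  "in_Lp r U h \<longleftrightarrow> h \<in> borel_measurable (lebesgue_on U) \<and>
    integrable (lebesgue_on U) (\<lambda>x. norm (h x) powr r)"

definition locally_integrable ::
  "'a::euclidean_space set \<Rightarrow> ('a \<Rightarrow> 'b::euclidean_space) \<Rightarrow> bool" where
  "locally_integrable U h \<longleftrightarrow> (\<forall>K. compact K \<and> K \<subseteq> U \<longrightarrow> integrable (lebesgue_on K) h)"

definition has_weak_gradient ::
  "'a::euclidean_space set \<Rightarrow> ('a \<Rightarrow> real) \<Rightarrow> ('a \<Rightarrow> 'a) \<Rightarrow> bool" where
  "has_weak_gradient U u G \<longleftrightarrow> locally_integrable U u \<and> locally_integrable U G \<and>
    (\<forall>\<phi>\<in>test_functions U.
      (\<integral>x. u x *\<^sub>R grad \<phi> x \<partial>lebesgue_on U) = - (\<integral>x. \<phi> x *\<^sub>R G x \<partial>lebesgue_on U))"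

text \<open>
  The weak gradient is only determined almost everywhere, so the Sobolev spaces are rendered
  as relations: \<open>W1p p U u G\<close> says that \<open>u \<in> W\<^sup>1\<^sup>,\<^sup>p(U)\<close> and \<open>\<nabla>u = G\<close>, and similarly for the other two.
\<close>

definition W1p ::
  "real \<Rightarrow> 'a::euclidean_space set \<Rightarrow> ('a \<Rightarrow> real) \<Rightarrow> ('a \<Rightarrow> 'a) \<Rightarrow> bool" where
  "W1p p U u G \<longleftrightarrow> has_weak_gradient U u G \<and> in_Lp p U u \<and> in_Lp p U G"

definition W1p_zero ::
  "real \<Rightarrow> 'a::euclidean_space set \<Rightarrow> ('a \<Rightarrow> real) \<Rightarrow> ('a \<Rightarrow> 'a) \<Rightarrow> bool" where
  "W1p_zero p U u G \<longleftrightarrow> W1p p UNIV u G \<and> (AE x in lebesgue. x \<notin> U \<longrightarrow> u x = 0)"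

text \<open>
  Weak gradients on overlapping open sets agree almost everywhere, so the gradients on the
  sets \<open>V\<close> always glue to a single \<open>G\<close> on \<open>U\<close>.
\<close>

definition W1p_loc ::
  "real \<Rightarrow> 'a::euclidean_space set \<Rightarrow> ('a \<Rightarrow> real) \<Rightarrow> ('a \<Rightarrow> 'a) \<Rightarrow> bool" where
  "W1p_loc p U u G \<longleftrightarrow> (\<forall>V. open V \<and> V \<Subset> U \<longrightarrow> W1p p V u G)"

definition conjugate_exponent :: "real \<Rightarrow> real" where
  "conjugate_exponent t = t / (t - 1)"

definition sobolev_exponent :: "'a::euclidean_space itself \<Rightarrow> real \<Rightarrow> real" where
  "sobolev_exponent _ p = real DIM('a) * p / (real DIM('a) - p)"

subsection \<open>Weak solutions\<close>

text \<open>\<open>bracket_pow \<xi> r\<close> is \<open>[\<xi>]\<^sup>r\<close>: with \<open>r = t - 1\<close> this is \<open>[\<xi>]\<^sup>t\<^sup>-\<^sup>1 = |\<xi>|\<^sup>t\<^sup>-\<^sup>2 \<xi>\<close>.\<close>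

definition bracket_pow :: "'b::real_normed_vector \<Rightarrow> real \<Rightarrow> 'b" where
  "bracket_pow \<xi> r = norm \<xi> powr (r - 1) *\<^sub>R \<xi>"

definition boundary_dist :: "'a::euclidean_space set \<Rightarrow> 'a \<Rightarrow> real" where
  "boundary_dist U x = infdist x (frontier U)"

text \<open>Functions are identified when equal almost everywhere, so pointwise conditions hold a.e.\<close>

definition positive_in :: "'a::euclidean_space set \<Rightarrow> ('a \<Rightarrow> real) \<Rightarrow> bool" where
  "positive_in U u \<longleftrightarrow> (AE x in lebesgue. x \<in> U \<longrightarrow> u x > 0) \<and>
    (AE x in lebesgue. x \<notin> U \<longrightarrow> u x = 0)"

definition locally_bounded_below :: "'a::euclidean_space set \<Rightarrow> ('a \<Rightarrow> real) \<Rightarrow> bool" where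
  "locally_bounded_below U u \<longleftrightarrow>
    (\<forall>\<omega>. \<omega> \<Subset> U \<longrightarrow> (\<exists>C>0. AE x in lebesgue. x \<in> \<omega> \<longrightarrow> u x \<ge> C))"

definition nonlocal_integrand ::
  "real \<Rightarrow> real \<Rightarrow> ('a::euclidean_space \<Rightarrow> real) \<Rightarrow> ('a \<Rightarrow> real) \<Rightarrow> 'a \<times> 'a \<Rightarrow> real" where
  "nonlocal_integrand q s u \<phi> = (\<lambda>(x, y).
    bracket_pow (u x - u y) (q - 1) * (\<phi> x - \<phi> y) / norm (x - y) powr (real DIM('a) + s * q))"

text \<open>
  The weak formulation, where \<open>G = \<nabla>u\<close>. The integral of a nonintegrable function is \<open>0\<close> in HOL,
  so the existence of the four integrals has to be stated along with the identity. Lebesgue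
  measure on the product type is the completed product measure.
\<close>

definition weak_formulation ::
  "'a::euclidean_space set \<Rightarrow> real \<Rightarrow> real \<Rightarrow> real \<Rightarrow> real \<Rightarrow> real \<Rightarrow>
    ('a \<Rightarrow> real) \<Rightarrow> ('a \<Rightarrow> real) \<Rightarrow> ('a \<Rightarrow> real) \<Rightarrow> ('a \<Rightarrow> 'a) \<Rightarrow> bool" where
  "weak_formulation U p q s \<alpha> \<beta> f g u G \<longleftrightarrow> (\<forall>\<phi>\<in>test_functions U.
    integrable (lebesgue_on U) (\<lambda>x. bracket_pow (G x) (p - 1) \<bullet> grad \<phi> x) \<and>
    integrable lebesgue (nonlocal_integrand q s u \<phi>) \<and>
    integrable (lebesgue_on U) (\<lambda>x. f x * u x powr (- \<alpha>) * \<phi> x) \<and>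
    integrable (lebesgue_on U) (\<lambda>x. g x * u x powr \<beta> * \<phi> x) \<and>
    (\<integral>x. bracket_pow (G x) (p - 1) \<bullet> grad \<phi> x \<partial>lebesgue_on U)
      + (\<integral>z. nonlocal_integrand q s u \<phi> z \<partial>lebesgue)
    = (\<integral>x. f x * u x powr (- \<alpha>) * \<phi> x \<partial>lebesgue_on U)
      + (\<integral>x. g x * u x powr \<beta> * \<phi> x \<partial>lebesgue_on U))"

end

theory Submission
  imports Defs
begin

text \<open>
  Suppose that \<open>u\<close> is a weak solution and put \<open>\<theta> = 1\<close> in the first case, \<open>\<theta> = \<theta>0\<close> in the second, so that \<open>v = u powr \<theta>\<close>
  lies in \<open>W\<^sup>1\<^sup>,\<^sup>p\<close> of the whole space and vanishes outside \<open>\<Omega>\<close>. The contradiction comes from two estimates on one small ball at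
  distance comparable to its radius \<open>r\<close> from the boundary: the singular term forces \<open>u\<close> to be bounded below there in
  the mean, whereas the boundary condition forces it to be small.

  For the lower bound the equation is tested with \<open>\<eta> ^ Q * (u + \<kappa>) powr (1 - q)\<close>, where \<open>\<eta>\<close> is a bump of radius \<open>r\<close>
  and \<open>\<kappa> > 0\<close>. In the local term the derivative of \<open>(u + \<kappa>) powr (1 - q)\<close> produces a negative multiple of
  \<open>\<bar>\<nabla>u\<bar> powr p\<close> that absorbs the mixed term (lemma \<open>gradient_absorption\<close>), and the power \<open>1 - q\<close> is
  exactly the one for which the discrete Picone inequality (lemma \<open>discrete_Picone\<close>) bounds the nonlocal term by the fractional
  energy of the bump alone. No information on the gradient of \<open>u\<close> or on its fractional energy survives in the
  result (lemma \<open>caccioppoli_ball\<close>). Since \<open>f \<ge> C1 * d powr (- \<delta>)\<close> is at least a multiple of \<open>r powr (- p)\<close> on the ball,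
  because \<open>\<delta> \<ge> p\<close>, and since both terms on the other side are at most multiples of
  \<open>r powr (N - p)\<close>, where \<open>N\<close> is the dimension, as soon as the mean of \<open>v powr p\<close> over the ball is bounded, the mean of
  \<open>(u + \<kappa>) powr (- (q - 1 + \<alpha>))\<close> over the ball of half the radius is bounded independently of \<open>r\<close> and \<open>\<kappa>\<close>. The term with \<open>g\<close> has a good sign.

  For the upper bound, \<open>v\<close> vanishes on the other side of the boundary, so the integral of \<open>v powr p\<close> over a boundary layer of
  thickness comparable to \<open>r\<close> is at most a multiple of \<open>r powr p\<close> (lemma \<open>shift_to_zero_set_estimate\<close>). The layer has measure at least a
  multiple of \<open>r\<close> (lemma \<open>boundary_layer\<close>), so the mean of \<open>v powr p\<close> over some ball with centre in it is at most a multiple of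
  \<open>r powr (p - 1)\<close> (lemma \<open>ball_with_small_norm\<close>), which tends to \<open>0\<close> because \<open>p > 1\<close>. Hence \<open>u \<le> \<kappa>\<close> on most of this ball once \<open>r\<close> is
  small, and then the mean of \<open>(u + \<kappa>) powr (- (q - 1 + \<alpha>))\<close> is at least nearly \<open>(2 * \<kappa>) powr (- (q - 1 + \<alpha>))\<close>, which exceeds every bound as
  \<open>\<kappa>\<close> tends to \<open>0\<close>.

  The test function above is not smooth. It is approximated by replacing \<open>u\<close> in it by mollifications along a sequence of radii for which
  values and gradients converge almost everywhere and the gradients have a common majorant in \<open>L\<^sup>p\<close>
  (lemma \<open>W1p_smooth_approximation\<close>), so that all limits are limits by dominated convergence or by Fatou's lemma.
\<close>

section \<open>Smooth functions and bumps\<close>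

lemma C_k_mono_Suc: "C_k (Suc k) h \<Longrightarrow> C_k k h"
proof (induction k arbitrary: h)
  case 0
  then obtain h' where "\<forall>x. (h has_derivative h' x) (at x)" by auto
  then show ?case by (auto intro!: continuous_at_imp_continuous_on has_derivative_continuous)
next
  case (Suc k)
  then obtain h' where "\<forall>x. (h has_derivative h' x) (at x)" "\<forall>v. C_k (Suc k) (\<lambda>x. h' x v)"
    by auto
  with Suc.IH show ?case by auto
qed

lemma C_k_imp_continuous: "C_k k h \<Longrightarrow> continuous_on A h"
proof (induction k)
  case 0 then show ?case by (auto intro: continuous_on_subset)
next
  case (Suc k) then show ?case using C_k_mono_Suc by blast
qed

lemma C_k_const: "C_k k (\<lambda>x. c)"
proof (induction k arbitrary: c)
  case (Suc k)
  then show ?case by (auto intro!: exI[of _ "\<lambda>x v. 0"])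
qed simp

lemma C_k_bounded_linear: 
  assumes "bounded_linear h" shows "C_k k h"
proof (cases k)
  case 0 then show ?thesis using assms by (simp add: linear_continuous_on)
next
  case (Suc k)
  have "(h has_derivative h) (at x)" for x
    using assms by (rule bounded_linear_imp_has_derivative)
  with Suc show ?thesis by (auto intro!: exI[of _ "\<lambda>x. h"] C_k_const)
qed

lemma C_k_add: "C_k k h1 \<Longrightarrow> C_k k h2 \<Longrightarrow> C_k k (\<lambda>x. h1 x + h2 x)"
proof (induction k arbitrary: h1 h2)
  case 0 then show ?case by (auto intro!: continuous_intros)
next
  case (Suc k)
  obtain d1 where d1: "\<And>x. (h1 has_derivative d1 x) (at x)" "\<And>v. C_k k (\<lambda>x. d1 x v)"
    using Suc.prems(1) by auto
  obtain d2 where d2: "\<And>x. (h2 has_derivative d2 x) (at x)" "\<And>v. C_k k (\<lambda>x. d2 x v)"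
    using Suc.prems(2) by auto
  have "((\<lambda>x. h1 x + h2 x) has_derivative (\<lambda>v. d1 x v + d2 x v)) (at x)" for x
    using d1(1) d2(1) by (rule has_derivative_add)
  then show ?case using Suc.IH d1(2) d2(2) by (auto intro!: exI[of _ "\<lambda>x v. d1 x v + d2 x v"])
qed

lemma C_k_mult: "C_k k h1 \<Longrightarrow> C_k k h2 \<Longrightarrow> C_k k (\<lambda>x. h1 x * h2 x)"
proof (induction k arbitrary: h1 h2)
  case 0 then show ?case by (auto intro!: continuous_intros)
next
  case (Suc k)
  obtain d1 where d1: "\<And>x. (h1 has_derivative d1 x) (at x)" "\<And>v. C_k k (\<lambda>x. d1 x v)"
    using Suc.prems(1) by auto
  obtain d2 where d2: "\<And>x. (h2 has_derivative d2 x) (at x)" "\<And>v. C_k k (\<lambda>x. d2 x v)"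
    using Suc.prems(2) by auto
  have "((\<lambda>x. h1 x * h2 x) has_derivative (\<lambda>v. h1 x * d2 x v + d1 x v * h2 x)) (at x)" for x
    using d1(1) d2(1) by (rule has_derivative_mult)
  moreover have "C_k k h1" "C_k k h2" using Suc.prems C_k_mono_Suc by blast+
  ultimately show ?case using Suc.IH d1(2) d2(2)
    by (auto intro!: exI[of _ "\<lambda>x v. h1 x * d2 x v + d1 x v * h2 x"] C_k_add)
qed

lemma C_k_cmult: "C_k k h \<Longrightarrow> C_k k (\<lambda>x. c * h x)"
  by (rule C_k_mult[OF C_k_const])

lemma C_k_diff: "C_k k h1 \<Longrightarrow> C_k k h2 \<Longrightarrow> C_k k (\<lambda>x. h1 x - h2 x)"
  using C_k_add[of k h1 "\<lambda>x. (-1) * h2 x"] C_k_cmult[of k h2 "-1"] by simp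

lemma C_k_sum: "(\<And>i. i \<in> I \<Longrightarrow> C_k k (h i)) \<Longrightarrow> C_k k (\<lambda>x. \<Sum>i\<in>I. h i x)"
  by (induction I rule: infinite_finite_induct) (auto intro: C_k_add C_k_const)

lemma C_k_power: "C_k k h \<Longrightarrow> C_k k (\<lambda>x. h x ^ n)"
  by (induction n) (auto intro: C_k_mult C_k_const)

lemma C_k_affine: 
  assumes "C_k k h" shows "C_k k (\<lambda>x. h (a *\<^sub>R x + c))"
  using assms
proof (induction k arbitrary: h)
  case 0 then show ?case 
    by (auto intro!: continuous_intros continuous_on_compose2[of UNIV h])
next
  case (Suc k)
  obtain d where d: "\<And>x. (h has_derivative d x) (at x)" "\<And>v. C_k k (\<lambda>x. d x v)"
    using Suc.prems by auto
  have "((\<lambda>x. h (a *\<^sub>R x + c)) has_derivative (\<lambda>v. d (a *\<^sub>R x + c) (a *\<^sub>R v))) (at x)" for x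
    by (rule has_derivative_compose[OF _ d(1)]) (auto intro!: derivative_eq_intros)
  then show ?case using Suc.IH[OF d(2)]
    by (auto intro!: exI[of _ "\<lambda>x v. d (a *\<^sub>R x + c) (a *\<^sub>R v)"])
qed

text \<open>
  Composing a smooth function with a real function \<open>F 0\<close> whose derivatives never leave the span of a
  sequence \<open>F\<close>. The two-term recursion covers both powers and the flat exponentials below, and
  only derivatives at values that \<open>u\<close> attains are needed.
\<close>

lemma C_k_compose_family:
  fixes F :: "nat \<Rightarrow> real \<Rightarrow> real"
  assumes u: "\<And>k. C_k k u"
    and F: "\<And>j x. (F j has_real_derivative A j * F (Suc j) (u x) + B j * F (Suc (Suc j)) (u x)) (at (u x))"
  shows "C_k k (\<lambda>x. F j (u x))"
proof (induction k arbitrary: j)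
  have du: "\<exists>d. (\<forall>x. (u has_derivative d x) (at x)) \<and> (\<forall>v. C_k k (\<lambda>x. d x v))" for k
    using u[of "Suc k"] by simp
  have dF: "((\<lambda>x. F j (u x)) has_derivative 
      (\<lambda>v. (A j * F (Suc j) (u x) + B j * F (Suc (Suc j)) (u x)) * d v)) (at x)" 
    if "(u has_derivative d) (at x)" for j x d
    using has_derivative_compose[OF that F[of j x, unfolded has_field_derivative_def]] by simp
  {
    case 0
    from du obtain d where "\<forall>x. (u has_derivative d x) (at x)" by blast
    with dF show ?case
      by (auto intro!: continuous_at_imp_continuous_on has_derivative_continuous)
  next
    case (Suc k)
    from du obtain d where d: "\<forall>x. (u has_derivative d x) (at x)" "\<forall>v. C_k k (\<lambda>x. d x v)" by blast
    show ?case unfolding C_k.simps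
      by (rule exI[of _ "\<lambda>x v. (A j * F (Suc j) (u x) + B j * F (Suc (Suc j)) (u x)) * d x v"])
        (use d dF Suc.IH in \<open>auto intro!: C_k_mult C_k_add C_k_cmult\<close>)
  }
qed

lemma C_k_powr:
  fixes u :: "'a::euclidean_space \<Rightarrow> real"
  assumes u: "\<And>k. C_k k u" and pos: "\<And>x. u x > 0"
  shows "C_k k (\<lambda>x. u x powr b)"
proof -
  have "C_k k (\<lambda>x. (\<lambda>t. t powr (b - real 0)) (u x))"
    by (rule C_k_compose_family[where F = "\<lambda>j t. t powr (b - real j)" and A = "\<lambda>j. b - real j" and B="\<lambda>j. 0"])
      (use u pos in \<open>auto intro!: derivative_eq_intros simp: algebra_simps\<close>)
  then show ?thesis by simp
qed

text \<open>
  The functions \<open>exp (- 1 / t) / t ^ j\<close>, extended by zero: the derivative of each is a combination of the next two, so the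
  whole family, and with it the bump below, is smooth.
\<close>

definition flat :: "nat \<Rightarrow> real \<Rightarrow> real" where
  "flat j t = (if t > 0 then exp (- 1 / t) / t ^ j else 0)"

lemma flat_tendsto_0: "(flat j \<longlongrightarrow> 0) (at 0)"
proof -
  have "((\<lambda>t. exp (- 1 / t) / t ^ j) \<longlongrightarrow> 0) (at_right (0::real))"
  proof -
    have "((\<lambda>s. s ^ j / exp s) \<longlongrightarrow> (0::real)) at_top" by (rule tendsto_power_div_exp_0)
    then have "((\<lambda>t. inverse t ^ j / exp (inverse t)) \<longlongrightarrow> 0) (at_right (0::real))"
      by (rule filterlim_compose[OF _ filterlim_inverse_at_top_right])
    then show ?thesis by (simp add: exp_minus field_simps)
  qed
  then have "(flat j \<longlongrightarrow> 0) (at_right 0)"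
    by (rule Lim_transform_eventually) (auto simp: flat_def eventually_at_right_less intro!: eventually_at_rightI[of 0 1])
  moreover have "(flat j \<longlongrightarrow> 0) (at_left 0)"
    by (rule Lim_transform_eventually[OF tendsto_const]) (auto simp: flat_def intro!: eventually_at_leftI[of "-1" 0])
  ultimately show ?thesis by (simp add: filterlim_split_at)
qed

lemma flat_has_derivative:
  "(flat j has_real_derivative - real j * flat (Suc j) t + 1 * flat (Suc (Suc j)) t) (at t)"
proof -
  consider "t > 0" | "t < 0" | "t = 0" by linarith
  then show ?thesis
  proof cases
    case 1
    have "((\<lambda>t. exp (- 1 / t) * inverse t ^ j) has_real_derivative 
       - real j * flat (Suc j) t + 1 * flat (Suc (Suc j)) t) (at t)"
      using 1
      apply (cases j)
       apply (auto intro!: derivative_eq_intros simp: flat_def field_simps power2_eq_square)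
      subgoal for n by (cases n) auto
      done
    then show ?thesis
      by (rule has_field_derivative_transform_within_open[where S="{0<..}"]) 
        (use 1 in \<open>auto simp: flat_def field_simps\<close>)
  next
    case 2
    have "((\<lambda>t. 0) has_real_derivative - real j * flat (Suc j) t + 1 * flat (Suc (Suc j)) t) (at t)"
      using 2 by (auto simp: flat_def)
    then show ?thesis
      by (rule has_field_derivative_transform_within_open[where S="{..<0}"]) 
        (use 2 in \<open>auto simp: flat_def field_simps\<close>)
  next
    case 3
    have "((\<lambda>h. (flat j h - flat j 0) / (h - 0)) \<longlongrightarrow> 0) (at 0)"
      by (rule Lim_transform_eventually[OF flat_tendsto_0[of "Suc j"]]) 
        (auto simp: flat_def eventually_at_filter)
    then show ?thesis using 3 unfolding has_field_derivative_iff by (simp add: flat_def)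
  qed
qed

definition bump :: "'a::euclidean_space \<Rightarrow> real" where
  "bump x = flat 0 (1 - x \<bullet> x)"

lemma C_k_bump: "C_k k bump"
proof -
  have "C_k k (\<lambda>x. x \<bullet> x)" for k :: nat
  proof -
    have "C_k k (\<lambda>x::'b::euclidean_space. \<Sum>b\<in>Basis. (x \<bullet> b) * (x \<bullet> b))"
      by (intro C_k_sum C_k_mult C_k_bounded_linear bounded_linear_inner_left)
    then show ?thesis by (simp add: euclidean_inner[symmetric])
  qed
  then show ?thesis unfolding bump_def
    by (intro C_k_compose_family[where F=flat and A="\<lambda>j. - real j" and B="\<lambda>_. 1"] flat_has_derivative)
      (auto intro!: C_k_diff C_k_const)
qed

lemma inner_self_less_1: "x \<bullet> x < 1 \<longleftrightarrow> norm x < 1"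
  by (simp add: norm_eq_sqrt_inner)

lemma bump_nonneg: "bump x \<ge> 0" 
  by (simp add: bump_def flat_def)

lemma bump_le_1: "bump x \<le> 1" 
  by (simp add: bump_def flat_def)

lemma bump_pos_iff: "bump x > 0 \<longleftrightarrow> norm x < 1"
  by (simp add: bump_def flat_def inner_self_less_1)

lemma bump_eq_0_iff: "bump x = 0 \<longleftrightarrow> norm x \<ge> 1"
  using bump_pos_iff[of x] bump_nonneg[of x] by linarith

lemma bump_ge: 
  assumes "norm x \<le> 1/2" shows "bump x \<ge> exp (-2)"
proof -
  have "x \<bullet> x \<le> 1/4"
    using power_mono[OF assms, of 2] by (simp add: power2_norm_eq_inner power_divide)
  then have "1 / (1 - x \<bullet> x) \<le> 2" by (simp add: field_simps)
  then show ?thesis using \<open>x \<bullet> x \<le> 1/4\<close> by (simp add: bump_def flat_def)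
qed

text \<open>
  A derivative witnessing \<open>C_k k h\<close> could depend on \<open>k\<close>. As derivatives are unique, one serves all orders.
\<close>

lemma smoothE:
  assumes "\<And>k. C_k k h"
  obtains h' where "\<And>x. (h has_derivative h' x) (at x)" "\<And>v k. C_k k (\<lambda>x. h' x v)"
proof
  have ex: "\<exists>h'. (\<forall>x. (h has_derivative h' x) (at x)) \<and> (\<forall>v. C_k k (\<lambda>x. h' x v))" for k
    using assms[of "Suc k"] by simp
  show d: "(h has_derivative frechet_derivative h (at x)) (at x)" for x
    using ex[of 0] by (metis differentiable_def frechet_derivative_works)
  show "C_k k (\<lambda>x. frechet_derivative h (at x) v)" for k v
  proof -
    obtain h' where h': "\<forall>x. (h has_derivative h' x) (at x)" "C_k k (\<lambda>x. h' x v)"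
      using ex by blast
    have "h' x = frechet_derivative h (at x)" for x
      using h'(1) by (simp add: frechet_derivative_at)
    with h'(2) show ?thesis by simp
  qed
qed

lemma grad_inner:
  assumes "(h has_derivative h') (at x)" shows "grad h x \<bullet> v = h' v"
proof -
  have "frechet_derivative h (at x) = h'" using frechet_derivative_at[OF assms] by simp
  then have "grad h x \<bullet> v = (\<Sum>b\<in>Basis. h' b * (b \<bullet> v))"
    by (simp add: grad_def inner_sum_left)
  also have "\<dots> = h' (\<Sum>b\<in>Basis. (v \<bullet> b) *\<^sub>R b)"
    using has_derivative_linear[OF assms] by (simp add: linear_sum linear_scale inner_commute mult.commute)
  finally show ?thesis by (simp add: euclidean_representation)
qed

section \<open>Continuity of translations in Lebesgue spaces\<close>

lemma nn_integral_affine: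
  fixes f :: "'a::euclidean_space \<Rightarrow> ennreal"
  assumes [measurable]: "f \<in> borel_measurable borel" and c: "c \<noteq> 0"
  shows "(\<integral>\<^sup>+x. f x \<partial>lborel) = ennreal (\<bar>c\<bar> ^ DIM('a)) * (\<integral>\<^sup>+x. f (t + c *\<^sub>R x) \<partial>lborel)"
  by (subst lborel_affine[OF c, of t])
    (simp add: nn_integral_density nn_integral_distr nn_integral_cmult)

lemma nn_integral_translate:
  fixes f :: "'a::euclidean_space \<Rightarrow> ennreal"
  assumes "f \<in> borel_measurable borel"
  shows "(\<integral>\<^sup>+x. f (x + a) \<partial>lborel) = (\<integral>\<^sup>+x. f x \<partial>lborel)"
  using nn_integral_affine[OF assms, of 1 a] by (simp add: add.commute)

lemma lborel_distr_reflect: "distr lborel borel (\<lambda>h. x - h) = (lborel :: 'a::euclidean_space measure)"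
  using lborel_affine[of "-1" x] by (simp add: density_1)

lemma norm_powr_add_le:
  fixes x y :: "'b::real_normed_vector"
  assumes "p \<ge> 0"
  shows "norm (x + y) powr p \<le> 2 powr p * (norm x powr p + norm y powr p)"
proof -
  have "norm (x + y) powr p \<le> (2 * max (norm x) (norm y)) powr p"
    using norm_triangle_ineq[of x y] assms by (intro powr_mono2) auto
  also have "\<dots> = 2 powr p * (max (norm x) (norm y)) powr p"
    by (simp add: powr_mult)
  also have "\<dots> \<le> 2 powr p * (norm x powr p + norm y powr p)"
    by (intro mult_left_mono) (auto simp: max_def)
  finally show ?thesis .
qed

lemma nn_integral_norm_powr_add_le:
  fixes f g :: "'a \<Rightarrow> 'b::euclidean_space"
  assumes [measurable]: "f \<in> borel_measurable M" "g \<in> borel_measurable M" and "p \<ge> 0"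
  shows "(\<integral>\<^sup>+x. norm (f x + g x) powr p \<partial>M)
     \<le> 2 powr p * ((\<integral>\<^sup>+x. norm (f x) powr p \<partial>M) + (\<integral>\<^sup>+x. norm (g x) powr p \<partial>M))"
proof -
  have "(\<integral>\<^sup>+x. norm (f x + g x) powr p \<partial>M) 
      \<le> (\<integral>\<^sup>+x. ennreal (2 powr p) * (ennreal (norm (f x) powr p) + ennreal (norm (g x) powr p)) \<partial>M)"
    using norm_powr_add_le[OF \<open>p \<ge> 0\<close>] 
    by (intro nn_integral_mono) (simp flip: ennreal_plus ennreal_mult')
  then show ?thesis by (simp add: nn_integral_cmult nn_integral_add)
qed

text \<open>
  Truncation by projection to a ball: unlike setting large values to zero, it preserves continuity.
\<close>

definition clip :: "real \<Rightarrow> 'b::real_normed_vector \<Rightarrow> 'b" where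
  "clip M y = (M / max M (norm y)) *\<^sub>R y"

definition cutoff :: "real \<Rightarrow> 'a::real_normed_vector \<Rightarrow> real" where
  "cutoff M x = max 0 (min 1 (M + 1 - norm x))"

lemma continuous_clip: "M > 0 \<Longrightarrow> continuous_on A (clip M)"
  unfolding clip_def by (intro continuous_intros) (auto simp: max_def)

lemma continuous_cutoff: "continuous_on A (cutoff M)"
  unfolding cutoff_def by (intro continuous_intros)

lemma cutoff_bounds: "0 \<le> cutoff M x" "cutoff M x \<le> 1"
  by (auto simp: cutoff_def)

lemma norm_clip_le: "M > 0 \<Longrightarrow> norm (clip M y) \<le> norm y" "M > 0 \<Longrightarrow> norm (clip M y) \<le> M"
  by (auto simp: clip_def max_def field_simps mult_left_mono)

text \<open>
  Measurability provides continuous functions that converge almost everywhere, without any majorant. Clipping values and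
  restricting to a ball, both for the function and for its approximants, makes dominated convergence applicable.
\<close>

lemma Lp_approx_continuous:
  fixes f :: "'a::euclidean_space \<Rightarrow> 'b::euclidean_space"
  assumes [measurable]: "f \<in> borel_measurable borel" and p: "p > 0"
    and fin: "(\<integral>\<^sup>+x. norm (f x) powr p \<partial>lborel) < \<infinity>" and \<tau>: "\<tau> > 0"
  obtains c R where "continuous_on UNIV c" "\<And>x. norm x \<ge> R \<Longrightarrow> c x = 0"
    "(\<integral>\<^sup>+x. norm (f x - c x) powr p \<partial>lborel) \<le> ennreal \<tau>"
proof -
  define \<tau>' where "\<tau>' = \<tau> / (2 powr p * 2)"
  have \<tau>': "\<tau>' > 0" using \<tau> by (simp add: \<tau>'_def)
  define F where "F n x = cutoff (real (Suc n)) x *\<^sub>R clip (real (Suc n)) (f x)" for n x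
  have cm[measurable]: "clip (real (Suc n)) \<in> borel_measurable (borel::'b measure)" for n
    by (intro borel_measurable_continuous_onI continuous_clip) simp
  have cm'[measurable]: "cutoff M \<in> borel_measurable (borel::'a measure)" for M
    by (intro borel_measurable_continuous_onI continuous_cutoff)
  have [measurable]: "F n \<in> borel_measurable borel" for n
    unfolding F_def by measurable
  have F_lim: "(\<lambda>n. F n x) \<longlonglongrightarrow> f x" for x
  proof (rule tendsto_eventually)
    show "\<forall>\<^sub>F n in sequentially. F n x = f x"
    proof (rule eventually_sequentiallyI)
      fix n assume "nat \<lceil>max (norm x) (norm (f x))\<rceil> \<le> n"
      then have "norm x \<le> real n" "norm (f x) \<le> real n" by linarith+
      then show "F n x = f x" by (auto simp: F_def cutoff_def clip_def max_def)
    qed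
  qed
  have "(\<lambda>n. \<integral>\<^sup>+x. norm (f x - F n x) powr p \<partial>lborel) \<longlonglongrightarrow> (\<integral>\<^sup>+x. (0::ennreal) \<partial>(lborel::'a measure))"
  proof (rule nn_integral_dominated_convergence[where w="\<lambda>x. ennreal ((2 * norm (f x)) powr p)"])
    show "AE x in lborel. ennreal (norm (f x - F n x) powr p) \<le> ennreal ((2 * norm (f x)) powr p)" for n
    proof (intro AE_I2 ennreal_leI powr_mono2)
      fix x
      have "norm (F n x) \<le> 1 * norm (f x)"
        using cutoff_bounds[of "real (Suc n)" x] unfolding F_def norm_scaleR
        by (intro mult_mono norm_clip_le) auto
      then show "norm (f x - F n x) \<le> 2 * norm (f x)" 
        using norm_triangle_ineq4[of "f x" "F n x"] by simp
    qed (use p in auto)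
    show "(\<integral>\<^sup>+x. ennreal ((2 * norm (f x)) powr p) \<partial>lborel) < \<infinity>"
      using fin by (simp add: powr_mult ennreal_mult nn_integral_cmult ennreal_mult_less_top)
    show "AE x in lborel. (\<lambda>n. ennreal (norm (f x - F n x) powr p)) \<longlonglongrightarrow> 0"
    proof (rule AE_I2)
      fix x
      have "(\<lambda>n. norm (f x - F n x) powr p) \<longlonglongrightarrow> 0 powr p"
        using F_lim[of x] p by (intro tendsto_powr' tendsto_eq_intros) (auto intro!: tendsto_eq_intros)
      then show "(\<lambda>n. ennreal (norm (f x - F n x) powr p)) \<longlonglongrightarrow> 0"
        using tendsto_ennrealI by fastforce
    qed
  qed measurable
  then have "\<forall>\<^sub>F n in sequentially. (\<integral>\<^sup>+x. norm (f x - F n x) powr p \<partial>lborel) < ennreal \<tau>'"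
    using \<tau>' by (auto dest!: order_tendstoD(2)[of _ _ _ "ennreal \<tau>'"])
  then obtain n where n: "(\<integral>\<^sup>+x. norm (f x - F n x) powr p \<partial>lborel) < ennreal \<tau>'"
    by (auto simp: eventually_sequentially)
  define M where "M = real (Suc n)"
  have M: "M > 0" by (simp add: M_def)
  have "f measurable_on UNIV" 
  proof (rule lebesgue_measurable_imp_measurable_on)
    have "f \<in> borel_measurable lborel" by simp
    then show "f \<in> borel_measurable lebesgue" by (rule measurable_completion)
  qed simp
  then obtain N g where N: "negligible N" and g: "\<And>k. continuous_on UNIV (g k)" 
     "\<And>x. x \<notin> N \<Longrightarrow> (\<lambda>k. g k x) \<longlonglongrightarrow> f x"
    by (auto simp: measurable_on_def)
  define c where "c k x = cutoff M x *\<^sub>R clip M (g k x)" for k x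
  have c: "continuous_on UNIV (c k)" for k
    unfolding c_def using M g(1)
    by (intro continuous_intros continuous_cutoff continuous_on_compose2[OF continuous_clip[of M UNIV]]) auto
  have [measurable]: "c k \<in> borel_measurable borel" for k
    using c by (rule borel_measurable_continuous_onI)
  have c0: "c k x = 0" if "norm x \<ge> M + 1" for k x
    using that by (simp add: c_def cutoff_def)
  have AEN: "AE x in lborel. x \<notin> N"
    using N by (metis AE_completion_iff AE_not_in negligible_iff_null_sets)
  have "(\<lambda>k. \<integral>\<^sup>+x. norm (F n x - c k x) powr p \<partial>lborel) \<longlonglongrightarrow> (\<integral>\<^sup>+x. (0::ennreal) \<partial>(lborel::'a measure))"
  proof (rule nn_integral_dominated_convergence[where 
        w="\<lambda>x. ennreal ((2 * M) powr p) * indicator (cball 0 (M+1)) x"])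
    show "AE x in lborel. ennreal (norm (F n x - c k x) powr p) 
      \<le> ennreal ((2 * M) powr p) * indicator (cball 0 (M+1)) x" for k
    proof (rule AE_I2)
      fix x
      show "ennreal (norm (F n x - c k x) powr p) \<le> ennreal ((2 * M) powr p) * indicator (cball 0 (M+1)) x"
      proof (cases "norm x \<le> M + 1")
        case True
        have "norm (F n x) \<le> 1 * M" "norm (c k x) \<le> 1 * M"
          using cutoff_bounds[of M x] M unfolding F_def c_def norm_scaleR M_def[symmetric]
          by (intro mult_mono norm_clip_le; simp)+
        then have "norm (F n x - c k x) \<le> 2 * M" 
          using norm_triangle_ineq4[of "F n x" "c k x"] by simp
        with True p show ?thesis by (auto intro!: ennreal_leI powr_mono2)
      next
        case False
        then show ?thesis by (simp add: F_def c_def cutoff_def M_def)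
      qed
    qed
    show "(\<integral>\<^sup>+x. ennreal ((2 * M) powr p) * indicator (cball 0 (M+1)) x \<partial>(lborel::'a measure)) < \<infinity>"
      using emeasure_lborel_cball_finite[of "0::'a" "M + 1"]
      by (subst nn_integral_cmult_indicator) (simp_all add: ennreal_mult_less_top)
    show "AE x in lborel. (\<lambda>k. ennreal (norm (F n x - c k x) powr p)) \<longlonglongrightarrow> 0"
      using AEN
    proof (rule AE_mp, intro AE_I2 impI)
      fix x assume "x \<notin> N"
      have "(\<lambda>k. clip M (g k x)) \<longlonglongrightarrow> clip M (f x)"
        using continuous_clip[OF M, of "UNIV::'b set"] 
        by (intro isCont_tendsto_compose[OF _ g(2)[OF \<open>x \<notin> N\<close>], of "clip M"])
          (simp add: continuous_on_eq_continuous_at)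
      then have "(\<lambda>k. c k x) \<longlonglongrightarrow> F n x" 
        unfolding c_def F_def M_def[symmetric] by (intro tendsto_intros)
      then have "(\<lambda>k. norm (F n x - c k x) powr p) \<longlonglongrightarrow> 0 powr p"
        using p by (intro tendsto_powr' tendsto_eq_intros) (auto intro!: tendsto_eq_intros)
      then show "(\<lambda>k. ennreal (norm (F n x - c k x) powr p)) \<longlonglongrightarrow> 0"
        using tendsto_ennrealI by fastforce
    qed
    show "(\<lambda>x. ennreal (norm (F n x - c k x) powr p)) \<in> borel_measurable lborel" for k
      by measurable
    show "(\<lambda>x. ennreal ((2 * M) powr p) * indicator (cball 0 (M+1)) x) \<in> borel_measurable (lborel :: 'a measure)"
      by (intro borel_measurable_times_ennreal borel_measurable_const borel_measurable_indicator) simp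
  qed simp
  then have "\<forall>\<^sub>F k in sequentially. (\<integral>\<^sup>+x. norm (F n x - c k x) powr p \<partial>lborel) < ennreal \<tau>'"
    using \<tau>' by (auto dest!: order_tendstoD(2)[of _ _ _ "ennreal \<tau>'"])
  then obtain k where k: "(\<integral>\<^sup>+x. norm (F n x - c k x) powr p \<partial>lborel) < ennreal \<tau>'"
    by (auto simp: eventually_sequentially)
  have "(\<integral>\<^sup>+x. norm (f x - c k x) powr p \<partial>lborel)
     = (\<integral>\<^sup>+x. norm ((f x - F n x) + (F n x - c k x)) powr p \<partial>lborel)" by simp
  also have "\<dots> \<le> 2 powr p * ((\<integral>\<^sup>+x. norm (f x - F n x) powr p \<partial>lborel) 
      + (\<integral>\<^sup>+x. norm (F n x - c k x) powr p \<partial>lborel))"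
    using p by (intro nn_integral_norm_powr_add_le) auto
  also have "\<dots> \<le> 2 powr p * (ennreal \<tau>' + ennreal \<tau>')"
    using n k by (intro mult_left_mono add_mono) auto
  also have "\<dots> = ennreal \<tau>"
    using \<tau> by (simp add: \<tau>'_def flip: ennreal_plus ennreal_mult')
  finally show ?thesis using that[of "c k" "M + 1"] c c0 by blast
qed

lemma uniformly_continuous_compact_support:
  fixes K :: "'a::euclidean_space \<Rightarrow> 'b::euclidean_space"
  assumes "continuous_on UNIV K" "\<And>x. norm x > R \<Longrightarrow> K x = 0"
  shows "uniformly_continuous_on UNIV K"
proof -
  have "uniformly_continuous_on (cball 0 (\<bar>R\<bar>+1)) K"
    using assms(1) by (intro compact_uniformly_continuous) (auto intro: continuous_on_subset)
  note uc = this[unfolded uniformly_continuous_on_def, rule_format]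
  show ?thesis
    unfolding uniformly_continuous_on_def
  proof (intro allI impI)
    fix e :: real assume "e > 0"
    from uc[OF this] obtain d where d: "d > 0"
      "\<And>x y. x \<in> cball 0 (\<bar>R\<bar>+1) \<Longrightarrow> y \<in> cball 0 (\<bar>R\<bar>+1) \<Longrightarrow> dist y x < d \<Longrightarrow> dist (K y) (K x) < e"
      by blast
    have "dist (K y) (K x) < e" if "dist y x < min d 1" for x y
    proof (cases "norm x \<le> R \<or> norm y \<le> R")
      case True
      then have "norm x \<le> \<bar>R\<bar> + 1" "norm y \<le> \<bar>R\<bar> + 1"
        using that norm_triangle_ineq2[of x y] norm_triangle_ineq2[of y x]
        by (auto simp: dist_norm norm_minus_commute)
      then show ?thesis using that by (intro d(2)) auto
    next
      case False
      then show ?thesis using assms(2)[of x] assms(2)[of y] \<open>e > 0\<close> by auto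
    qed
    then show "\<exists>d>0. \<forall>x\<in>UNIV. \<forall>x'\<in>UNIV. dist x' x < d \<longrightarrow> dist (K x') (K x) < e"
      using d(1) by (intro exI[of _ "min d 1"]) auto
  qed
qed

text \<open>
  For continuous functions of compact support this is uniform continuity. The general case follows by approximation,
  since translations preserve the norm.
\<close>

lemma Lp_translation_continuous:
  fixes f :: "'a::euclidean_space \<Rightarrow> 'b::euclidean_space"
  assumes [measurable]: "f \<in> borel_measurable borel" and p: "p > 0"
    and fin: "(\<integral>\<^sup>+x. norm (f x) powr p \<partial>lborel) < \<infinity>" and \<tau>: "\<tau> > 0"
  obtains \<delta> where "\<delta> > 0" 
    "\<And>h. norm h < \<delta> \<Longrightarrow> (\<integral>\<^sup>+x. norm (f (x - h) - f x) powr p \<partial>lborel) \<le> ennreal \<tau>"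
proof -
  define B where "B = 2 powr p * (1 + 2 powr p * 2)"
  have B: "B > 0" by (auto simp: B_def intro!: mult_pos_pos add_pos_pos)
  define \<tau>' where "\<tau>' = \<tau> / B"
  have \<tau>': "\<tau>' > 0" using \<tau> B by (simp add: \<tau>'_def)
  obtain c R where c: "continuous_on UNIV c" "\<And>x. norm x \<ge> R \<Longrightarrow> c x = 0"
    "(\<integral>\<^sup>+x. norm (f x - c x) powr p \<partial>lborel) \<le> ennreal \<tau>'"
    using Lp_approx_continuous[OF assms(1) p fin \<tau>'] by blast
  have [measurable]: "c \<in> borel_measurable borel"
    using c(1) by (rule borel_measurable_continuous_onI)
  define m where "m = measure lborel (cball (0::'a) (\<bar>R\<bar>+1))"
  define \<sigma> where "\<sigma> = (\<tau>' / (m + 1)) powr (1 / p)"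
  have m: "m \<ge> 0" by (simp add: m_def)
  have \<sigma>: "\<sigma> > 0" "\<sigma> powr p = \<tau>' / (m + 1)" using \<tau>' m p by (simp_all add: \<sigma>_def powr_powr)
  have "uniformly_continuous_on UNIV c"
    by (rule uniformly_continuous_compact_support[OF c(1), of R]) (use c(2) in auto)
  then obtain \<delta>0 where \<delta>0: "\<delta>0 > 0" "\<And>x y. dist y x < \<delta>0 \<Longrightarrow> dist (c y) (c x) < \<sigma>"
    unfolding uniformly_continuous_on_def using \<sigma>(1) by (metis UNIV_I)
  define \<delta> where "\<delta> = min \<delta>0 1"
  show ?thesis
  proof (rule that[of \<delta>])
    show "\<delta> > 0" using \<delta>0 by (simp add: \<delta>_def)
    fix h :: 'a assume h: "norm h < \<delta>"
    have h1: "norm h < 1" "norm h < \<delta>0" using h by (auto simp: \<delta>_def)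
    have pt: "norm (c (x - h) - c x) powr p \<le> \<sigma> powr p * indicator (cball 0 (\<bar>R\<bar>+1)) x" for x
    proof (cases "norm x < R \<or> norm (x - h) < R")
      case True
      then have "norm x \<le> \<bar>R\<bar> + 1" "norm (x - h) \<le> \<bar>R\<bar> + 1"
        using h1 norm_triangle_ineq4[of x h] norm_triangle_ineq[of "x - h" h] by auto
      moreover have "dist (c (x - h)) (c x) < \<sigma>"
        using \<delta>0(2)[of "x - h" x] h1 by (simp add: dist_norm)
      ultimately show ?thesis using p by (auto simp: dist_norm intro!: powr_mono2)
    next
      case False
      then show ?thesis using c(2)[of x] c(2)[of "x - h"] by auto
    qed
    have c_est: "(\<integral>\<^sup>+x. norm (c (x - h) - c x) powr p \<partial>lborel) \<le> ennreal \<tau>'"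
    proof -
      have "(\<integral>\<^sup>+x. norm (c (x - h) - c x) powr p \<partial>lborel) 
          \<le> (\<integral>\<^sup>+x. ennreal (\<sigma> powr p) * indicator (cball (0::'a) (\<bar>R\<bar>+1)) x \<partial>lborel)"
      proof (rule nn_integral_mono)
        fix x
        show "ennreal (norm (c (x - h) - c x) powr p) \<le> ennreal (\<sigma> powr p) * indicator (cball 0 (\<bar>R\<bar>+1)) x"
          using ennreal_leI[OF pt[of x]] by (simp add: ennreal_mult' ennreal_indicator)
      qed
      also have "\<dots> = ennreal (\<sigma> powr p) * ennreal m"
      proof -
        have "emeasure lborel (cball (0::'a) (\<bar>R\<bar>+1)) = ennreal m"
          unfolding m_def using emeasure_lborel_cball_finite[of "0::'a" "\<bar>R\<bar> + 1"]
          by (intro emeasure_eq_ennreal_measure) auto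
        then show ?thesis by (subst nn_integral_cmult_indicator) auto
      qed
      also have "\<dots> \<le> ennreal \<tau>'"
      proof -
        have "\<sigma> powr p * m \<le> \<tau>'" 
          unfolding \<sigma>(2) using m \<tau>' by (simp add: divide_le_eq mult_left_mono)
        then show ?thesis by (simp add: ennreal_leI flip: ennreal_mult')
      qed
      finally show ?thesis .
    qed
    have trans: "(\<integral>\<^sup>+x. norm (f (x - h) - c (x - h)) powr p \<partial>lborel) \<le> ennreal \<tau>'"
      using c(3) nn_integral_translate[of "\<lambda>x. norm (f x - c x) powr p" "-h"] by simp
    have "(\<integral>\<^sup>+x. norm (f (x - h) - f x) powr p \<partial>lborel)
      = (\<integral>\<^sup>+x. norm ((c x - f x) + ((f (x - h) - c (x - h)) + (c (x - h) - c x))) powr p \<partial>lborel)"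
      by (simp add: algebra_simps)
    also have "\<dots> \<le> 2 powr p * ((\<integral>\<^sup>+x. norm (c x - f x) powr p \<partial>lborel)
        + (\<integral>\<^sup>+x. norm ((f (x - h) - c (x - h)) + (c (x - h) - c x)) powr p \<partial>lborel))"
      using p by (intro nn_integral_norm_powr_add_le) auto
    also have "\<dots> \<le> 2 powr p * ((\<integral>\<^sup>+x. norm (c x - f x) powr p \<partial>lborel)
        + 2 powr p * ((\<integral>\<^sup>+x. norm (f (x - h) - c (x - h)) powr p \<partial>lborel)
          + (\<integral>\<^sup>+x. norm (c (x - h) - c x) powr p \<partial>lborel)))"
      using p by (intro mult_left_mono add_left_mono nn_integral_norm_powr_add_le) auto
    also have "\<dots> \<le> 2 powr p * (ennreal \<tau>' + 2 powr p * (ennreal \<tau>' + ennreal \<tau>'))"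
      using c(3) trans c_est by (intro mult_left_mono add_mono) (auto simp: norm_minus_commute)
    also have "\<dots> = ennreal (2 powr p * (\<tau>' + 2 powr p * (\<tau>' + \<tau>')))"
      using \<tau>' by (simp flip: ennreal_plus ennreal_mult')
    also have "\<dots> = ennreal (B * \<tau>')"
      by (rule arg_cong[where f=ennreal]) (simp add: B_def ring_distribs)
    also have "\<dots> = ennreal \<tau>" using B by (simp add: \<tau>'_def)
    finally show "(\<integral>\<^sup>+x. norm (f (x - h) - f x) powr p \<partial>lborel) \<le> ennreal \<tau>" .
  qed
qed

section \<open>Mollification\<close>

lemma powr_ge_tangent:
  fixes a A p :: real
  assumes "p \<ge> 1" "a \<ge> 0" "A > 0"
  shows "a powr p \<ge> A powr p + p * A powr (p - 1) * (a - A)"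
proof (cases "a = 0")
  case True
  have "A powr p = A powr (p - 1) * A" using assms powr_add[of A "p - 1" 1] by simp
  moreover have "0 \<le> (p - 1) * (A powr (p - 1) * A)" using assms by simp
  ultimately have "A powr p + p * A powr (p - 1) * (0 - A) \<le> 0" by (simp add: algebra_simps)
  then show ?thesis using True by simp
next
  case False
  then have "a powr p - A powr p \<ge> (p * A powr (p - 1)) * (a - A)"
    using assms
    by (intro convex_on_imp_above_tangent[where A="{0<..}"] powr_convex)
      (auto intro!: derivative_eq_intros simp: interior_open)
  then show ?thesis by simp
qed

text \<open>Jensen's inequality: the tangent at the mean lies below the power function, and integrates to its value there.\<close>

lemma powr_integral_le:
  fixes k g :: "'x \<Rightarrow> real"
  assumes k: "integrable M k" "(\<integral>h. k h \<partial>M) = 1" "\<And>h. k h \<ge> 0"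
    and [measurable]: "g \<in> borel_measurable M" and g: "\<And>h. g h \<ge> 0"
    and p: "p \<ge> 1"
  shows "ennreal ((\<integral>h. k h * g h \<partial>M) powr p) \<le> (\<integral>\<^sup>+h. ennreal (k h) * ennreal (g h powr p) \<partial>M)"
proof -
  have [measurable]: "k \<in> borel_measurable M" using k(1) by auto
  define A where "A = (\<integral>h. k h * g h \<partial>M)"
  show ?thesis
  proof (cases "A > 0 \<and> (\<integral>\<^sup>+h. ennreal (k h) * ennreal (g h powr p) \<partial>M) < \<infinity>")
    case False
    have "A \<ge> 0" unfolding A_def using k(3) g by (intro integral_nonneg_AE AE_I2 mult_nonneg_nonneg)
    with False p consider "A = 0" | "(\<integral>\<^sup>+h. ennreal (k h) * ennreal (g h powr p) \<partial>M) = \<infinity>"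
      by (auto simp: less_top[symmetric])
    then show ?thesis by cases (use p in \<open>auto simp: A_def[symmetric]\<close>)
  next
    case True
    then have A: "A > 0" by simp
    have fin: "integrable M (\<lambda>h. k h * g h powr p)"
      using True k(3) by (intro integrableI_nonneg) (auto simp: ennreal_mult)
    have kg: "integrable M (\<lambda>h. k h * g h)"
      using A not_integrable_integral_eq[of M "\<lambda>h. k h * g h"] by (force simp: A_def)
    have "A powr p = (\<integral>h. k h * (A powr p) + p * A powr (p - 1) * (k h * g h - k h * A) \<partial>M)"
      using k(1,2) kg by (simp add: A_def[symmetric])
    also have "\<dots> \<le> (\<integral>h. k h * g h powr p \<partial>M)"
    proof (rule integral_mono[OF _ fin])
      fix h
      have "k h * (A powr p + p * A powr (p - 1) * (g h - A)) \<le> k h * g h powr p"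
        using powr_ge_tangent[OF p g A] k(3) by (intro mult_left_mono)
      then show "k h * A powr p + p * A powr (p - 1) * (k h * g h - k h * A) \<le> k h * g h powr p"
        by (simp add: algebra_simps)
    qed (use k(1) kg in auto)
    finally have "ennreal (A powr p) \<le> ennreal (\<integral>h. k h * g h powr p \<partial>M)" by (rule ennreal_leI)
    also have "\<dots> = (\<integral>\<^sup>+h. ennreal (k h * g h powr p) \<partial>M)"
      using fin k(3) by (intro nn_integral_eq_integral[symmetric]) auto
    finally show ?thesis using k(3) by (simp add: A_def ennreal_mult)
  qed
qed

text \<open>
  Dividing by the integral at the same radius gives total mass one without computing how integrals scale.
\<close>

definition mollifier :: "real \<Rightarrow> 'a::euclidean_space \<Rightarrow> real" where
  "mollifier \<epsilon> x = bump (x /\<^sub>R \<epsilon>) / (\<integral>y. bump (y /\<^sub>R \<epsilon>) \<partial>(lborel :: 'a measure))"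

definition mollify :: "real \<Rightarrow> ('a::euclidean_space \<Rightarrow> 'b::euclidean_space) \<Rightarrow> 'a \<Rightarrow> 'b" where
  "mollify \<epsilon> f x = (\<integral>z. mollifier \<epsilon> (x - z) *\<^sub>R f z \<partial>lborel)"

lemma integrable_compact_support:
  fixes K :: "'a::euclidean_space \<Rightarrow> 'b::euclidean_space"
  assumes "continuous_on UNIV K" "\<And>x. norm x \<ge> R \<Longrightarrow> K x = 0"
  shows "integrable lborel K" "\<exists>B. \<forall>x. norm (K x) \<le> B"
proof -
  have "bounded (K ` cball 0 \<bar>R\<bar>)"
    using assms(1) by (intro compact_imp_bounded compact_continuous_image) (auto intro: continuous_on_subset)
  then obtain B where B: "\<And>x. norm x \<le> \<bar>R\<bar> \<Longrightarrow> norm (K x) \<le> B"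
    unfolding bounded_iff by (metis imageI mem_cball_0)
  have "norm (K x) \<le> \<bar>B\<bar>" for x
    using order_trans[OF B[of x] abs_ge_self] assms(2)[of x] by (cases "norm x \<le> \<bar>R\<bar>") auto
  then show "\<exists>B. \<forall>x. norm (K x) \<le> B" by blast
  have "integrable lborel (\<lambda>x. indicator (cball 0 \<bar>R\<bar>) x *\<^sub>R K x)"
    using borel_integrable_compact[of "cball 0 \<bar>R\<bar>" K] continuous_on_subset[OF assms(1)]
    by (auto simp: set_integrable_def)
  also have "(\<lambda>x. indicator (cball 0 \<bar>R\<bar>) x *\<^sub>R K x) = K"
    using assms(2) by (auto simp: indicator_def fun_eq_iff)
  finally show "integrable lborel K" .
qed

context
  fixes \<epsilon> :: real assumes \<epsilon>: "\<epsilon> > 0"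
begin

lemma mollifier_support_aux: "bump (x /\<^sub>R \<epsilon>) = 0 \<longleftrightarrow> norm x \<ge> \<epsilon>" for x :: "'a::euclidean_space"
  using \<epsilon> by (simp add: bump_eq_0_iff field_simps)

lemma C_k_scaled_bump: "C_k k (\<lambda>x. bump (x /\<^sub>R \<epsilon>))"
  using C_k_affine[OF C_k_bump, of k "inverse \<epsilon>" 0] by simp

lemma integrable_scaled_bump: "integrable lborel (\<lambda>x::'a::euclidean_space. bump (x /\<^sub>R \<epsilon>))"
  by (rule integrable_compact_support(1)[where R=\<epsilon>]) 
    (auto intro: C_k_imp_continuous C_k_scaled_bump simp: mollifier_support_aux)

lemma integral_scaled_bump_pos: "(\<integral>x. bump (x /\<^sub>R \<epsilon>) \<partial>(lborel :: 'a::euclidean_space measure)) > 0"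
proof -
  have "(\<integral>x. bump (x /\<^sub>R \<epsilon>) \<partial>(lborel :: 'a measure)) \<noteq> 0"
  proof
    assume "(\<integral>x. bump (x /\<^sub>R \<epsilon>) \<partial>(lborel :: 'a measure)) = 0"
    then have "AE x in lborel. bump ((x::'a) /\<^sub>R \<epsilon>) = 0"
      using integrable_scaled_bump by (subst (asm) integral_nonneg_eq_0_iff_AE) (auto simp: bump_nonneg)
    then have "AE x in lborel. (x::'a) \<notin> ball 0 \<epsilon>"
      by eventually_elim (auto simp: mollifier_support_aux)
    then have "emeasure lborel (ball (0::'a) \<epsilon>) = 0"
      by (subst (asm) AE_iff_measurable[of "ball 0 \<epsilon>"]) auto
    then have "measure lborel (ball (0::'a) \<epsilon>) = 0" by (simp add: measure_def)
    then show False using \<epsilon> by simp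
  qed
  moreover have "(\<integral>x. bump (x /\<^sub>R \<epsilon>) \<partial>(lborel :: 'a measure)) \<ge> 0" by (simp add: bump_nonneg)
  ultimately show ?thesis by simp
qed

lemma C_k_mollifier: "C_k k (mollifier \<epsilon>)"
  unfolding mollifier_def divide_inverse using C_k_mult[OF C_k_scaled_bump C_k_const] .

lemma mollifier_nonneg: "mollifier \<epsilon> (x::'a::euclidean_space) \<ge> 0"
  unfolding mollifier_def by (intro divide_nonneg_nonneg bump_nonneg less_imp_le integral_scaled_bump_pos)

lemma mollifier_eq_0_iff: "mollifier \<epsilon> (x::'a::euclidean_space) = 0 \<longleftrightarrow> norm x \<ge> \<epsilon>"
  using integral_scaled_bump_pos[where 'a='a] by (simp add: mollifier_def mollifier_support_aux)

lemma integrable_mollifier: "integrable lborel (mollifier \<epsilon> :: 'a::euclidean_space \<Rightarrow> real)"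
  unfolding mollifier_def by (intro integrable_divide_zero integrable_scaled_bump)

lemma integral_mollifier: "(\<integral>x. mollifier \<epsilon> (x::'a::euclidean_space) \<partial>lborel) = 1"
  unfolding mollifier_def using integral_scaled_bump_pos[where 'a='a] by simp

lemma borel_measurable_mollifier [measurable]: "mollifier \<epsilon> \<in> borel_measurable (borel :: 'a::euclidean_space measure)"
  by (intro borel_measurable_continuous_onI C_k_imp_continuous C_k_mollifier)

lemma borel_measurable_mollify [measurable]:
  assumes [measurable]: "f \<in> borel_measurable (borel :: 'a::euclidean_space measure)"
  shows "mollify \<epsilon> f \<in> borel_measurable borel"
  unfolding mollify_def[abs_def] by measurable

lemma integrable_mollify:
  assumes "integrable lborel (f :: 'a::euclidean_space \<Rightarrow> 'b::euclidean_space)"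
  shows "integrable lborel (\<lambda>z. mollifier \<epsilon> (x - z) *\<^sub>R f z)"
proof -
  obtain B where B: "\<And>x. norm (mollifier \<epsilon> (x::'a)) \<le> B"
    using integrable_compact_support(2)[of "mollifier \<epsilon>" \<epsilon>] C_k_imp_continuous[OF C_k_mollifier]
    by (auto simp: mollifier_eq_0_iff)
  show ?thesis
  proof (rule Bochner_Integration.integrable_bound[of _ "\<lambda>z. B *\<^sub>R f z"])
    show "AE z in lborel. norm (mollifier \<epsilon> (x - z) *\<^sub>R f z) \<le> norm (B *\<^sub>R f z)"
      using B by (auto intro!: mult_right_mono order_trans[OF _ abs_ge_self])
  qed (use assms in \<open>auto dest!: borel_measurable_integrable\<close>)
qed

lemma mollify_swap:
  assumes "f \<in> borel_measurable (borel :: 'a::euclidean_space measure)"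
  shows "mollify \<epsilon> f x = (\<integral>h. mollifier \<epsilon> h *\<^sub>R f (x - h) \<partial>lborel)"
proof -
  have [measurable]: "f \<in> borel_measurable borel" by fact
  have "mollify \<epsilon> f x = (\<integral>z. mollifier \<epsilon> (x - z) *\<^sub>R f z \<partial>distr lborel borel (\<lambda>h. x - h))"
    unfolding lborel_distr_reflect mollify_def ..
  also have "\<dots> = (\<integral>h. mollifier \<epsilon> h *\<^sub>R f (x - h) \<partial>lborel)"
    by (subst integral_distr) auto
  finally show ?thesis .
qed

lemma mollify_nonneg:
  assumes "\<And>x. (f :: 'a::euclidean_space \<Rightarrow> real) x \<ge> 0" shows "mollify \<epsilon> f x \<ge> 0"
  unfolding mollify_def using assms by (simp add: mollifier_nonneg)

text \<open>
  The error of a mollification is an average of the errors of translations by less than \<open>\<epsilon>\<close>. By Jensen's inequality and Tonelli's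
  theorem its \<open>p\<close>-th power integral is at most the worst of theirs.
\<close>

lemma mollify_Lp_close:
  fixes f :: "'a::euclidean_space \<Rightarrow> 'b::euclidean_space"
  assumes f: "integrable lborel f" and p: "p \<ge> 1"
    and \<tau>: "\<And>h. norm h < \<epsilon> \<Longrightarrow> (\<integral>\<^sup>+x. norm (f (x - h) - f x) powr p \<partial>lborel) \<le> ennreal \<tau>"
  shows "(\<integral>\<^sup>+x. norm (mollify \<epsilon> f x - f x) powr p \<partial>lborel) \<le> ennreal \<tau>"
proof -
  have [measurable]: "f \<in> borel_measurable borel" using f by auto
  have pt: "ennreal (norm (mollify \<epsilon> f x - f x) powr p) 
      \<le> (\<integral>\<^sup>+h. ennreal (mollifier \<epsilon> h) * ennreal (norm (f (x - h) - f x) powr p) \<partial>lborel)" for x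
  proof -
    have int: "integrable lborel (\<lambda>h. mollifier \<epsilon> h *\<^sub>R f (x - h))"
    proof -
      have "integrable (distr lborel borel (\<lambda>h. x - h)) (\<lambda>z. mollifier \<epsilon> (x - z) *\<^sub>R f z)"
        unfolding lborel_distr_reflect by (rule integrable_mollify[OF f])
      then show ?thesis by (subst (asm) integrable_distr_eq) auto
    qed
    have "mollify \<epsilon> f x - f x 
        = (\<integral>h. mollifier \<epsilon> h *\<^sub>R f (x - h) \<partial>lborel) - (\<integral>h. mollifier \<epsilon> h *\<^sub>R f x \<partial>(lborel :: 'a measure))"
      by (simp add: mollify_swap integral_mollifier integrable_mollifier)
    also have "\<dots> = (\<integral>h. mollifier \<epsilon> h *\<^sub>R f (x - h) - mollifier \<epsilon> h *\<^sub>R f x \<partial>lborel)"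
      using int integrable_mollifier[where 'a='a] by (intro Bochner_Integration.integral_diff[symmetric]) auto
    also have "\<dots> = (\<integral>h. mollifier \<epsilon> h *\<^sub>R (f (x - h) - f x) \<partial>lborel)"
      by (simp add: scaleR_diff_right)
    finally have "norm (mollify \<epsilon> f x - f x) \<le> (\<integral>h. norm (mollifier \<epsilon> h *\<^sub>R (f (x - h) - f x)) \<partial>lborel)"
      using integral_norm_bound by metis
    also have "\<dots> = (\<integral>h. mollifier \<epsilon> h * norm (f (x - h) - f x) \<partial>lborel)"
      by (simp add: mollifier_nonneg)
    finally have "norm (mollify \<epsilon> f x - f x) powr p \<le> (\<integral>h. mollifier \<epsilon> h * norm (f (x - h) - f x) \<partial>lborel) powr p"
      using p by (intro powr_mono2) auto
    then have "ennreal (norm (mollify \<epsilon> f x - f x) powr p) 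
        \<le> ennreal ((\<integral>h. mollifier \<epsilon> h * norm (f (x - h) - f x) \<partial>lborel) powr p)"
      by (rule ennreal_leI)
    also have "\<dots> \<le> (\<integral>\<^sup>+h. ennreal (mollifier \<epsilon> h) * ennreal (norm (f (x - h) - f x) powr p) \<partial>lborel)"
      using p by (intro powr_integral_le) 
        (auto simp: integral_mollifier mollifier_nonneg intro: integrable_mollifier)
    finally show ?thesis .
  qed
  have "(\<integral>\<^sup>+x. norm (mollify \<epsilon> f x - f x) powr p \<partial>lborel)
    \<le> (\<integral>\<^sup>+x. \<integral>\<^sup>+h. ennreal (mollifier \<epsilon> h) * ennreal (norm (f (x - h) - f x) powr p) \<partial>lborel \<partial>lborel)"
    using pt by (intro nn_integral_mono) 
  also have "\<dots> = (\<integral>\<^sup>+h. \<integral>\<^sup>+x. ennreal (mollifier \<epsilon> h) * ennreal (norm (f (x - h) - f x) powr p) \<partial>lborel \<partial>lborel)"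
    by (rule lborel_pair.Fubini') measurable
  also have "\<dots> = (\<integral>\<^sup>+h. ennreal (mollifier \<epsilon> h) * (\<integral>\<^sup>+x. ennreal (norm (f (x - h) - f x) powr p) \<partial>lborel) \<partial>lborel)"
    by (intro nn_integral_cong nn_integral_cmult) measurable
  also have "\<dots> \<le> (\<integral>\<^sup>+h. ennreal (mollifier \<epsilon> h) * ennreal \<tau> \<partial>(lborel::'a measure))"
  proof (intro nn_integral_mono)
    fix h :: 'a
    show "ennreal (mollifier \<epsilon> h) * (\<integral>\<^sup>+x. ennreal (norm (f (x - h) - f x) powr p) \<partial>lborel) 
        \<le> ennreal (mollifier \<epsilon> h) * ennreal \<tau>"
      using \<tau>[of h] mollifier_eq_0_iff[of h] by (cases "norm h < \<epsilon>") (auto intro: mult_left_mono)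
  qed
  also have "\<dots> = ennreal \<tau>"
    using integrable_mollifier[where 'a='a] integral_mollifier[where 'a='a]
    by (simp add: nn_integral_multc nn_integral_eq_integral mollifier_nonneg)
  finally show ?thesis .
qed

end

text \<open>
  Along a fast enough sequence of radii the mollifications of two functions converge almost everywhere,
  and those of the second one have a common integrable majorant: if the \<open>L\<^sup>p\<close> errors are at
  most \<open>2\<^sup>-\<^sup>n\<close>, then the sum of all their \<open>p\<close>-th powers is integrable, hence finite almost everywhere.
  This is what later allows limits to be taken by dominated convergence.
\<close>

lemma mollify_sequence:
  fixes f :: "'a::euclidean_space \<Rightarrow> 'b::euclidean_space" and g :: "'a \<Rightarrow> 'c::euclidean_space"
  assumes f: "integrable lborel f" "(\<integral>\<^sup>+x. norm (f x) powr p \<partial>lborel) < \<infinity>"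
    and g: "integrable lborel g" "(\<integral>\<^sup>+x. norm (g x) powr p \<partial>lborel) < \<infinity>"
    and p: "p \<ge> 1" and e0: "e0 > 0"
  obtains \<epsilon> :: "nat \<Rightarrow> real" and W :: "'a \<Rightarrow> ennreal"
  where "\<And>n. 0 < \<epsilon> n" "\<And>n. \<epsilon> n < e0"
    "AE x in lborel. (\<lambda>n. mollify (\<epsilon> n) f x) \<longlonglongrightarrow> f x"
    "AE x in lborel. (\<lambda>n. mollify (\<epsilon> n) g x) \<longlonglongrightarrow> g x"
    "W \<in> borel_measurable borel" "(\<integral>\<^sup>+x. W x \<partial>lborel) < \<infinity>"
    "\<And>n x. ennreal (norm (mollify (\<epsilon> n) g x) powr p) \<le> W x"
proof -
  have fg[measurable]: "f \<in> borel_measurable borel" "g \<in> borel_measurable borel" using f g by auto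
  have "\<exists>e. 0 < e \<and> e < e0 \<and> 
      (\<integral>\<^sup>+x. norm (mollify e f x - f x) powr p \<partial>lborel) \<le> ennreal ((1/2)^n) \<and>
      (\<integral>\<^sup>+x. norm (mollify e g x - g x) powr p \<partial>lborel) \<le> ennreal ((1/2)^n)" for n
  proof -
    obtain d1 where d1: "d1 > 0" 
      "\<And>h. norm h < d1 \<Longrightarrow> (\<integral>\<^sup>+x. norm (f (x - h) - f x) powr p \<partial>lborel) \<le> ennreal ((1/2)^n)"
      using Lp_translation_continuous[of f p "(1/2)^n"] f p by auto
    obtain d2 where d2: "d2 > 0" 
      "\<And>h. norm h < d2 \<Longrightarrow> (\<integral>\<^sup>+x. norm (g (x - h) - g x) powr p \<partial>lborel) \<le> ennreal ((1/2)^n)"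
      using Lp_translation_continuous[of g p "(1/2)^n"] g p by auto
    define e where "e = min (min d1 d2) (e0 / 2)"
    have e: "0 < e" "e \<le> d1" "e \<le> d2" "e < e0" using d1(1) d2(1) e0 by (auto simp: e_def)
    have "(\<integral>\<^sup>+x. norm (mollify e f x - f x) powr p \<partial>lborel) \<le> ennreal ((1/2)^n)"
      by (rule mollify_Lp_close[OF e(1) f(1) p d1(2)]) (use e in linarith)
    moreover have "(\<integral>\<^sup>+x. norm (mollify e g x - g x) powr p \<partial>lborel) \<le> ennreal ((1/2)^n)"
      by (rule mollify_Lp_close[OF e(1) g(1) p d2(2)]) (use e in linarith)
    ultimately show ?thesis using e by blast
  qed
  then have "\<exists>\<epsilon>. \<forall>n. 0 < \<epsilon> n \<and> \<epsilon> n < e0 \<and> 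
      (\<integral>\<^sup>+x. norm (mollify (\<epsilon> n) f x - f x) powr p \<partial>lborel) \<le> ennreal ((1/2)^n) \<and>
      (\<integral>\<^sup>+x. norm (mollify (\<epsilon> n) g x - g x) powr p \<partial>lborel) \<le> ennreal ((1/2)^n)"
    by (intro choice allI)
  then obtain \<epsilon> where \<epsilon>: "\<And>n. 0 < \<epsilon> n" "\<And>n. \<epsilon> n < e0"
      "\<And>n. (\<integral>\<^sup>+x. norm (mollify (\<epsilon> n) f x - f x) powr p \<partial>lborel) \<le> ennreal ((1/2)^n)"
      "\<And>n. (\<integral>\<^sup>+x. norm (mollify (\<epsilon> n) g x - g x) powr p \<partial>lborel) \<le> ennreal ((1/2)^n)"
    by blast
  have [measurable]: "mollify (\<epsilon> n) f \<in> borel_measurable borel" "mollify (\<epsilon> n) g \<in> borel_measurable borel" for n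
    using \<epsilon>(1) by auto
  have geo: "(\<Sum>n. ennreal ((1/2)^n)) = ennreal 2"
    by (rule suminf_ennreal_eq) (use geometric_sums[of "1/2::real"] in auto)
  have AE_lim: "(AE x in lborel. (\<lambda>n. mollify (\<epsilon> n) F x) \<longlonglongrightarrow> F x) \<and>
      (\<integral>\<^sup>+x. (\<Sum>n. ennreal (norm (mollify (\<epsilon> n) F x - F x) powr p)) \<partial>lborel) < \<infinity>"
    if [measurable]: "F \<in> borel_measurable borel" and
      F: "\<And>n. (\<integral>\<^sup>+x. norm (mollify (\<epsilon> n) F x - F x) powr p \<partial>lborel) \<le> ennreal ((1/2)^n)" 
    for F :: "'a \<Rightarrow> 'd::euclidean_space"
  proof -
    have [measurable]: "mollify (\<epsilon> n) F \<in> borel_measurable borel" for n using \<epsilon>(1) by auto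
    have "(\<integral>\<^sup>+x. (\<Sum>n. ennreal (norm (mollify (\<epsilon> n) F x - F x) powr p)) \<partial>lborel)
      = (\<Sum>n. \<integral>\<^sup>+x. ennreal (norm (mollify (\<epsilon> n) F x - F x) powr p) \<partial>lborel)"
      by (rule nn_integral_suminf) measurable
    also have "\<dots> \<le> (\<Sum>n. ennreal ((1/2)^n))" by (rule suminf_le) (use F in auto)
    finally have fin: "(\<integral>\<^sup>+x. (\<Sum>n. ennreal (norm (mollify (\<epsilon> n) F x - F x) powr p)) \<partial>lborel) < \<infinity>"
      unfolding geo by (rule le_less_trans) simp
    then have "AE x in lborel. (\<Sum>n. ennreal (norm (mollify (\<epsilon> n) F x - F x) powr p)) \<noteq> \<infinity>"
      by (intro nn_integral_PInf_AE) (auto simp: less_top[symmetric])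
    then have "AE x in lborel. (\<lambda>n. mollify (\<epsilon> n) F x) \<longlonglongrightarrow> F x"
    proof eventually_elim
      case (elim x)
      then have "summable (\<lambda>n. norm (mollify (\<epsilon> n) F x - F x) powr p)"
        by (intro summable_suminf_not_top) auto
      then have "(\<lambda>n. norm (mollify (\<epsilon> n) F x - F x) powr p) \<longlonglongrightarrow> 0" by (rule summable_LIMSEQ_zero)
      then have "(\<lambda>n. (norm (mollify (\<epsilon> n) F x - F x) powr p) powr (1/p)) \<longlonglongrightarrow> 0 powr (1/p)"
        using p by (intro tendsto_powr' tendsto_intros) auto
      then have "(\<lambda>n. norm (mollify (\<epsilon> n) F x - F x)) \<longlonglongrightarrow> 0"
        using p by (simp add: powr_powr)
      then show ?case by (simp add: LIM_zero_cancel tendsto_norm_zero_iff)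
    qed
    with fin show ?thesis by blast
  qed
  define W where "W x = ennreal (2 powr p) * (ennreal (norm (g x) powr p) 
      + (\<Sum>n. ennreal (norm (mollify (\<epsilon> n) g x - g x) powr p)))" for x
  show ?thesis
  proof (rule that[of \<epsilon> W])
    show [measurable]: "W \<in> borel_measurable borel" unfolding W_def[abs_def] by measurable
    have "(\<integral>\<^sup>+x. W x \<partial>lborel) = ennreal (2 powr p) * ((\<integral>\<^sup>+x. norm (g x) powr p \<partial>lborel) + 
        (\<integral>\<^sup>+x. (\<Sum>n. ennreal (norm (mollify (\<epsilon> n) g x - g x) powr p)) \<partial>lborel))"
      unfolding W_def by (subst nn_integral_cmult) (auto simp: nn_integral_add)
    also have "\<dots> < \<infinity>"
    proof -
      have "(\<integral>\<^sup>+x. (\<Sum>n. ennreal (norm (mollify (\<epsilon> n) g x - g x) powr p)) \<partial>lborel) < \<infinity>"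
        by (rule AE_lim[OF fg(2) \<epsilon>(4), THEN conjunct2])
      with g(2) show ?thesis unfolding infinity_ennreal_def
        by (intro ennreal_mult_less_top[THEN iffD2] disjI2 conjI ennreal_less_top) 
          (simp add: ennreal_add_less_top)
    qed
    finally show "(\<integral>\<^sup>+x. W x \<partial>lborel) < \<infinity>" .
    fix n x
    have "ennreal (norm (mollify (\<epsilon> n) g x) powr p) 
      \<le> ennreal (2 powr p * (norm (g x) powr p + norm (mollify (\<epsilon> n) g x - g x) powr p))"
      using norm_powr_add_le[of p "g x" "mollify (\<epsilon> n) g x - g x"] p by (intro ennreal_leI) simp
    also have "\<dots> = ennreal (2 powr p) * (ennreal (norm (g x) powr p) + ennreal (norm (mollify (\<epsilon> n) g x - g x) powr p))"
      by (simp add: ennreal_mult ennreal_plus)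
    also have "\<dots> \<le> W x"
      unfolding W_def
    proof (intro mult_left_mono add_left_mono)
      show "ennreal (norm (mollify (\<epsilon> n) g x - g x) powr p) 
         \<le> (\<Sum>n. ennreal (norm (mollify (\<epsilon> n) g x - g x) powr p))"
        by (rule order_trans[OF _ sum_le_suminf[OF summableI, of "{n}"]]) auto
    qed simp
    finally show "ennreal (norm (mollify (\<epsilon> n) g x) powr p) \<le> W x" .
    show "0 < \<epsilon> n" "\<epsilon> n < e0" by (rule \<epsilon>)+
    show "AE x in lborel. (\<lambda>n. mollify (\<epsilon> n) f x) \<longlonglongrightarrow> f x"
      by (rule AE_lim[OF fg(1) \<epsilon>(3), THEN conjunct1])
    show "AE x in lborel. (\<lambda>n. mollify (\<epsilon> n) g x) \<longlonglongrightarrow> g x"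
      by (rule AE_lim[OF fg(2) \<epsilon>(4), THEN conjunct1])
  qed
qed

lemma smooth_grad:
  assumes "\<And>k. C_k k h"
  shows "(h has_derivative (\<lambda>v. grad h x \<bullet> v)) (at x)" "C_k k (\<lambda>x. grad h x \<bullet> v)" "continuous_on A (grad h)"
proof -
  obtain h' where h': "\<And>x. (h has_derivative h' x) (at x)" "\<And>v k. C_k k (\<lambda>x. h' x v)"
    using smoothE assms by metis
  have eq: "grad h x \<bullet> v = h' x v" for x v by (rule grad_inner[OF h'(1)])
  have "(\<lambda>v. grad h x \<bullet> v) = h' x" for x by (simp add: eq)
  then show "(h has_derivative (\<lambda>v. grad h x \<bullet> v)) (at x)" using h'(1) by simp
  show *: "C_k k (\<lambda>x. grad h x \<bullet> v)" for k v using h'(2) by (simp add: eq)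
  have "continuous_on A (\<lambda>x. \<Sum>b\<in>Basis. (grad h x \<bullet> b) *\<^sub>R b)"
    by (intro continuous_on_sum continuous_on_scaleR continuous_on_const C_k_imp_continuous[OF *])
  then show "continuous_on A (grad h)" by (simp add: euclidean_representation)
qed

lemma grad_eqI:
  assumes "(h has_derivative (\<lambda>v. w \<bullet> v)) (at x)" shows "grad h x = w"
  by (rule euclidean_eqI) (rule grad_inner[OF assms])

lemma grad_eq_0_outside_support:
  assumes "\<And>x. norm x \<ge> R \<Longrightarrow> h x = 0" "norm x > R"
  shows "grad h x = 0"
proof (rule grad_eqI)
  have "((\<lambda>x. 0) has_derivative (\<lambda>v. 0)) (at x)" by simp
  then have "(h has_derivative (\<lambda>v. 0)) (at x)"
  proof (rule has_derivative_transform_within_open)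
    show "open (- cball (0::'a) R)" by auto
  qed (use assms in auto)
  then show "(h has_derivative (\<lambda>v. 0 \<bullet> v)) (at x)" by simp
qed

lemma integrable_convolution:
  fixes K :: "'a::euclidean_space \<Rightarrow> 'b::euclidean_space"
  assumes "continuous_on UNIV K" "\<And>x. norm x > R \<Longrightarrow> K x = 0" and f: "integrable lborel (f :: 'a \<Rightarrow> real)"
  shows "integrable lborel (\<lambda>z. f z *\<^sub>R K (x - z))"
proof -
  obtain B where B: "\<And>x. norm (K x) \<le> B"
    using integrable_compact_support(2)[of K "R + 1"] assms by auto
  have [measurable]: "K \<in> borel_measurable borel" using assms(1) by (rule borel_measurable_continuous_onI)
  have [measurable]: "f \<in> borel_measurable borel" using f by auto
  show ?thesis
  proof (rule Bochner_Integration.integrable_bound[of _ "\<lambda>z. B * f z"])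
    show "AE z in lborel. norm (f z *\<^sub>R K (x - z)) \<le> norm (B * f z)"
    proof (rule AE_I2)
      fix z
      have "\<bar>f z\<bar> * norm (K (x - z)) \<le> \<bar>f z\<bar> * \<bar>B\<bar>"
        using order_trans[OF B[of "x - z"] abs_ge_self] by (rule mult_left_mono) simp
      then show "norm (f z *\<^sub>R K (x - z)) \<le> norm (B * f z)" by (simp add: abs_mult mult.commute)
    qed
  qed (use f in auto)
qed

text \<open>
  The derivative falls on the kernel. As the gradient of the kernel is uniformly continuous, the linearization error of
  \<open>K (x - z)\<close> is small uniformly in \<open>z\<close>, so it may be integrated against \<open>f\<close>.
\<close>

lemma has_derivative_convolution:
  fixes K :: "'a::euclidean_space \<Rightarrow> real"
  assumes K: "\<And>k. C_k k K" "\<And>x. norm x \<ge> R \<Longrightarrow> K x = 0" and f: "integrable lborel (f :: 'a \<Rightarrow> real)"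
  shows "((\<lambda>x. \<integral>z. f z * K (x - z) \<partial>lborel) has_derivative 
    (\<lambda>v. (\<integral>z. f z *\<^sub>R grad K (x - z) \<partial>lborel) \<bullet> v)) (at x)"
  unfolding has_derivative_at_alt
proof (intro conjI allI impI)
  show "bounded_linear (\<lambda>v. (\<integral>z. f z *\<^sub>R grad K (x - z) \<partial>lborel) \<bullet> v)"
    by (rule bounded_linear_inner_right)
  have K0: "grad K x = 0" if "norm x > R" for x
    using grad_eq_0_outside_support[of R K] K(2) that by auto
  have uc: "uniformly_continuous_on UNIV (grad K)"
    by (rule uniformly_continuous_compact_support[OF smooth_grad(3)[OF K(1)] K0])
  have intK: "integrable lborel (\<lambda>z. f z * K (y - z))" for y
    using integrable_convolution[OF C_k_imp_continuous[OF K(1)], of R f y] K(2) f by simp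
  have intG: "integrable lborel (\<lambda>z. f z *\<^sub>R grad K (y - z))" for y
    by (rule integrable_convolution[OF smooth_grad(3)[OF K(1)] K0 f])
  fix e :: real assume "e > 0"
  define m where "m = (\<integral>z. \<bar>f z\<bar> \<partial>lborel)"
  have m: "m \<ge> 0" by (simp add: m_def)
  define \<tau> where "\<tau> = e / (m + 1)"
  have \<tau>: "\<tau> > 0" using \<open>e > 0\<close> m by (simp add: \<tau>_def)
  from uc \<tau> obtain d where d: "d > 0" "\<And>x y. dist y x < d \<Longrightarrow> dist (grad K y) (grad K x) < \<tau>"
    unfolding uniformly_continuous_on_def by (metis UNIV_I)
  show "\<exists>d>0. \<forall>y. norm (y - x) < d \<longrightarrow> norm ((\<integral>z. f z * K (y - z) \<partial>lborel) - (\<integral>z. f z * K (x - z) \<partial>lborel) -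
      (\<integral>z. f z *\<^sub>R grad K (x - z) \<partial>lborel) \<bullet> (y - x)) \<le> e * norm (y - x)"
  proof (intro exI[of _ d] conjI allI impI d(1))
    fix y assume y: "norm (y - x) < d"
    have pt: "\<bar>K (y - z) - K (x - z) - grad K (x - z) \<bullet> (y - x)\<bar> \<le> norm (y - x) * \<tau>" for z
    proof -
      have "norm (K (y - z) - K (x - z) - grad K (x - z) \<bullet> ((y - z) - (x - z))) \<le> norm ((y - z) - (x - z)) * \<tau>"
      proof (rule differentiable_bound_linearization[where S="ball (x - z) d" and f'="\<lambda>y v. grad K y \<bullet> v"])
        show "x - z + t *\<^sub>R (y - z - (x - z)) \<in> ball (x - z) d" if "t \<in> {0..1}" for t
        proof -
          have "\<bar>t\<bar> * norm (y - x) \<le> 1 * norm (y - x)" using that by (intro mult_right_mono) auto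
          with y show ?thesis by (simp add: dist_norm)
        qed
        show "(K has_derivative (\<lambda>v. grad K w \<bullet> v)) (at w within ball (x - z) d)" for w
          using smooth_grad(1)[OF K(1)] by (rule has_derivative_at_withinI)
        show "onorm ((\<lambda>v. grad K w \<bullet> v) - (\<lambda>v. grad K (x - z) \<bullet> v)) \<le> \<tau>" if "w \<in> ball (x - z) d" for w
        proof (rule onorm_bound)
          show "0 \<le> \<tau>" using \<tau> by simp
          fix v :: 'a
          have "dist (grad K w) (grad K (x - z)) < \<tau>" using that by (intro d(2)) (simp add: dist_commute)
          then have "norm (grad K w - grad K (x - z)) * norm v \<le> \<tau> * norm v"
            by (intro mult_right_mono) (auto simp: dist_norm)
          then show "norm (((\<lambda>v. grad K w \<bullet> v) - (\<lambda>v. grad K (x - z) \<bullet> v)) v) \<le> \<tau> * norm v"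
            using Cauchy_Schwarz_ineq2[of "grad K w - grad K (x - z)" v]
            by (simp add: inner_diff_left)
        qed
        show "x - z \<in> ball (x - z) d" using d(1) by simp
      qed
      then show ?thesis by simp
    qed
    have "(\<integral>z. f z * K (y - z) \<partial>lborel) - (\<integral>z. f z * K (x - z) \<partial>lborel) -
        (\<integral>z. f z *\<^sub>R grad K (x - z) \<partial>lborel) \<bullet> (y - x)
       = (\<integral>z. f z * (K (y - z) - K (x - z) - grad K (x - z) \<bullet> (y - x)) \<partial>lborel)"
      using intK[of x] intK[of y] integrable_inner_left[OF intG[of x], of "y - x"] integral_inner_left[OF intG[of x], of "y - x"]
      by (simp add: right_diff_distrib)
    also have "norm \<dots> \<le> (\<integral>z. \<bar>f z\<bar> * (norm (y - x) * \<tau>) \<partial>lborel)"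
    proof (rule Bochner_Integration.integral_norm_bound_integral)
      have "integrable lborel (\<lambda>z. f z * K (y - z) - f z * K (x - z) - (f z *\<^sub>R grad K (x - z)) \<bullet> (y - x))"
        by (intro Bochner_Integration.integrable_diff intK integrable_inner_left intG)
      then show "integrable lborel (\<lambda>z. f z * (K (y - z) - K (x - z) - grad K (x - z) \<bullet> (y - x)))"
        by (simp add: right_diff_distrib)
      show "norm (f z * (K (y - z) - K (x - z) - grad K (x - z) \<bullet> (y - x))) \<le> \<bar>f z\<bar> * (norm (y - x) * \<tau>)" for z
        using mult_left_mono[OF pt[of z] abs_ge_zero[of "f z"]] by (simp add: abs_mult)
    qed (use f in simp)
    also have "\<dots> = m * (norm (y - x) * \<tau>)"
      by (simp add: m_def)
    also have "\<dots> \<le> e * norm (y - x)"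
    proof -
      have "m * \<tau> \<le> e" using m \<open>e > 0\<close> by (simp add: \<tau>_def field_simps)
      then have "m * \<tau> * norm (y - x) \<le> e * norm (y - x)" by (rule mult_right_mono) simp
      then show ?thesis by (simp add: algebra_simps)
    qed
    finally show "norm ((\<integral>z. f z * K (y - z) \<partial>lborel) - (\<integral>z. f z * K (x - z) \<partial>lborel) -
      (\<integral>z. f z *\<^sub>R grad K (x - z) \<partial>lborel) \<bullet> (y - x)) \<le> e * norm (y - x)" .
  qed
qed

lemma C_k_convolution:
  fixes K :: "'a::euclidean_space \<Rightarrow> real"
  assumes "\<And>k. C_k k K" "\<And>x. norm x \<ge> R \<Longrightarrow> K x = 0" and f: "integrable lborel (f :: 'a \<Rightarrow> real)"
  shows "C_k k (\<lambda>x. \<integral>z. f z * K (x - z) \<partial>lborel)"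
  using assms(1,2)
proof (induction k arbitrary: K R)
  case 0
  then show ?case using has_derivative_convolution[OF 0 f]
    by (auto intro!: continuous_at_imp_continuous_on has_derivative_continuous)
next
  case (Suc k)
  have K0: "grad K x = 0" if "norm x > R" for x
    using grad_eq_0_outside_support[of R K] Suc.prems(2) that by auto
  have "C_k k (\<lambda>x. (\<integral>z. f z *\<^sub>R grad K (x - z) \<partial>lborel) \<bullet> v)" for v
  proof -
    have "C_k k (\<lambda>x. \<integral>z. f z * (grad K (x - z) \<bullet> v) \<partial>lborel)"
      by (rule Suc.IH[where R="R + 1"]) (use smooth_grad(2)[OF Suc.prems(1)] K0 in auto)
    moreover have "(\<integral>z. f z *\<^sub>R grad K (x - z) \<partial>lborel) \<bullet> v = (\<integral>z. f z * (grad K (x - z) \<bullet> v) \<partial>lborel)" for x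
      using integral_inner_left[OF integrable_convolution[OF smooth_grad(3)[OF Suc.prems(1)] K0 f, where x=x], of v] by simp
    ultimately show ?thesis by simp
  qed
  then show ?case
    using has_derivative_convolution[OF Suc.prems f]
    by (auto intro!: exI[of _ "\<lambda>x v. (\<integral>z. f z *\<^sub>R grad K (x - z) \<partial>lborel) \<bullet> v"])
qed

lemma mollify_real: "mollify \<epsilon> f x = (\<integral>z. f z * mollifier \<epsilon> (x - z) \<partial>lborel)"
  unfolding mollify_def by (simp add: mult.commute)

lemma C_k_mollify:
  assumes "\<epsilon> > 0" "integrable lborel (f :: 'a::euclidean_space \<Rightarrow> real)"
  shows "C_k k (mollify \<epsilon> f)"
  unfolding mollify_real[abs_def]
  by (rule C_k_convolution[OF C_k_mollifier, where R=\<epsilon>]) (use assms in \<open>auto simp: mollifier_eq_0_iff\<close>)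

text \<open>
  Statements about completed Lebesgue measure on a set are transferred to Borel functions on the
  whole space, where Tonelli's theorem and translations are available.
\<close>

lemma borel_representative:
  fixes h :: "'a::euclidean_space \<Rightarrow> 'b::euclidean_space"
  assumes "h \<in> borel_measurable (lebesgue_on S)" "S \<in> sets borel"
  obtains h' where "h' \<in> borel_measurable borel" "AE x in lborel. x \<in> S \<longrightarrow> h x = h' x" "\<And>x. x \<notin> S \<Longrightarrow> h' x = 0"
proof -
  have S: "S \<in> sets lebesgue" using assms(2) by simp
  have m: "(\<lambda>x. indicator S x *\<^sub>R h x) \<in> borel_measurable lebesgue"
    using assms(1) S by (subst (asm) borel_measurable_restrict_space_iff) (auto simp: mult.commute)
  have "\<exists>g'\<in>borel_measurable lborel. AE x in lborel. (indicator S x *\<^sub>R h x) \<bullet> b = g' x" if "b \<in> Basis" for b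
    by (rule completion_ex_borel_measurable_real) (use m in measurable)
  then obtain g where g: "\<And>b. b \<in> Basis \<Longrightarrow> g b \<in> borel_measurable lborel" 
    "\<And>b. b \<in> Basis \<Longrightarrow> AE x in lborel. (indicator S x *\<^sub>R h x) \<bullet> b = g b x"
    by metis
  define h' where "h' x = indicator S x *\<^sub>R (\<Sum>b\<in>Basis. g b x *\<^sub>R b)" for x
  have [measurable]: "\<And>b. b \<in> Basis \<Longrightarrow> g b \<in> borel_measurable borel" using g(1) by simp
  show ?thesis
  proof (rule that[of h'])
    show "h' \<in> borel_measurable borel" unfolding h'_def[abs_def] using assms(2) by measurable
    have "AE x in lborel. \<forall>b\<in>Basis. (indicator S x *\<^sub>R h x) \<bullet> b = g b x"
      using g(2) by (subst AE_finite_all) auto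
    then show "AE x in lborel. x \<in> S \<longrightarrow> h x = h' x"
    proof eventually_elim
      case (elim x)
      have "x \<in> S \<Longrightarrow> (\<Sum>b\<in>Basis. g b x *\<^sub>R b) = (\<Sum>b\<in>Basis. (h x \<bullet> b) *\<^sub>R b)"
        using elim by (intro sum.cong) auto
      then show ?case by (simp add: h'_def euclidean_representation)
    qed
  qed (simp add: h'_def)
qed

lemma lebesgue_on_transfer:
  fixes h h' :: "'a::euclidean_space \<Rightarrow> 'b::euclidean_space"
  assumes S: "S \<in> sets borel" and h': "h' \<in> borel_measurable borel" 
    and ae: "AE x in lborel. x \<in> S \<longrightarrow> h x = h' x" and z: "\<And>x. x \<notin> S \<Longrightarrow> h' x = 0"
  shows "integrable (lebesgue_on S) h \<longleftrightarrow> integrable lborel h'"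
    and "(\<integral>x. h x \<partial>lebesgue_on S) = (\<integral>x. h' x \<partial>lborel)"
proof -
  have S': "S \<inter> space lebesgue \<in> sets lebesgue" using S by simp
  have h'l: "h' \<in> borel_measurable lborel" using h' by simp
  have ae': "AE x in lebesgue. h' x = indicator S x *\<^sub>R h x"
    using ae z by (intro AE_completion) (auto elim!: eventually_mono simp: indicator_def)
  have m: "h' \<in> borel_measurable lebesgue" using h'l by (rule measurable_completion)
  have m2: "(\<lambda>x. indicator S x *\<^sub>R h x) \<in> borel_measurable lebesgue"
    by (rule borel_measurable_AE[OF m ae'])
  show "integrable (lebesgue_on S) h \<longleftrightarrow> integrable lborel h'"
    unfolding integrable_restrict_space[OF S'] integrable_completion[OF h'l, symmetric]
    using integrable_cong_AE[OF m m2 ae'] by simp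
  show "(\<integral>x. h x \<partial>lebesgue_on S) = (\<integral>x. h' x \<partial>lborel)"
    unfolding integral_restrict_space[OF S'] integral_completion[OF h'l, symmetric]
    using integral_cong_AE[OF m m2 ae'] by simp
qed

text \<open>
  The mollifier centred at \<open>x\<close> is a test function, so the definition of the weak gradient moves the derivative from the
  kernel to \<open>u\<close>.
\<close>

lemma mollify_has_derivative:
  assumes V: "open V" and wg: "has_weak_gradient V u G"
    and u': "integrable lborel u'" "AE x in lborel. x \<in> V \<longrightarrow> u x = u' x" "\<And>x. x \<notin> V \<Longrightarrow> u' x = 0"
    and G': "integrable lborel G'" "AE x in lborel. x \<in> V \<longrightarrow> G x = G' x" "\<And>x. x \<notin> V \<Longrightarrow> G' x = 0"
    and e: "\<epsilon> > 0" "cball x \<epsilon> \<subseteq> V"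
  shows "(mollify \<epsilon> u' has_derivative (\<lambda>v. mollify \<epsilon> G' x \<bullet> v)) (at x)"
proof -
  have [measurable]: "u' \<in> borel_measurable borel" "G' \<in> borel_measurable borel" using u' G' by auto
  define \<phi> where "\<phi> z = mollifier \<epsilon> (x - z)" for z
  have \<phi>C: "C_k k \<phi>" for k
    using C_k_affine[OF C_k_mollifier[OF e(1)], of k "-1" x] by (simp add: \<phi>_def[abs_def] algebra_simps)
  have supp: "{z. \<phi> z \<noteq> 0} \<subseteq> cball x \<epsilon>"
    using e(1) by (auto simp: \<phi>_def mollifier_eq_0_iff dist_norm)
  have "closure {z. \<phi> z \<noteq> 0} \<subseteq> cball x \<epsilon>" using supp by (simp add: closure_minimal)
  then have "compact (closure {z. \<phi> z \<noteq> 0})" "closure {z. \<phi> z \<noteq> 0} \<subseteq> V"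
    using e(2) by (auto intro: compact_closure[THEN iffD2] bounded_subset[OF bounded_cball supp])
  then have \<phi>t: "\<phi> \<in> test_functions V" by (simp add: test_functions_def compactly_contained_def \<phi>C)
  have g\<phi>: "grad \<phi> z = - grad (mollifier \<epsilon>) (x - z)" for z
  proof (rule grad_eqI)
    have "(\<phi> has_derivative (\<lambda>v. grad (mollifier \<epsilon>) (x - z) \<bullet> (- v))) (at z)"
      unfolding \<phi>_def[abs_def]
      by (rule has_derivative_compose[where g="mollifier \<epsilon>", OF _ smooth_grad(1)[OF C_k_mollifier[OF e(1)]]])
        (auto intro!: derivative_eq_intros)
    then show "(\<phi> has_derivative (\<lambda>v. (- grad (mollifier \<epsilon>) (x - z)) \<bullet> v)) (at z)" by simp
  qed
  have [measurable]: "\<phi> \<in> borel_measurable borel" "grad \<phi> \<in> borel_measurable borel"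
    using \<phi>C smooth_grad(3)[OF \<phi>C] by (auto intro!: borel_measurable_continuous_onI C_k_imp_continuous)
  have "(\<integral>z. u z *\<^sub>R grad \<phi> z \<partial>lebesgue_on V) = - (\<integral>z. \<phi> z *\<^sub>R G z \<partial>lebesgue_on V)"
    using wg \<phi>t by (simp add: has_weak_gradient_def)
  moreover have "(\<integral>z. u z *\<^sub>R grad \<phi> z \<partial>lebesgue_on V) = (\<integral>z. u' z *\<^sub>R grad \<phi> z \<partial>lborel)"
    by (rule lebesgue_on_transfer) (use V u' in auto)
  moreover have "(\<integral>z. \<phi> z *\<^sub>R G z \<partial>lebesgue_on V) = (\<integral>z. \<phi> z *\<^sub>R G' z \<partial>lborel)"
    by (rule lebesgue_on_transfer) (use V G' in auto)
  ultimately have "(\<integral>z. u' z *\<^sub>R grad (mollifier \<epsilon>) (x - z) \<partial>lborel) = mollify \<epsilon> G' x"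
    by (simp add: g\<phi> \<phi>_def mollify_def)
  with has_derivative_convolution[OF C_k_mollifier[OF e(1)], of \<epsilon> u' x] u'(1) e(1)
  show ?thesis by (simp add: mollify_real[abs_def] mollifier_eq_0_iff)
qed

text \<open>
  The approximants are mollifications of the extension of \<open>u\<close> by zero. As soon as the radius is less than \<open>R - R'\<close>, their gradients on
  the smaller ball are the mollifications of the extension of \<open>G\<close> by zero, to which the majorant belongs.
\<close>

lemma W1p_smooth_approximation:
  fixes u :: "'a::euclidean_space \<Rightarrow> real"
  assumes W: "W1p p (ball z R) u G" and p: "p \<ge> 1" and R: "0 < R'" "R' < R"
    and nonneg: "AE x in lborel. x \<in> ball z R \<longrightarrow> u x \<ge> 0"
  obtains w :: "nat \<Rightarrow> 'a \<Rightarrow> real" and M :: "'a \<Rightarrow> ennreal" where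
    "\<And>n k. C_k k (w n)" "\<And>n x. w n x \<ge> 0"
    "AE x in lborel. x \<in> ball z R' \<longrightarrow> (\<lambda>n. w n x) \<longlonglongrightarrow> u x"
    "AE x in lborel. x \<in> ball z R' \<longrightarrow> (\<lambda>n. grad (w n) x) \<longlonglongrightarrow> G x"
    "M \<in> borel_measurable borel" "(\<integral>\<^sup>+x. M x \<partial>lborel) < \<infinity>"
    "\<And>n x. x \<in> ball z R' \<Longrightarrow> ennreal (norm (grad (w n) x) powr p) \<le> M x"
proof -
  define V where "V = ball z R"
  have V: "V \<in> sets borel" "open V" by (simp_all add: V_def)
  have L: "has_weak_gradient V u G" "in_Lp p V u" "in_Lp p V G" using W by (auto simp: W1p_def V_def)
  have rep: "\<exists>h'. integrable lborel h' \<and> (AE x in lborel. x \<in> V \<longrightarrow> h x = h' x) \<and> (\<forall>x. x \<notin> V \<longrightarrow> h' x = 0) 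
      \<and> (\<integral>\<^sup>+x. norm (h' x) powr p \<partial>lborel) < \<infinity>" if h: "in_Lp p V h" for h :: "'a \<Rightarrow> 'b::euclidean_space"
  proof -
    from h have hm: "h \<in> borel_measurable (lebesgue_on V)" and hi: "integrable (lebesgue_on V) (\<lambda>x. norm (h x) powr p)"
      by (auto simp: in_Lp_def)
    obtain h' where h': "h' \<in> borel_measurable borel" "AE x in lborel. x \<in> V \<longrightarrow> h x = h' x" "\<And>x. x \<notin> V \<Longrightarrow> h' x = 0"
      using borel_representative[OF hm V(1)] by blast
    have [measurable]: "h' \<in> borel_measurable borel" by fact
    have i1: "integrable lborel (\<lambda>x. norm (h' x) powr p)"
      using hi by (subst (asm) lebesgue_on_transfer(1)[OF V(1), where h'="\<lambda>x. norm (h' x) powr p"]) (use h' p in auto)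
    have i2: "integrable lborel (\<lambda>x. indicator V x + norm (h' x) powr p)"
      using emeasure_lborel_ball_finite[of z R] i1 
      by (intro Bochner_Integration.integrable_add integrable_real_indicator) (auto simp: V_def)
    have "integrable lborel h'"
    proof (rule Bochner_Integration.integrable_bound[OF i2])
      show "AE x in lborel. norm (h' x) \<le> norm (indicator V x + norm (h' x) powr p)"
      proof (rule AE_I2)
        fix x
        have "norm (h' x) \<le> indicator V x + norm (h' x) powr p"
        proof (cases "norm (h' x) \<le> 1")
          case True then show ?thesis using h'(3)[of x] by (auto simp: indicator_def intro: order_trans)
        next
          case False
          then have "norm (h' x) powr 1 \<le> norm (h' x) powr p" using p by (intro powr_mono) auto
          then show ?thesis using False by (simp add: indicator_def)
        qed
        then show "norm (h' x) \<le> norm (indicator V x + norm (h' x) powr p)" by simp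
      qed
    qed measurable
    moreover have "(\<integral>\<^sup>+x. norm (h' x) powr p \<partial>lborel) < \<infinity>"
      using i1 by (simp add: integrable_iff_bounded)
    ultimately show ?thesis using h' by blast
  qed
  obtain u0 where u0: "integrable lborel u0" "AE x in lborel. x \<in> V \<longrightarrow> u x = u0 x" "\<And>x. x \<notin> V \<Longrightarrow> u0 x = 0" 
    "(\<integral>\<^sup>+x. norm (u0 x) powr p \<partial>lborel) < \<infinity>" using rep[OF L(2)] by blast
  obtain G' where G': "integrable lborel G'" "AE x in lborel. x \<in> V \<longrightarrow> G x = G' x" "\<And>x. x \<notin> V \<Longrightarrow> G' x = 0" 
    "(\<integral>\<^sup>+x. norm (G' x) powr p \<partial>lborel) < \<infinity>" using rep[OF L(3)] by blast
  define u' where "u' x = \<bar>u0 x\<bar>" for x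
  have u': "integrable lborel u'"
    unfolding u'_def[abs_def] using u0(1) by (rule integrable_abs)
  have u': "integrable lborel u'" "AE x in lborel. x \<in> V \<longrightarrow> u x = u' x" "\<And>x. x \<notin> V \<Longrightarrow> u' x = 0"
    "(\<integral>\<^sup>+x. norm (u' x) powr p \<partial>lborel) < \<infinity>" "\<And>x. u' x \<ge> 0"
    using u0(2,3,4) nonneg u' by (auto simp: u'_def V_def elim!: eventually_elim2)
  obtain \<epsilon> M where *: "\<And>n. 0 < \<epsilon> n" "\<And>n. \<epsilon> n < R - R'"
    "AE x in lborel. (\<lambda>n. mollify (\<epsilon> n) u' x) \<longlonglongrightarrow> u' x"
    "AE x in lborel. (\<lambda>n. mollify (\<epsilon> n) G' x) \<longlonglongrightarrow> G' x"
    "M \<in> borel_measurable borel" "(\<integral>\<^sup>+x. M x \<partial>lborel) < \<infinity>"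
    "\<And>n x. ennreal (norm (mollify (\<epsilon> n) G' x) powr p) \<le> M x"
    using mollify_sequence[OF u'(1,4) G'(1,4) p, of "R - R'"] R by auto
  have gr: "grad (mollify (\<epsilon> n) u') x = mollify (\<epsilon> n) G' x" if "x \<in> ball z R'" for n x
  proof (rule grad_eqI, rule mollify_has_derivative[OF V(2) L(1) u'(1,2,3) G'(1,2,3) *(1)])
    show "cball x (\<epsilon> n) \<subseteq> V"
    proof
      fix y assume "y \<in> cball x (\<epsilon> n)"
      then have "dist z y < R" using that *(2)[of n] dist_triangle[of z y x] by auto
      then show "y \<in> V" by (simp add: V_def)
    qed
  qed
  show ?thesis
  proof (rule that[of "\<lambda>n. mollify (\<epsilon> n) u'" M])
    show "C_k k (mollify (\<epsilon> n) u')" for n k by (rule C_k_mollify[OF *(1) u'(1)])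
    show "mollify (\<epsilon> n) u' x \<ge> 0" for n x by (rule mollify_nonneg[OF *(1) u'(5)])
    show "AE x in lborel. x \<in> ball z R' \<longrightarrow> (\<lambda>n. mollify (\<epsilon> n) u' x) \<longlonglongrightarrow> u x"
      using *(3) u'(2) by eventually_elim (use R in \<open>auto simp: V_def\<close>)
    show "AE x in lborel. x \<in> ball z R' \<longrightarrow> (\<lambda>n. grad (mollify (\<epsilon> n) u') x) \<longlonglongrightarrow> G x"
      using *(4) G'(2) by eventually_elim (use R in \<open>auto simp: V_def gr\<close>)
  qed (use * gr in auto)
qed

text \<open>
  The fundamental theorem of calculus on the segment from \<open>y\<close> to \<open>x\<close>, followed by Jensen's inequality. The majorant \<open>M\<close> may be
  infinite at some points, as the sum of a series of majorants can be.
\<close>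

lemma powr_diff_le_line_integral:
  fixes w :: "'a::euclidean_space \<Rightarrow> real"
  assumes w: "\<And>k. C_k k w" and S: "convex S" "x \<in> S" "y \<in> S" and p: "p \<ge> 1"
    and M: "\<And>x. x \<in> S \<Longrightarrow> ennreal (norm (grad w x) powr p) \<le> M x"
  shows "ennreal (\<bar>w x - w y\<bar> powr p) 
    \<le> ennreal (norm (x - y) powr p) * (\<integral>\<^sup>+t. indicator {0..1} t * M (y + t *\<^sub>R (x - y)) \<partial>lborel)"
proof -
  define l where "l t = y + t *\<^sub>R (x - y)" for t :: real
  have l: "l t \<in> S" if "t \<in> {0..1}" for t
  proof -
    have "l t = (1 - t) *\<^sub>R y + t *\<^sub>R x" by (simp add: l_def algebra_simps)
    then show ?thesis using S that by (auto simp: convex_alt)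
  qed
  have cont: "continuous_on UNIV (\<lambda>t. grad w (l t))"
    unfolding l_def by (intro continuous_on_compose2[OF smooth_grad(3)[OF w, of UNIV]] continuous_intros) auto
  then have c1: "continuous_on UNIV (\<lambda>t. norm (grad w (l t)))" by (intro continuous_intros)
  then have [measurable]: "(\<lambda>t. norm (grad w (l t))) \<in> borel_measurable borel"
    by (rule borel_measurable_continuous_onI)
  have der: "((\<lambda>t. w (l t)) has_vector_derivative grad w (l t) \<bullet> (x - y)) (at t within {0..1})" for t
  proof -
    have "((\<lambda>t. w (l t)) has_derivative (\<lambda>h. grad w (l t) \<bullet> (h *\<^sub>R (x - y)))) (at t)"
      by (rule has_derivative_compose[OF _ smooth_grad(1)[OF w]]) (auto simp: l_def intro!: derivative_eq_intros)
    then show ?thesis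
      by (auto simp: has_vector_derivative_def intro: has_derivative_at_withinI)
  qed
  have int: "(\<integral>t. indicator {0..1} t *\<^sub>R (grad w (l t) \<bullet> (x - y)) \<partial>lborel) = w (l 1) - w (l 0)"
    using cont by (intro integral_FTC_atLeastAtMost der) (auto intro!: continuous_intros intro: continuous_on_subset)
  have i2: "integrable lborel (\<lambda>t. indicator {0..1} t * norm (grad w (l t)))" 
    using borel_integrable_atLeastAtMost'[of 0 1 "\<lambda>t. norm (grad w (l t))"] continuous_on_subset[OF c1]
    by (auto simp: set_integrable_def)
  have "\<bar>w x - w y\<bar> = norm (\<integral>t. indicator {0..1} t *\<^sub>R (grad w (l t) \<bullet> (x - y)) \<partial>lborel)"
    unfolding int by (simp add: l_def)
  also have "\<dots> \<le> (\<integral>t. norm (x - y) * (indicator {0..1} t * norm (grad w (l t))) \<partial>lborel)"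
  proof (rule Bochner_Integration.integral_norm_bound_integral)
    have "continuous_on {0..1} (\<lambda>t. grad w (l t) \<bullet> (x - y))"
      by (intro continuous_on_inner continuous_on_const continuous_on_subset[OF cont]) simp
    then show "integrable lborel (\<lambda>t. indicator {0..1} t *\<^sub>R (grad w (l t) \<bullet> (x - y)))"
      using borel_integrable_atLeastAtMost' unfolding set_integrable_def by blast
    show "integrable lborel (\<lambda>t. norm (x - y) * (indicator {0..1} t * norm (grad w (l t))))"
      using i2 by simp
    show "norm (indicator {0..1} t *\<^sub>R (grad w (l t) \<bullet> (x - y)))
         \<le> norm (x - y) * (indicator {0..1} t * norm (grad w (l t)))" for t
      using Cauchy_Schwarz_ineq2[of "grad w (l t)" "x - y"] by (auto simp: indicator_def mult.commute)
  qed
  also have "\<dots> = norm (x - y) * (\<integral>t. indicator {0..1} t * norm (grad w (l t)) \<partial>lborel)"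
    using i2 by simp
  finally have "\<bar>w x - w y\<bar> powr p \<le> (norm (x - y) * (\<integral>t. indicator {0..1} t * norm (grad w (l t)) \<partial>lborel)) powr p"
    using p by (intro powr_mono2) auto
  also have "\<dots> = norm (x - y) powr p * (\<integral>t. indicator {0..1} t * norm (grad w (l t)) \<partial>lborel) powr p"
    by (rule powr_mult)
  finally have "ennreal (\<bar>w x - w y\<bar> powr p) 
      \<le> ennreal (norm (x - y) powr p) * ennreal ((\<integral>t. indicator {0..1} t * norm (grad w (l t)) \<partial>lborel) powr p)"
    by (simp add: ennreal_leI flip: ennreal_mult')
  also have "\<dots> \<le> ennreal (norm (x - y) powr p) * 
      (\<integral>\<^sup>+t. ennreal (indicator {0..1} t) * ennreal (norm (grad w (l t)) powr p) \<partial>lborel)"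
    using p by (intro mult_left_mono powr_integral_le) (auto simp: integrable_real_indicator)
  also have "\<dots> \<le> ennreal (norm (x - y) powr p) * (\<integral>\<^sup>+t. indicator {0..1} t * M (l t) \<partial>lborel)"
    using M l by (intro mult_left_mono nn_integral_mono) (auto simp: indicator_def)
  finally show ?thesis by (simp add: l_def)
qed

section \<open>Two pointwise inequalities\<close>

lemma powr_convex_combination:
  fixes x y t p :: real
  assumes "p \<ge> 1" "x \<ge> 0" "y \<ge> 0" "0 < t" "t < 1"
  shows "((1 - t) * x + t * y) powr p \<le> (1 - t) * x powr p + t * y powr p"
proof -
  define A where "A = (1 - t) * x + t * y"
  have A: "A \<ge> 0" using assms by (simp add: A_def)
  show ?thesis
  proof (cases "A = 0")
    case True then show ?thesis using assms by (simp add: A_def)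
  next
    case False
    with A have "A > 0" by simp
    have "(1 - t) * (A powr p + p * A powr (p - 1) * (x - A)) \<le> (1 - t) * x powr p"
      "t * (A powr p + p * A powr (p - 1) * (y - A)) \<le> t * y powr p"
      using powr_ge_tangent[OF assms(1,2) \<open>A > 0\<close>] powr_ge_tangent[OF assms(1,3) \<open>A > 0\<close>] assms(4,5)
      by (auto intro!: mult_left_mono)
    moreover have "(1 - t) * (A powr p + p * A powr (p - 1) * (x - A)) + t * (A powr p + p * A powr (p - 1) * (y - A))
       = A powr p + p * A powr (p - 1) * ((1 - t) * x + t * y - A)" by (simp add: algebra_simps)
    ultimately show ?thesis by (simp add: A_def)
  qed
qed

text \<open>
  With \<open>t = b / a\<close>, the number \<open>A\<close> is the convex combination of \<open>(A - B) / (1 - t)\<close> and \<open>B / t\<close> with weights \<open>1 - t\<close> and \<open>t\<close>. Convexity of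
  the \<open>q\<close>-th power gives the claim after multiplication by \<open>(1 - t) powr (q - 1)\<close>.
\<close>

lemma discrete_Picone_ordered:
  fixes a b A B q :: real
  assumes q: "q > 1" and ab: "0 < b" "b < a" and AB: "A \<ge> 0" "B \<ge> 0"
  shows "(a - b) powr (q - 1) * (A powr q * a powr (1 - q) - B powr q * b powr (1 - q)) \<le> \<bar>A - B\<bar> powr q"
proof (cases "A \<le> B")
  case True
  have "A powr q * a powr (1 - q) \<le> B powr q * b powr (1 - q)"
    using True assms by (intro mult_mono powr_mono2 powr_mono2') auto
  then have "(a - b) powr (q - 1) * (A powr q * a powr (1 - q) - B powr q * b powr (1 - q)) \<le> 0"
    by (intro mult_nonneg_nonpos) auto
  then show ?thesis by (rule order_trans) simp
next
  case False
  define t where "t = b / a"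
  have t: "0 < t" "t < 1" "b = t * a" using ab by (auto simp: t_def)
  have conv: "A powr q \<le> (1 - t) powr (1 - q) * (A - B) powr q + t powr (1 - q) * B powr q"
  proof -
    have "A powr q = ((1 - t) * ((A - B) / (1 - t)) + t * (B / t)) powr q" using t by simp
    also have "\<dots> \<le> (1 - t) * ((A - B) / (1 - t)) powr q + t * (B / t) powr q"
      using q False AB t by (intro powr_convex_combination) auto
    also have "(1 - t) * ((A - B) / (1 - t)) powr q = (1 - t) powr (1 - q) * (A - B) powr q"
      using t False by (simp add: powr_divide powr_diff)
    also have "t * (B / t) powr q = t powr (1 - q) * B powr q"
      using t AB by (simp add: powr_divide powr_diff)
    finally show ?thesis .
  qed
  have "(a - b) powr (q - 1) * (A powr q * a powr (1 - q) - B powr q * b powr (1 - q))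
    = (1 - t) powr (q - 1) * (A powr q - t powr (1 - q) * B powr q)"
  proof -
    have "a - b = (1 - t) * a" using t by (simp add: algebra_simps)
    then have "(a - b) powr (q - 1) = (1 - t) powr (q - 1) * a powr (q - 1)" by (simp add: powr_mult)
    moreover have "b powr (1 - q) = t powr (1 - q) * a powr (1 - q)" using t(3) by (simp add: powr_mult)
    moreover have "a powr (q - 1) * a powr (1 - q) = 1" using ab by (simp flip: powr_add)
    ultimately show ?thesis by (simp add: algebra_simps) (simp add: mult.assoc[symmetric])
  qed
  also have "\<dots> \<le> (1 - t) powr (q - 1) * ((1 - t) powr (1 - q) * (A - B) powr q)"
    using conv by (intro mult_left_mono) auto
  also have "\<dots> = (A - B) powr q" using t by (simp add: mult.assoc[symmetric] flip: powr_add)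
  finally show ?thesis using False by simp
qed

lemma discrete_Picone:
  fixes a b A B q :: real
  assumes "q > 1" "0 < a" "0 < b" "A \<ge> 0" "B \<ge> 0"
  shows "bracket_pow (a - b) (q - 1) * (A powr q * a powr (1 - q) - B powr q * b powr (1 - q)) \<le> \<bar>A - B\<bar> powr q"
proof -
  have br: "bracket_pow x (q - 1) = x powr (q - 1)" if "x > 0" for x :: real
    using that powr_add[of x "q - 2" 1] by (simp add: bracket_pow_def)
  consider "a = b" | "b < a" | "a < b" by linarith
  then show ?thesis
  proof cases
    case 1 then show ?thesis by (simp add: bracket_pow_def)
  next
    case 2 then show ?thesis using discrete_Picone_ordered[of q b a A B] assms by (simp add: br)
  next
    case 3
    have "bracket_pow (a - b) (q - 1) = - bracket_pow (b - a) (q - 1)"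
      by (simp add: bracket_pow_def abs_minus_commute algebra_simps)
    then show ?thesis using discrete_Picone_ordered[of q a b B A] assms 3
      by (simp add: br abs_minus_commute algebra_simps)
  qed
qed

lemma norm_bracket_pow: 
  assumes "r > 0" shows "norm (bracket_pow x r) = norm x powr r"
proof (cases "x = 0")
  case False
  then show ?thesis using powr_add[of "norm x" "r - 1" 1] by (simp add: bracket_pow_def)
qed (use assms in \<open>simp add: bracket_pow_def\<close>)

lemma bracket_pow_inner_self:
  assumes "p > 1" shows "bracket_pow x (p - 1) \<bullet> x = norm x powr p"
proof (cases "x = 0")
  case False
  have "norm x powr p = norm x powr (p - 2) * (norm x)\<^sup>2"
    using False powr_add[of "norm x" "p - 2" 2] by (simp add: powr_numeral)
  then show ?thesis by (simp add: bracket_pow_def power2_norm_eq_inner)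
qed (use assms in \<open>simp add: bracket_pow_def\<close>)

text \<open>
  Here \<open>t\<close> stands for the norm of the gradient of \<open>u\<close>, \<open>w\<close> for \<open>u + \<kappa>\<close> and \<open>A\<close> for a bound of the gradient of the bump \<open>\<eta>\<close>. Either the
  negative term dominates, or \<open>\<eta> * t\<close> is at most a multiple of \<open>A * w\<close>, which bounds the first term. The second case
  needs \<open>\<eta> ^ (Q - 1) \<le> \<eta> powr (p - 1)\<close>, hence \<open>Q \<ge> p\<close>.
\<close>

lemma gradient_absorption:
  fixes t w \<eta> A p q :: real and Q :: nat
  assumes q: "1 < q" and p: "1 < p" and Q: "p \<le> real Q" and t: "0 \<le> t" and w: "0 < w" 
    and \<eta>: "0 \<le> \<eta>" "\<eta> \<le> 1" and A: "0 \<le> A"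
  shows "real Q * \<eta> ^ (Q - 1) * A * t powr (p - 1) * w powr (1 - q) - (q - 1) * \<eta> ^ Q * t powr p * w powr (- q)
    \<le> (real Q powr p / (q - 1) powr (p - 1)) * A powr p * w powr (p - q)"
    (is "?L \<le> ?R")
proof -
  have R0: "?R \<ge> 0" using A by (intro mult_nonneg_nonneg divide_nonneg_nonneg) auto
  have Q2: "Q \<ge> 2" using p Q by linarith
  have tp: "t powr p = t powr (p - 1) * t"
    using t p powr_add[of t "p - 1" 1] by (cases "t = 0") auto
  have wq: "w powr (1 - q) = w powr (- q) * w" using w powr_add[of w "- q" 1] by (simp add: add.commute)
  have \<eta>Q: "\<eta> ^ Q = \<eta> ^ (Q - 1) * \<eta>" using Q2 by (metis One_nat_def Suc_pred less_le_trans mult.commute pos2 power_Suc)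
  have eq: "?L = \<eta> ^ (Q - 1) * t powr (p - 1) * w powr (- q) * (real Q * A * w - (q - 1) * (\<eta> * t))"
    unfolding tp wq \<eta>Q by (simp add: algebra_simps)
  show ?thesis
  proof (cases "real Q * A * w \<le> (q - 1) * (\<eta> * t)")
    case True
    then have "?L \<le> 0" unfolding eq using \<eta> t by (intro mult_nonneg_nonpos mult_nonneg_nonneg) auto
    with R0 show ?thesis by linarith
  next
    case False
    then have \<eta>t: "\<eta> * t \<le> real Q * A * w / (q - 1)" using q by (simp add: field_simps)
    have "\<eta> ^ (Q - 1) * t powr (p - 1) \<le> (\<eta> * t) powr (p - 1)"
    proof (cases "\<eta> = 0")
      case True then show ?thesis using Q2 by (simp add: zero_power)
    next
      case False
      then have "\<eta> ^ (Q - 1) = \<eta> powr real (Q - 1)" using \<eta> by (simp add: powr_realpow)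
      also have "\<dots> \<le> \<eta> powr (p - 1)" using \<eta> False Q Q2 by (intro powr_mono') auto
      finally show ?thesis using t by (simp add: powr_mult mult_right_mono)
    qed
    also have "\<dots> \<le> (real Q * A * w / (q - 1)) powr (p - 1)"
      using \<eta>t \<eta> t p by (intro powr_mono2) auto
    finally have *: "\<eta> ^ (Q - 1) * t powr (p - 1) \<le> (real Q * A * w / (q - 1)) powr (p - 1)" .
    have "?L \<le> (\<eta> ^ (Q - 1) * t powr (p - 1)) * (real Q * A * w powr (1 - q))"
    proof -
      have "0 \<le> (q - 1) * \<eta> ^ Q * t powr p * w powr (- q)" using q \<eta> by simp
      then show ?thesis by (simp add: algebra_simps)
    qed
    also have "\<dots> \<le> (real Q * A * w / (q - 1)) powr (p - 1) * (real Q * A * w powr (1 - q))"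
      using * A by (intro mult_right_mono) auto
    also have "\<dots> = ?R"
    proof (cases "A = 0")
      case False
      have e1: "real Q powr p = real Q powr (p - 1) * real Q" "A powr p = A powr (p - 1) * A"
        using powr_add[of "real Q" "p - 1" 1] powr_add[of A "p - 1" 1] Q2 False A by auto
      have e2: "w powr (p - q) = w powr (p - 1) * w powr (1 - q)" by (simp flip: powr_add)
      show ?thesis unfolding e1 e2 using q A w by (simp add: powr_mult powr_divide)
    qed (use p in simp)
    finally show ?thesis .
  qed
qed

section \<open>Singular kernels\<close>

text \<open>Both kernel bounds compare \<open>|h|\<^sup>-\<^sup>b\<close> with a geometric series of indicators of dyadic balls.\<close>

lemma nn_integral_dyadic_finite:
  fixes F :: "'a::euclidean_space \<Rightarrow> ennreal" and R c :: "nat \<Rightarrow> real"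
  assumes pt: "\<And>h. F h \<le> (\<Sum>k. ennreal (c k) * indicator (ball 0 (R k)) h)"
    and R: "\<And>k. R k \<ge> 0" and c: "\<And>k. c k \<ge> 0"
    and geo: "\<And>k. c k * R k ^ DIM('a) = C * t ^ k" and t: "0 \<le> t" "t < 1" and C: "C \<ge> 0"
  shows "(\<integral>\<^sup>+h. F h \<partial>lborel) < \<infinity>"
proof -
  define \<omega> where "\<omega> = unit_ball_vol (real DIM('a))"
  have \<omega>: "\<omega> \<ge> 0" by (simp add: \<omega>_def unit_ball_vol_nonneg)
  have "(\<integral>\<^sup>+h. F h \<partial>lborel) \<le> (\<integral>\<^sup>+h. (\<Sum>k. ennreal (c k) * indicator (ball (0::'a) (R k)) h) \<partial>lborel)"
    using pt by (intro nn_integral_mono)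
  also have "\<dots> = (\<Sum>k. \<integral>\<^sup>+h. ennreal (c k) * indicator (ball (0::'a) (R k)) h \<partial>lborel)"
    by (rule nn_integral_suminf) (intro borel_measurable_times_ennreal borel_measurable_const borel_measurable_indicator, simp)
  also have "\<dots> \<le> (\<Sum>k. ennreal (\<omega> * (C * t ^ k)))"
  proof (rule suminf_le)
    fix k
    have "(\<integral>\<^sup>+h. ennreal (c k) * indicator (ball (0::'a) (R k)) h \<partial>lborel) = ennreal (c k) * emeasure lborel (ball (0::'a) (R k))"
      by (rule nn_integral_cmult_indicator) simp
    also have "\<dots> = ennreal (\<omega> * (c k * R k ^ DIM('a)))"
      using R[of k] c[of k] by (simp add: emeasure_ball \<omega>_def ennreal_mult'[symmetric] mult_ac)
    finally show "(\<integral>\<^sup>+h. ennreal (c k) * indicator (ball (0::'a) (R k)) h \<partial>lborel) \<le> ennreal (\<omega> * (C * t ^ k))"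
      by (simp add: geo)
  qed auto
  also have "\<dots> < \<infinity>"
  proof -
    have "summable (\<lambda>k. \<omega> * (C * t ^ k))" using t by (intro summable_mult summable_geometric) auto
    then show ?thesis using \<omega> C t by (subst suminf_ennreal2) auto
  qed
  finally show ?thesis .
qed

lemma nn_integral_kernel_near:
  fixes b R :: real
  assumes b: "0 < b" "b < real DIM('a::euclidean_space)"
  shows "(\<integral>\<^sup>+h. indicator (ball (0::'a) R) h * ennreal (norm h powr (- b)) \<partial>lborel) < \<infinity>"
proof (cases "R > 0")
  case False
  then have e: "ball (0::'a) R = {}" by simp
  show ?thesis unfolding e by simp
next
  case R: True
  define N where "N = DIM('a)"
  define c where "c k = (R / 2 ^ Suc k) powr (- b)" for k :: nat
  have pt: "indicator (ball (0::'a) R) h * ennreal (norm h powr (- b))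
     \<le> (\<Sum>k. ennreal (c k) * indicator (ball 0 (R / 2 ^ k)) h)" for h
  proof (cases "h \<noteq> 0 \<and> norm h < R")
    case False
    then show ?thesis by auto
  next
    case True
    have "\<exists>k. R / 2 ^ Suc k \<le> norm h"
    proof -
      obtain k where "(1/2::real) ^ k < norm h / R"
        using real_arch_pow_inv[of "norm h / R" "1/2"] True R by auto
      then have "R / 2 ^ k < norm h" using R by (simp add: field_simps power_divide)
      moreover have "R / 2 ^ Suc k \<le> R / 2 ^ k" using R by (simp add: field_simps)
      ultimately show ?thesis by (intro exI[of _ k]) linarith
    qed
    define k where "k = (LEAST k. R / 2 ^ Suc k \<le> norm h)"
    have k: "R / 2 ^ Suc k \<le> norm h" unfolding k_def by (rule LeastI_ex) fact
    have k2: "norm h < R / 2 ^ k"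
    proof (cases k)
      case 0 then show ?thesis using True by simp
    next
      case (Suc j)
      then have "\<not> (R / 2 ^ Suc j \<le> norm h)" using not_less_Least[of j "\<lambda>k. R / 2 ^ Suc k \<le> norm h"]
        by (simp add: k_def)
      then show ?thesis using Suc by simp
    qed
    have "norm h powr (- b) \<le> c k" unfolding c_def using k b R by (intro powr_mono2') auto
    then have "indicator (ball (0::'a) R) h * ennreal (norm h powr (- b)) 
       \<le> (\<Sum>k\<in>{k}. ennreal (c k) * indicator (ball 0 (R / 2 ^ k)) h)"
      using True k2 by (simp add: ennreal_leI)
    also have "\<dots> \<le> (\<Sum>k. ennreal (c k) * indicator (ball 0 (R / 2 ^ k)) h)"
      by (rule sum_le_suminf) auto
    finally show ?thesis .
  qed
  show ?thesis
  proof (rule nn_integral_dyadic_finite[OF pt])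
    show "c k * (R / 2 ^ k) ^ DIM('a) = (2 powr b * R powr (- b) * R ^ N) * (2 powr (b - N)) ^ k" for k
    proof -
      have "c k = R powr (- b) * (2 ^ Suc k) powr b" using R 
        by (simp add: c_def powr_divide powr_minus field_simps)
      also have "(2 ^ Suc k) powr b = (2::real) powr b * 2 powr (b * k)"
      proof -
        have "(2::real) ^ Suc k = 2 powr (1 + real k)" by (simp add: powr_add powr_realpow)
        then have "(2 ^ Suc k) powr b = (2::real) powr (b + b * k)"
          by (simp only: powr_powr) (simp add: algebra_simps)
        then show ?thesis by (simp add: powr_add)
      qed
      finally have c: "c k = R powr (- b) * (2 powr b * 2 powr (b * k))" .
      have "(2 powr (b - N)) ^ k = 2 powr ((b - N) * k)" by (simp add: powr_powr flip: powr_realpow)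
      also have "(b - N) * k = b * k - real k * real N" by (simp add: algebra_simps)
      also have "2 powr (b * k - real k * real N) = 2 powr (b * k) / 2 powr (real k * real N)"
        by (rule powr_diff)
      also have "2 powr (real k * real N) = ((2::real) ^ k) ^ N"
        by (simp add: powr_realpow flip: power_mult of_nat_mult)
      finally have "(2 powr (b - N)) ^ k = 2 powr (b * k) / (2 ^ k) ^ N" .
      then show ?thesis unfolding c N_def[symmetric] by (simp add: power_divide field_simps)
    qed
    have "(2::real) powr (b - N) < 2 powr 0" using b by (intro powr_less_mono) (auto simp: N_def)
    then show "(2::real) powr (b - N) < 1" by simp
  qed (use R in \<open>auto simp: c_def\<close>)
qed

lemma nn_integral_kernel_far:
  fixes a :: real
  assumes a: "real DIM('a::euclidean_space) < a"
  shows "(\<integral>\<^sup>+h. indicator (- ball (0::'a) 1) h * ennreal (norm h powr (- a)) \<partial>lborel) < \<infinity>"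
proof -
  define N where "N = DIM('a)"
  define c where "c k = (2 ^ k) powr (- a)" for k :: nat
  have pt: "indicator (- ball (0::'a) 1) h * ennreal (norm h powr (- a))
     \<le> (\<Sum>k. ennreal (c k) * indicator (ball 0 (2 ^ Suc k)) h)" for h
  proof (cases "norm h \<ge> 1")
    case False
    then show ?thesis by auto
  next
    case True
    have "\<exists>k. norm h < 2 ^ Suc k"
      using real_arch_pow[of 2 "norm h"] by (metis Suc_pred le_less_trans less_irrefl not_gr0 one_less_numeral_iff power_0 semiring_norm(76) True)
    define k where "k = (LEAST k. norm h < 2 ^ Suc k)"
    have k: "norm h < 2 ^ Suc k" unfolding k_def by (rule LeastI_ex) fact
    have k2: "2 ^ k \<le> norm h"
    proof (cases k)
      case 0 then show ?thesis using True by simp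
    next
      case (Suc j)
      then have "\<not> (norm h < 2 ^ Suc j)" using not_less_Least[of j "\<lambda>k. norm h < 2 ^ Suc k"]
        by (simp add: k_def)
      then show ?thesis using Suc by simp
    qed
    have "norm h powr (- a) \<le> c k" unfolding c_def using k2 a by (intro powr_mono2') auto
    then have "indicator (- ball (0::'a) 1) h * ennreal (norm h powr (- a)) 
       \<le> (\<Sum>k\<in>{k}. ennreal (c k) * indicator (ball 0 (2 ^ Suc k)) h)"
      using True k by (simp add: ennreal_leI)
    also have "\<dots> \<le> (\<Sum>k. ennreal (c k) * indicator (ball 0 (2 ^ Suc k)) h)"
      by (rule sum_le_suminf) auto
    finally show ?thesis .
  qed
  show ?thesis
  proof (rule nn_integral_dyadic_finite[OF pt])
    show "c k * (2 ^ Suc k) ^ DIM('a) = 2 ^ N * (2 powr (N - a)) ^ k" for k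
    proof -
      have c: "c k = 1 / 2 powr (a * k)"
        by (simp add: c_def powr_powr powr_minus field_simps flip: powr_realpow)
      have "(2 powr (N - a)) ^ k = 2 powr ((N - a) * k)" by (simp add: powr_powr flip: powr_realpow)
      also have "(N - a) * k = real k * real N - a * k" by (simp add: algebra_simps)
      also have "2 powr (real k * real N - a * k) = 2 powr (real k * real N) / 2 powr (a * k)"
        by (rule powr_diff)
      also have "2 powr (real k * real N) = ((2::real) ^ k) ^ N"
        by (simp add: powr_realpow flip: power_mult of_nat_mult)
      finally have "(2 powr (N - a)) ^ k = (2 ^ k) ^ N / 2 powr (a * k)" .
      then show ?thesis unfolding c N_def[symmetric] by (simp add: power_mult_distrib field_simps)
    qed
    have "(2::real) powr (N - a) < 2 powr 0" using a by (intro powr_less_mono) (auto simp: N_def)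
    then show "(2::real) powr (N - a) < 1" by simp
  qed (auto simp: c_def)
qed

section \<open>The Gagliardo energy of a bump\<close>

lemma bump_Lipschitz:
  obtains L where "L > 0" "\<And>x y :: 'a::euclidean_space. \<bar>bump x - bump y\<bar> \<le> L * norm (x - y)" 
    "\<And>x :: 'a. norm (grad bump x) \<le> L"
proof -
  have "grad bump x = 0" if "norm x \<ge> 2" for x :: 'a
    using grad_eq_0_outside_support[of 1 "bump :: 'a \<Rightarrow> real" x] that by (simp add: bump_eq_0_iff)
  then obtain B where B: "\<And>x::'a. norm (grad bump x) \<le> B"
    using integrable_compact_support(2)[OF smooth_grad(3)[OF C_k_bump], of 2] by blast
  define L where "L = \<bar>B\<bar> + 1"
  have L: "norm (grad bump x) \<le> L" for x :: 'a using B[of x] by (simp add: L_def)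
  have "norm (bump x - bump y) \<le> L * norm (x - y)" for x y :: 'a
  proof (rule differentiable_bound[where S=UNIV and f'="\<lambda>x v. grad bump x \<bullet> v"])
    fix x :: 'a
    show "(bump has_derivative (\<lambda>v. grad bump x \<bullet> v)) (at x within UNIV)"
      by (rule smooth_grad(1)[OF C_k_bump])
    show "onorm (\<lambda>v. grad bump x \<bullet> v) \<le> L"
    proof (rule onorm_bound)
      show "0 \<le> L" by (simp add: L_def)
      fix v :: 'a
      show "norm (grad bump x \<bullet> v) \<le> L * norm v"
        using Cauchy_Schwarz_ineq2[of "grad bump x" v] mult_right_mono[OF L[of x] norm_ge_zero[of v]] by simp
    qed
  qed auto
  then show ?thesis using that[of L] L by (simp add: L_def)
qed

lemma powr_diff_le_unit_interval:
  fixes a b m :: real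
  assumes "m \<ge> 1" "0 \<le> a" "a \<le> 1" "0 \<le> b" "b \<le> 1"
  shows "\<bar>a powr m - b powr m\<bar> \<le> m * \<bar>a - b\<bar>"
proof -
  have *: "x powr m - y powr m \<le> m * \<bar>x - y\<bar>" if "0 \<le> x" "x \<le> 1" "0 \<le> y" "y \<le> 1" for x y :: real
  proof (cases "x > 0")
    case True
    have "x powr m - y powr m \<le> x powr (m - 1) * (m * (x - y))"
      using powr_ge_tangent[OF assms(1) that(3) True] by (simp add: algebra_simps)
    also have "\<dots> \<le> x powr (m - 1) * (m * \<bar>x - y\<bar>)" using assms by (intro mult_left_mono) auto
    also have "\<dots> \<le> 1 * (m * \<bar>x - y\<bar>)" using assms that by (intro mult_right_mono powr_le1) auto
    finally show ?thesis by simp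
  next
    case False
    with that have "x = 0" by simp
    then have "x powr m - y powr m \<le> 0" by simp
    moreover have "0 \<le> m * \<bar>x - y\<bar>" using assms by simp
    ultimately show ?thesis by linarith
  qed
  show ?thesis using *[of a b] *[of b a] assms by (auto simp: abs_le_iff abs_minus_commute)
qed

text \<open>
  The Gagliardo energy of \<open>bump powr m\<close>; for \<open>c = N + s * q\<close> in dimension \<open>N\<close> it is the \<open>q\<close>-th power of a fractional Sobolev seminorm.
  The power \<open>m = Q / q\<close> occurs because Picone's inequality needs the \<open>q\<close>-th root of \<open>bump ^ Q\<close>.
\<close>

definition bump_energy :: "'a::euclidean_space itself \<Rightarrow> real \<Rightarrow> real \<Rightarrow> real \<Rightarrow> ennreal" where
  "bump_energy _ q c m = (\<integral>\<^sup>+x. \<integral>\<^sup>+y. ennreal (\<bar>bump (x::'a) powr m - bump y powr m\<bar> powr q * norm (x - y) powr (- c)) \<partial>lborel \<partial>lborel)"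

lemma bump_measurable [measurable]: "bump \<in> borel_measurable borel"
  by (intro borel_measurable_continuous_onI C_k_imp_continuous C_k_bump)

text \<open>
  Differences of the bump are controlled by its Lipschitz constant at distances below one, where \<open>\<bar>h\<bar> powr (q - c)\<close> is integrable, and by
  its maximum at larger distances, where \<open>\<bar>h\<bar> powr (- c)\<close> is.
\<close>

lemma bump_energy_finite:
  assumes m: "m \<ge> 1" and q: "q \<ge> 0" and c: "real DIM('a::euclidean_space) < c" "q < c" "c - q < real DIM('a)"
  shows "bump_energy TYPE('a) q c m < \<infinity>"
proof -
  obtain L where L: "L > 0" "\<And>x y :: 'a. \<bar>bump x - bump y\<bar> \<le> L * norm (x - y)" 
    using bump_Lipschitz[where 'a='a] by metis
  define C where "C = max 1 ((m * L) powr q)"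
  define k :: "'a \<Rightarrow> ennreal" where "k h = ennreal C * (indicator (ball 0 1) h * ennreal (norm h powr (- (c - q))) 
      + indicator (- ball 0 1) h * ennreal (norm h powr (- c)))" for h
  have [measurable]: "k \<in> borel_measurable borel" unfolding k_def[abs_def]
    by (intro borel_measurable_times_ennreal borel_measurable_add borel_measurable_const borel_measurable_indicator) auto
  have kfin: "(\<integral>\<^sup>+h. k h \<partial>lborel) < \<infinity>"
  proof -
    have "(\<integral>\<^sup>+h. k h \<partial>lborel) = ennreal C * ((\<integral>\<^sup>+h. indicator (ball (0::'a) 1) h * ennreal (norm h powr (- (c - q))) \<partial>lborel)
       + (\<integral>\<^sup>+h. indicator (- ball (0::'a) 1) h * ennreal (norm h powr (- c)) \<partial>lborel))"
    proof -
      have m: "(\<lambda>h. indicator (ball (0::'a) 1) h * ennreal (norm h powr (- (c - q)))) \<in> borel_measurable lborel"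
        "(\<lambda>h. indicator (- ball (0::'a) 1) h * ennreal (norm h powr (- c))) \<in> borel_measurable lborel"
        by (intro borel_measurable_times_ennreal borel_measurable_indicator; simp)+
      show ?thesis 
        unfolding k_def nn_integral_cmult[OF borel_measurable_add[OF m]] nn_integral_add[OF m] ..
    qed
    also have "\<dots> < \<infinity>"
      using nn_integral_kernel_near[of "c - q" 1, where 'a='a] nn_integral_kernel_far[where 'a='a, OF c(1)] c
      unfolding infinity_ennreal_def
      by (intro ennreal_mult_less_top[THEN iffD2] disjI2 conjI ennreal_less_top) (simp add: ennreal_add_less_top)
    finally show ?thesis .
  qed
  have pt: "ennreal (\<bar>bump x powr m - bump y powr m\<bar> powr q * norm (x - y) powr (- c))
     \<le> (indicator (ball 0 1) x + indicator (ball 0 1) y) * k (x - y)" for x y :: 'a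
  proof (cases "norm x < 1 \<or> norm y < 1")
    case False
    then have "bump x = 0" "bump y = 0" by (auto simp: bump_eq_0_iff)
    then show ?thesis by simp
  next
    case True
    have d1: "\<bar>bump x powr m - bump y powr m\<bar> \<le> m * L * norm (x - y)"
    proof -
      have "\<bar>bump x powr m - bump y powr m\<bar> \<le> m * \<bar>bump x - bump y\<bar>"
        using m bump_nonneg bump_le_1 by (intro powr_diff_le_unit_interval) auto
      also have "\<dots> \<le> m * (L * norm (x - y))" using m L(2) by (intro mult_left_mono) auto
      finally show ?thesis by simp
    qed
    have d2: "\<bar>bump x powr m - bump y powr m\<bar> \<le> 1"
    proof -
      have "0 \<le> bump x powr m" "0 \<le> bump y powr m" "bump x powr m \<le> 1" "bump y powr m \<le> 1"
        using bump_nonneg[of x] bump_le_1[of x] bump_nonneg[of y] bump_le_1[of y] m by (auto intro!: powr_le1)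
      then show ?thesis by linarith
    qed
    have "ennreal (\<bar>bump x powr m - bump y powr m\<bar> powr q * norm (x - y) powr (- c)) \<le> k (x - y)"
    proof (cases "norm (x - y) < 1")
      case True
      have "\<bar>bump x powr m - bump y powr m\<bar> powr q \<le> (m * L * norm (x - y)) powr q"
        using d1 q by (intro powr_mono2) auto
      also have "\<dots> = (m * L) powr q * norm (x - y) powr q" by (rule powr_mult)
      also have "\<dots> \<le> C * norm (x - y) powr q" by (intro mult_right_mono) (auto simp: C_def)
      finally have "\<bar>bump x powr m - bump y powr m\<bar> powr q * norm (x - y) powr (- c)
         \<le> C * norm (x - y) powr q * norm (x - y) powr (- c)" by (rule mult_right_mono) simp
      also have "\<dots> = C * norm (x - y) powr (- (c - q))" by (simp add: mult.assoc flip: powr_add)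
      finally have "ennreal (\<bar>bump x powr m - bump y powr m\<bar> powr q * norm (x - y) powr (- c))
         \<le> ennreal (C * norm (x - y) powr (- (c - q)))" by (rule ennreal_leI)
      also have "\<dots> = k (x - y)" using True by (simp add: k_def ennreal_mult' C_def)
      finally show ?thesis .
    next
      case False
      have "\<bar>bump x powr m - bump y powr m\<bar> powr q \<le> 1"
        using d2 q by (intro powr_le1) auto
      then have "\<bar>bump x powr m - bump y powr m\<bar> powr q * norm (x - y) powr (- c) \<le> C * norm (x - y) powr (- c)"
        by (intro mult_right_mono) (auto simp: C_def)
      then have "ennreal (\<bar>bump x powr m - bump y powr m\<bar> powr q * norm (x - y) powr (- c))
         \<le> ennreal (C * norm (x - y) powr (- c))" by (rule ennreal_leI)
      also have "\<dots> = k (x - y)" using False by (simp add: k_def ennreal_mult' C_def)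
      finally show ?thesis .
    qed
    also have "k (x - y) \<le> (indicator (ball 0 1) x + indicator (ball 0 1) y) * k (x - y)"
    proof -
      have "1 * k (x - y) \<le> (indicator (ball 0 1) x + indicator (ball 0 1) y) * k (x - y)"
        using True by (intro mult_right_mono) (auto simp: indicator_def)
      then show ?thesis by simp
    qed
    finally show ?thesis .
  qed
  define I :: "'a \<Rightarrow> ennreal" where "I x = indicator (ball 0 1) x" for x
  have [measurable]: "I \<in> borel_measurable borel"
    unfolding I_def[abs_def] by (rule borel_measurable_indicator) simp
  have I_int: "(\<integral>\<^sup>+x. I x \<partial>lborel) = emeasure lborel (ball (0::'a) 1)"
    unfolding I_def by (rule nn_integral_indicator) simp
  have inner1: "(\<integral>\<^sup>+y. k (x - y) \<partial>lborel) = (\<integral>\<^sup>+h. k h \<partial>lborel)" for x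
    using nn_integral_affine[of k "-1" x] by simp
  have inner2: "(\<integral>\<^sup>+x. k (x - y) \<partial>lborel) = (\<integral>\<^sup>+h. k h \<partial>lborel)" for y
    using nn_integral_translate[of k "-y"] by simp
  have "bump_energy TYPE('a) q c m \<le> (\<integral>\<^sup>+x. \<integral>\<^sup>+y. (I x + I y) * k (x - y) \<partial>lborel \<partial>lborel)"
    unfolding bump_energy_def I_def using pt by (intro nn_integral_mono)
  also have "\<dots> = (\<integral>\<^sup>+x. (\<integral>\<^sup>+y. I x * k (x - y) \<partial>lborel) 
      + (\<integral>\<^sup>+y. I y * k (x - y) \<partial>lborel) \<partial>lborel)"
    by (intro nn_integral_cong) (simp add: distrib_right nn_integral_add)
  also have "\<dots> = (\<integral>\<^sup>+x. \<integral>\<^sup>+y. I x * k (x - y) \<partial>lborel \<partial>lborel)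
     + (\<integral>\<^sup>+x. \<integral>\<^sup>+y. I y * k (x - y) \<partial>lborel \<partial>lborel)"
    by (rule nn_integral_add) measurable
  also have "(\<integral>\<^sup>+x. \<integral>\<^sup>+y. I y * k (x - y) \<partial>lborel \<partial>lborel) 
     = (\<integral>\<^sup>+y. \<integral>\<^sup>+x. I y * k (x - y) \<partial>lborel \<partial>lborel)"
    by (rule lborel_pair.Fubini') measurable
  also have "\<dots> = emeasure lborel (ball (0::'a) 1) * (\<integral>\<^sup>+h. k h \<partial>lborel)"
    by (simp add: nn_integral_cmult inner2 nn_integral_multc I_int)
  also have "(\<integral>\<^sup>+x. \<integral>\<^sup>+y. I x * k (x - y) \<partial>lborel \<partial>lborel) 
      = emeasure lborel (ball (0::'a) 1) * (\<integral>\<^sup>+h. k h \<partial>lborel)"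
    by (simp add: nn_integral_cmult inner1 nn_integral_multc I_int)
  also have "emeasure lborel (ball (0::'a) 1) * (\<integral>\<^sup>+h. k h \<partial>lborel) 
     + emeasure lborel (ball (0::'a) 1) * (\<integral>\<^sup>+h. k h \<partial>lborel) < \<infinity>"
    using kfin emeasure_lborel_ball_finite[of "0::'a" 1] by (simp add: ennreal_mult_less_top)
  finally show ?thesis .
qed

lemma bump_energy_scaled:
  fixes z :: "'a::euclidean_space"
  assumes r: "r > 0"
  shows "(\<integral>\<^sup>+x. \<integral>\<^sup>+y. ennreal (\<bar>bump ((x - z) /\<^sub>R r) powr m - bump ((y - z) /\<^sub>R r) powr m\<bar> powr q * norm (x - y) powr (- c)) 
      \<partial>lborel \<partial>lborel) = ennreal (r powr (2 * real DIM('a) - c)) * bump_energy TYPE('a) q c m"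
proof -
  define N where "N = DIM('a)"
  define F where "F x y = ennreal (\<bar>bump ((x - z) /\<^sub>R r) powr m - bump ((y - z) /\<^sub>R r) powr m\<bar> powr q * norm (x - y) powr (- c))" for x y :: 'a
  define F0 where "F0 x y = ennreal (\<bar>bump x powr m - bump y powr m\<bar> powr q * norm (x - y) powr (- c))" for x y :: 'a
  have F: "F (z + r *\<^sub>R x) (z + r *\<^sub>R y) = ennreal (r powr (- c)) * F0 x y" for x y
  proof -
    have "norm (z + r *\<^sub>R x - (z + r *\<^sub>R y)) = r * norm (x - y)"
    proof -
      have "z + r *\<^sub>R x - (z + r *\<^sub>R y) = r *\<^sub>R (x - y)" by (simp add: algebra_simps)
      then show ?thesis using r by simp
    qed
    then show ?thesis using r by (simp add: F_def F0_def powr_mult ennreal_mult' algebra_simps flip: ennreal_mult')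
  qed
  have [measurable]: "(\<lambda>(x, y). F x y) \<in> borel_measurable (borel \<Otimes>\<^sub>M borel)" unfolding F_def by measurable
  have [measurable]: "(\<lambda>(x, y). F0 x y) \<in> borel_measurable (borel \<Otimes>\<^sub>M borel)" unfolding F0_def by measurable
  have "(\<integral>\<^sup>+x. \<integral>\<^sup>+y. F x y \<partial>lborel \<partial>lborel) 
    = ennreal (r ^ N) * (\<integral>\<^sup>+x. \<integral>\<^sup>+y. F (z + r *\<^sub>R x) y \<partial>lborel \<partial>lborel)"
    using nn_integral_affine[of "\<lambda>x. \<integral>\<^sup>+y. F x y \<partial>lborel" r z] r by (simp add: N_def)
  also have "\<dots> = ennreal (r ^ N) * (\<integral>\<^sup>+x. ennreal (r ^ N) * (\<integral>\<^sup>+y. F (z + r *\<^sub>R x) (z + r *\<^sub>R y) \<partial>lborel) \<partial>lborel)"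
    using nn_integral_affine[of "\<lambda>y. F (z + r *\<^sub>R x) y" r z for x] r by (simp add: N_def)
  also have "\<dots> = ennreal (r ^ N) * (\<integral>\<^sup>+x. ennreal (r ^ N) * (ennreal (r powr (- c)) * (\<integral>\<^sup>+y. F0 x y \<partial>lborel)) \<partial>lborel)"
    by (simp add: F nn_integral_cmult)
  also have "\<dots> = ennreal (r ^ N) * (ennreal (r ^ N) * (ennreal (r powr (- c)) * (\<integral>\<^sup>+x. \<integral>\<^sup>+y. F0 x y \<partial>lborel \<partial>lborel)))"
    by (simp add: nn_integral_cmult)
  also have "\<dots> = ennreal (r ^ N * r ^ N * r powr (- c)) * (\<integral>\<^sup>+x. \<integral>\<^sup>+y. F0 x y \<partial>lborel \<partial>lborel)"
    using r by (simp add: ennreal_mult' mult.assoc)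
  also have "r ^ N * r ^ N * r powr (- c) = r powr (2 * real N - c)"
  proof -
    have "2 * real N - c = real N + real N + (- c)" by simp
    then show ?thesis using r by (simp only: powr_add powr_realpow)
  qed
  finally show ?thesis by (simp add: F_def F0_def bump_energy_def N_def)
qed

section \<open>The Caccioppoli estimate on a ball\<close>

text \<open>
  Dominated convergence with a majorant that may be infinite on a null set, as sums and line integrals of majorants are.
\<close>

lemma dominated_convergence_ennreal:
  fixes S :: "nat \<Rightarrow> 'x \<Rightarrow> real"
  assumes S: "\<And>n. S n \<in> borel_measurable M" and S': "S' \<in> borel_measurable M"
    and lim: "AE x in M. (\<lambda>n. S n x) \<longlonglongrightarrow> S' x"
    and dom: "AE x in M. \<forall>n. ennreal \<bar>S n x\<bar> \<le> W x"
    and W: "W \<in> borel_measurable M" "(\<integral>\<^sup>+x. W x \<partial>M) < \<infinity>"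
  shows "integrable M S'" "(\<lambda>n. \<integral>x. S n x \<partial>M) \<longlonglongrightarrow> (\<integral>x. S' x \<partial>M)"
proof -
  have fin: "AE x in M. W x \<noteq> \<infinity>"
    using W by (intro nn_integral_PInf_AE) (auto simp: less_top[symmetric])
  define V where "V x = enn2real (W x)" for x
  have V: "integrable M V"
  proof (rule integrableI_nonneg)
    show "V \<in> borel_measurable M" unfolding V_def[abs_def] using W(1) by measurable
    have "(\<integral>\<^sup>+x. ennreal (V x) \<partial>M) \<le> (\<integral>\<^sup>+x. W x \<partial>M)"
      unfolding V_def by (intro nn_integral_mono) (auto simp: ennreal_enn2real_if)
    then show "(\<integral>\<^sup>+x. ennreal (V x) \<partial>M) < \<infinity>" using W(2) by (rule le_less_trans)
  qed (simp add: V_def)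
  have bd: "AE x in M. norm (S n x) \<le> V x" for n
    using fin dom
  proof eventually_elim
    case (elim x)
    then have "ennreal \<bar>S n x\<bar> \<le> ennreal (V x)" by (simp add: V_def less_top)
    then show ?case by (simp add: V_def)
  qed
  show "integrable M S'" using integrable_dominated_convergence[OF S' S V lim bd] .
  show "(\<lambda>n. \<integral>x. S n x \<partial>M) \<longlonglongrightarrow> (\<integral>x. S' x \<partial>M)" using integral_dominated_convergence[OF S' S V lim bd] .
qed

lemma ennreal_integral_le_nn_integral:
  fixes h :: "'x \<Rightarrow> real"
  assumes h: "integrable M h" and le: "AE x in M. ennreal (h x) \<le> b x"
  shows "ennreal (\<integral>x. h x \<partial>M) \<le> (\<integral>\<^sup>+x. b x \<partial>M)"
proof -
  have "ennreal (\<integral>x. h x \<partial>M) \<le> ennreal (\<integral>x. max 0 (h x) \<partial>M)"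
    using h by (intro ennreal_leI integral_mono) auto
  also have "\<dots> = (\<integral>\<^sup>+x. ennreal (max 0 (h x)) \<partial>M)"
    using h by (intro nn_integral_eq_integral[symmetric]) auto
  also have "\<dots> \<le> (\<integral>\<^sup>+x. b x \<partial>M)"
  proof (rule nn_integral_mono_AE, use le in eventually_elim)
    fix x assume "ennreal (h x) \<le> b x"
    then show "ennreal (max 0 (h x)) \<le> b x" by (cases "h x \<ge> 0") (auto simp: max_def)
  qed
  finally show ?thesis .
qed

lemma AE_translate:
  assumes "AE x in lborel. P (x :: 'a::euclidean_space)"
  shows "AE x in lborel. P (x + a)"
proof -
  obtain N where N: "{x. \<not> P x} \<subseteq> N" "emeasure lborel N = 0" "N \<in> sets lborel"
    using AE_E[OF assms] by auto
  have [measurable]: "N \<in> sets borel" using N by simp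
  have "(\<integral>\<^sup>+x. indicator N (x + a) \<partial>lborel) = (\<integral>\<^sup>+x. indicator N x \<partial>lborel)"
    by (rule nn_integral_translate) simp
  then have "(\<integral>\<^sup>+x. indicator N (x + a) \<partial>lborel) = 0" using N by simp
  then have "AE x in lborel. indicator N (x + a) = (0 :: ennreal)"
    by (subst (asm) nn_integral_0_iff_AE) auto
  then show ?thesis by eventually_elim (use N(1) in \<open>auto simp: indicator_def\<close>)
qed

lemma AE_lborel_prod:
  assumes "AE x in lborel. P (x :: 'a::euclidean_space)"
  shows "AE z in lborel. P (fst z) \<and> P (snd (z :: 'a \<times> 'a))"
proof -
  obtain N where N: "{x. \<not> P x} \<subseteq> N" "emeasure lborel N = 0" "N \<in> sets lborel"
    using AE_E[OF assms] by auto
  have n1: "N \<times> UNIV \<in> null_sets (lborel \<Otimes>\<^sub>M (lborel :: 'a measure))" 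
    using N by (intro null_setsI) (auto simp: lborel.emeasure_pair_measure_Times)
  have n2: "UNIV \<times> N \<in> null_sets ((lborel :: 'a measure) \<Otimes>\<^sub>M lborel)" 
    using N by (intro null_setsI) (auto simp: lborel.emeasure_pair_measure_Times)
  have "AE z in lborel. z \<notin> N \<times> (UNIV :: 'a set)" "AE z in lborel. z \<notin> (UNIV :: 'a set) \<times> N"
    by (rule AE_not_in[OF n1, unfolded lborel_prod], rule AE_not_in[OF n2, unfolded lborel_prod])
  then show ?thesis by eventually_elim (use N(1) in auto)
qed

text \<open>
  The line integrals that bound difference quotients are integrable against a locally integrable kernel:
  after substituting \<open>x = y + h\<close>, the integral in \<open>y\<close> does not see the shift by \<open>t h\<close>.
\<close>

lemma line_integral_kernel_finite:
  fixes z :: "'a::euclidean_space" and M :: "'a \<Rightarrow> ennreal"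
  assumes M[measurable]: "M \<in> borel_measurable borel" and Mfin: "(\<integral>\<^sup>+x. M x \<partial>lborel) < \<infinity>"
    and b: "0 < b" "b < real DIM('a)"
  shows "(\<integral>\<^sup>+(x, y). indicator (ball z R) x * indicator (ball z R) y * ennreal (norm (x - y) powr (- b)) 
     * (\<integral>\<^sup>+t. indicator {0..1} t * M (y + t *\<^sub>R (x - y)) \<partial>lborel) \<partial>lborel) < \<infinity>"
proof -
  define I :: "'a \<Rightarrow> ennreal" where "I x = indicator (ball z R) x" for x
  define J :: "'a \<Rightarrow> ennreal" where "J x = indicator (ball 0 (2 * R)) x" for x
  have [measurable]: "I \<in> borel_measurable borel" "J \<in> borel_measurable borel"
    unfolding I_def[abs_def] J_def[abs_def] by (rule borel_measurable_indicator; simp)+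
  define f where "f x y = I x * I y * ennreal (norm (x - y) powr (- b)) 
     * (\<integral>\<^sup>+t. indicator {0..1} t * M (y + t *\<^sub>R (x - y)) \<partial>lborel)" for x y
  have [measurable]: "(\<lambda>(x, y). f x y) \<in> borel_measurable (borel \<Otimes>\<^sub>M borel)"
    unfolding f_def by measurable
  have IJ: "I (h + y) * I y \<le> J h" for h y
  proof -
    have "norm h < 2 * R" if "h + y \<in> ball z R" "y \<in> ball z R"
      using that norm_triangle_ineq4[of "(h + y) - z" "y - z"] by (auto simp: dist_norm norm_minus_commute)
    then show ?thesis by (auto simp: I_def J_def indicator_def)
  qed
  have "(\<integral>\<^sup>+(x, y). f x y \<partial>lborel) = (\<integral>\<^sup>+y. \<integral>\<^sup>+x. f x y \<partial>lborel \<partial>lborel)"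
    by (subst lborel_prod[symmetric], subst lborel_pair.nn_integral_snd[symmetric]) (auto simp: case_prod_beta)
  also have "\<dots> = (\<integral>\<^sup>+y. \<integral>\<^sup>+h. f (h + y) y \<partial>lborel \<partial>lborel)"
    by (subst nn_integral_translate) auto
  also have "\<dots> \<le> (\<integral>\<^sup>+y. \<integral>\<^sup>+h. J h * ennreal (norm h powr (- b)) * 
      (\<integral>\<^sup>+t. indicator {0..1} t * M (y + t *\<^sub>R h) \<partial>lborel) \<partial>lborel \<partial>lborel)"
  proof (intro nn_integral_mono)
    fix y h :: 'a
    show "f (h + y) y \<le> J h * ennreal (norm h powr (- b)) * (\<integral>\<^sup>+t. indicator {0..1} t * M (y + t *\<^sub>R h) \<partial>lborel)"
      unfolding f_def using IJ[of h y] by (simp add: mult_right_mono)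
  qed
  also have "\<dots> = (\<integral>\<^sup>+h. \<integral>\<^sup>+y. J h * ennreal (norm h powr (- b)) * 
      (\<integral>\<^sup>+t. indicator {0..1} t * M (y + t *\<^sub>R h) \<partial>lborel) \<partial>lborel \<partial>lborel)"
    by (rule lborel_pair.Fubini') measurable
  also have "\<dots> = (\<integral>\<^sup>+h. J h * ennreal (norm h powr (- b)) * 
      (\<integral>\<^sup>+y. \<integral>\<^sup>+t. indicator {0..1} t * M (y + t *\<^sub>R h) \<partial>lborel \<partial>lborel) \<partial>lborel)"
    by (intro nn_integral_cong nn_integral_cmult) measurable
  also have "\<dots> = (\<integral>\<^sup>+h. J h * ennreal (norm h powr (- b)) * (\<integral>\<^sup>+x. M x \<partial>lborel) \<partial>lborel)"
  proof (rule nn_integral_cong)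
    fix h :: 'a
    have "(\<integral>\<^sup>+y. \<integral>\<^sup>+t. indicator {0..1} t * M (y + t *\<^sub>R h) \<partial>lborel \<partial>lborel)
      = (\<integral>\<^sup>+t. \<integral>\<^sup>+y. indicator {0..1::real} t * M (y + t *\<^sub>R h) \<partial>lborel \<partial>lborel)"
      by (rule lborel_pair.Fubini') measurable
    also have "\<dots> = (\<integral>\<^sup>+t. indicator {0..1::real} t * (\<integral>\<^sup>+y. M y \<partial>lborel) \<partial>lborel)"
      by (intro nn_integral_cong) (simp add: nn_integral_cmult nn_integral_translate)
    also have "\<dots> = (\<integral>\<^sup>+y. M y \<partial>lborel)"
      by (subst nn_integral_multc) auto
    finally show "J h * ennreal (norm h powr (- b)) * 
        (\<integral>\<^sup>+y. \<integral>\<^sup>+t. indicator {0..1} t * M (y + t *\<^sub>R h) \<partial>lborel \<partial>lborel)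
        = J h * ennreal (norm h powr (- b)) * (\<integral>\<^sup>+x. M x \<partial>lborel)" by (simp only:)
  qed
  also have "\<dots> = (\<integral>\<^sup>+h. J h * ennreal (norm h powr (- b)) \<partial>lborel) * (\<integral>\<^sup>+x. M x \<partial>lborel)"
    by (rule nn_integral_multc) measurable
  also have "\<dots> < \<infinity>"
    using nn_integral_kernel_near[of b "2 * R", where 'a='a] b Mfin by (simp add: J_def ennreal_mult_less_top)
  finally show ?thesis by (simp add: f_def I_def)
qed

lemma crude_Young:
  fixes a b p :: real
  assumes "a \<ge> 0" "b \<ge> 0" "p \<ge> 1"
  shows "a powr (p - 1) * b \<le> a powr p + b powr p"
proof -
  have pp: "x powr (p - 1) * x = x powr p" if "x \<ge> 0" for x :: real
    using that assms powr_add[of x "p - 1" 1] by (cases "x = 0") auto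
  show ?thesis
  proof (cases "b \<le> a")
    case True
    then have "a powr (p - 1) * b \<le> a powr (p - 1) * a" by (intro mult_left_mono) auto
    then show ?thesis using pp[OF assms(1)] powr_ge_zero[of b p] by linarith
  next
    case False
    then have "a powr (p - 1) * b \<le> b powr (p - 1) * b" using assms by (intro mult_right_mono powr_mono2) auto
    then show ?thesis using pp[OF assms(2)] powr_ge_zero[of a p] by linarith
  qed
qed

lemma powr_neg_Lipschitz:
  fixes a b \<kappa> q :: real
  assumes "q > 1" "\<kappa> > 0" "a \<ge> 0" "b \<ge> 0"
  shows "\<bar>(a + \<kappa>) powr (1 - q) - (b + \<kappa>) powr (1 - q)\<bar> \<le> (q - 1) * \<kappa> powr (- q) * \<bar>a - b\<bar>"
proof -
  have "norm ((a + \<kappa>) powr (1 - q) - (b + \<kappa>) powr (1 - q)) \<le> ((q - 1) * \<kappa> powr (- q)) * norm (a - b)"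
  proof (rule field_differentiable_bound[where S="{0..}" and f'="\<lambda>t. (1 - q) * (t + \<kappa>) powr (- q)"])
    fix t :: real assume t: "t \<in> {0..}"
    show "((\<lambda>t. (t + \<kappa>) powr (1 - q)) has_field_derivative (1 - q) * (t + \<kappa>) powr (- q)) (at t within {0..})"
      using t assms by (auto intro!: derivative_eq_intros)
    have "(t + \<kappa>) powr (- q) \<le> \<kappa> powr (- q)" using t assms by (intro powr_mono2') auto
    then show "norm ((1 - q) * (t + \<kappa>) powr (- q)) \<le> (q - 1) * \<kappa> powr (- q)"
      using assms by (simp add: abs_mult mult_left_mono)
  qed (use assms in auto)
  then show ?thesis by simp
qed

lemma scaled_bump_test_function:
  fixes y0 :: "'a::euclidean_space"
  assumes "r > 0" "\<And>k. C_k k h" "cball y0 r \<subseteq> U" "Q \<noteq> 0"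
  shows "(\<lambda>x. bump ((x - y0) /\<^sub>R r) ^ Q * h x) \<in> test_functions U"
proof -
  have "C_k k (\<lambda>x. bump ((x - y0) /\<^sub>R r))" for k
    using C_k_affine[OF C_k_bump, of k "inverse r" "- (y0 /\<^sub>R r)"] by (simp add: scaleR_diff_right)
  then have C: "C_k k (\<lambda>x. bump ((x - y0) /\<^sub>R r) ^ Q * h x)" for k
    using assms(2) by (intro C_k_mult C_k_power)
  have supp: "{x. bump ((x - y0) /\<^sub>R r) ^ Q * h x \<noteq> 0} \<subseteq> cball y0 r"
    using mollifier_support_aux[OF assms(1), of "x - y0" for x] assms(4)
    by (force simp: dist_norm norm_minus_commute zero_power)
  then have "closure {x. bump ((x - y0) /\<^sub>R r) ^ Q * h x \<noteq> 0} \<subseteq> cball y0 r" by (simp add: closure_minimal)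
  moreover have "compact (closure {x. bump ((x - y0) /\<^sub>R r) ^ Q * h x \<noteq> 0})"
    using bounded_subset[OF bounded_cball supp] by (simp only: compact_closure)
  ultimately show ?thesis
    using C assms(3) unfolding test_functions_def compactly_contained_def by blast
qed

lemma grad_scaled_bump:
  assumes "r > 0"
  shows "grad (\<lambda>x. bump ((x - y0) /\<^sub>R r)) x = grad bump ((x - y0) /\<^sub>R r) /\<^sub>R r"
proof (rule grad_eqI)
  have "((\<lambda>x. bump ((x - y0) /\<^sub>R r)) has_derivative (\<lambda>v. grad bump ((x - y0) /\<^sub>R r) \<bullet> (v /\<^sub>R r))) (at x)"
    by (rule has_derivative_compose[where g=bump, OF _ smooth_grad(1)[OF C_k_bump]])
      (auto intro!: derivative_eq_intros simp: scaleR_diff_right)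
  then show "((\<lambda>x. bump ((x - y0) /\<^sub>R r)) has_derivative (\<lambda>v. (grad bump ((x - y0) /\<^sub>R r) /\<^sub>R r) \<bullet> v)) (at x)" 
    by simp
qed

lemma grad_power_times_powr:
  fixes w \<eta> :: "'a::euclidean_space \<Rightarrow> real"
  assumes "\<And>k. C_k k \<eta>" "\<And>k. C_k k w" "w x \<ge> 0" "\<kappa> > 0"
  shows "grad (\<lambda>x. \<eta> x ^ Q * (w x + \<kappa>) powr (1 - q)) x
    = (real Q * \<eta> x ^ (Q - 1) * (w x + \<kappa>) powr (1 - q)) *\<^sub>R grad \<eta> x 
      + ((1 - q) * \<eta> x ^ Q * (w x + \<kappa>) powr (- q)) *\<^sub>R grad w x"
proof (rule grad_eqI)
  have d1: "((\<lambda>x. \<eta> x ^ Q) has_derivative (\<lambda>v. real Q * (grad \<eta> x \<bullet> v) * \<eta> x ^ (Q - 1))) (at x)"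
    by (rule has_derivative_power[OF smooth_grad(1)[OF assms(1)]])
  have "((\<lambda>t. (t + \<kappa>) powr (1 - q)) has_real_derivative (1 - q) * (w x + \<kappa>) powr (- q)) (at (w x))"
    using assms by (auto intro!: derivative_eq_intros)
  then have d2: "((\<lambda>x. (w x + \<kappa>) powr (1 - q)) has_derivative (\<lambda>v. (1 - q) * (w x + \<kappa>) powr (- q) * (grad w x \<bullet> v))) (at x)"
    using has_derivative_compose[OF smooth_grad(1)[OF assms(2)]] unfolding has_field_derivative_def by blast
  show "((\<lambda>x. \<eta> x ^ Q * (w x + \<kappa>) powr (1 - q)) has_derivative (\<lambda>v. ((real Q * \<eta> x ^ (Q - 1) * (w x + \<kappa>) powr (1 - q)) *\<^sub>R grad \<eta> x 
      + ((1 - q) * \<eta> x ^ Q * (w x + \<kappa>) powr (- q)) *\<^sub>R grad w x) \<bullet> v)) (at x)"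
    by (rule has_derivative_eq_rhs[OF has_derivative_mult[OF d1 d2]]) (auto simp: inner_add_left algebra_simps)
qed

lemma norm_scaleR_inverse: "r > 0 \<Longrightarrow> norm (x /\<^sub>R r) = norm x / r"
  by (simp add: divide_inverse_commute)

lemma ennreal_add_le: "ennreal (a + b) \<le> ennreal a + ennreal b"
proof (cases "a \<ge> 0 \<and> b \<ge> 0")
  case False
  then have "ennreal (a + b) \<le> ennreal a \<or> ennreal (a + b) \<le> ennreal b"
    by (auto intro!: ennreal_leI)
  then show ?thesis by (auto intro: add_increasing add_increasing2)
qed simp

text \<open>
  The equation tested with \<open>\<eta> ^ Q * (u + \<kappa>) powr (1 - q)\<close>, where \<open>\<eta>\<close> is the bump of radius \<open>r\<close>, in integrated form; \<open>Fl\<close> stands for the singular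
  term. The smooth test functions contain approximants \<open>w n\<close> in place of \<open>u\<close>. In the limit, the pointwise
  inequalities of the preceding sections remove the gradient and the differences of \<open>u\<close> from the right-hand side. They do not apply before the
  limit, because the integrands of the equation contain \<open>u\<close> and \<open>G\<close> themselves.
\<close>

lemma caccioppoli_ball:
  fixes u Fl :: "'a::euclidean_space \<Rightarrow> real" and G :: "'a \<Rightarrow> 'a" and y0 :: 'a and w :: "nat \<Rightarrow> 'a \<Rightarrow> real"
    and M :: "'a \<Rightarrow> ennreal" and Q :: nat
  assumes s: "0 < s" "s < 1" and q: "1 < q" "q \<le> p" and p: "p < real DIM('a)" and Q: "p \<le> real Q"
    and \<kappa>: "\<kappa> > 0" and r: "r > 0"
    and u[measurable]: "u \<in> borel_measurable borel" "\<And>x. u x \<ge> 0"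
    and G[measurable]: "G \<in> borel_measurable borel"
    and Fl[measurable]: "Fl \<in> borel_measurable borel" "\<And>x. Fl x \<ge> 0"
    and weak: "\<And>\<phi>. \<phi> \<in> test_functions U \<Longrightarrow> (\<And>x. \<phi> x \<ge> 0) \<Longrightarrow>
        integrable lborel (\<lambda>x. bracket_pow (G x) (p - 1) \<bullet> grad \<phi> x) \<and>
        integrable lborel (nonlocal_integrand q s u \<phi>) \<and> integrable lborel (\<lambda>x. Fl x * \<phi> x) \<and>
        (\<integral>x. Fl x * \<phi> x \<partial>lborel) 
          \<le> (\<integral>x. bracket_pow (G x) (p - 1) \<bullet> grad \<phi> x \<partial>lborel) + (\<integral>z. nonlocal_integrand q s u \<phi> z \<partial>lborel)"
    and U: "ball y0 (3 * r) \<subseteq> U"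
    and w: "\<And>n k. C_k k (w n)" "\<And>n x. w n x \<ge> 0"
      "AE x in lborel. x \<in> ball y0 (3 * r) \<longrightarrow> (\<lambda>n. w n x) \<longlonglongrightarrow> u x"
      "AE x in lborel. x \<in> ball y0 (3 * r) \<longrightarrow> (\<lambda>n. grad (w n) x) \<longlonglongrightarrow> G x"
    and M[measurable]: "M \<in> borel_measurable borel" and Mfin: "(\<integral>\<^sup>+x. M x \<partial>lborel) < \<infinity>"
    and wM: "\<And>n x. x \<in> ball y0 (3 * r) \<Longrightarrow> ennreal (norm (grad (w n) x) powr p) \<le> M x"
    and L: "L > 0" "\<And>x y :: 'a. \<bar>bump x - bump y\<bar> \<le> L * norm (x - y)" "\<And>x :: 'a. norm (grad bump x) \<le> L"
  shows "(\<integral>\<^sup>+x. ennreal (Fl x * (bump ((x - y0) /\<^sub>R r) ^ Q * (u x + \<kappa>) powr (1 - q))) \<partial>lborel)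
     \<le> ennreal (real Q powr p / (q - 1) powr (p - 1) * (L / r) powr p) * 
         (\<integral>\<^sup>+x. indicator (ball y0 r) x * ennreal ((u x + \<kappa>) powr (p - q)) \<partial>lborel)
       + ennreal (r powr (real DIM('a) - s * q)) * bump_energy TYPE('a) q (real DIM('a) + s * q) (real Q / q)"
proof -
  define S where "S = ball y0 (3 * r)"
  define c where "c = real DIM('a) + s * q"
  define \<eta> where "\<eta> x = bump ((x - y0) /\<^sub>R r)" for x
  define \<phi> where "\<phi> n x = \<eta> x ^ Q * (w n x + \<kappa>) powr (1 - q)" for n x
  define \<psi> where "\<psi> x = \<eta> x ^ Q * (u x + \<kappa>) powr (1 - q)" for x
  define c0 where "c0 = \<kappa> powr (1 - q)"
  define c1 where "c1 = (q - 1) * \<kappa> powr (- q)"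
  define ca where "ca = real Q * c0 * (L / r)"
  have p1: "p > 1" using q by simp
  have Q2: "Q \<ge> 2" using p1 Q by linarith
  have c0: "c0 > 0" and c1: "c1 > 0" and ca: "ca > 0" 
    using \<kappa> q L r Q2 by (auto simp: c0_def c1_def ca_def intro!: mult_pos_pos)
  have \<eta>C: "C_k k \<eta>" for k
    using C_k_affine[OF C_k_bump, of k "inverse r" "- (y0 /\<^sub>R r)"] by (simp add: \<eta>_def[abs_def] scaleR_diff_right)
  have \<eta>: "0 \<le> \<eta> x" "\<eta> x \<le> 1" for x by (simp_all add: \<eta>_def bump_nonneg bump_le_1)
  have \<eta>0: "\<eta> x = 0 \<longleftrightarrow> x \<notin> ball y0 r" for x
    using mollifier_support_aux[OF r, of "x - y0"] by (auto simp: \<eta>_def dist_norm norm_minus_commute)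
  have \<eta>Q: "0 \<le> \<eta> x ^ k" "\<eta> x ^ k \<le> 1" for x k using \<eta> by (auto intro: power_le_one)
  have \<eta>L: "\<bar>\<eta> x - \<eta> y\<bar> \<le> L / r * norm (x - y)" for x y
  proof -
    have "\<bar>\<eta> x - \<eta> y\<bar> \<le> L * norm ((x - y0) /\<^sub>R r - (y - y0) /\<^sub>R r)" unfolding \<eta>_def by (rule L)
    also have "(x - y0) /\<^sub>R r - (y - y0) /\<^sub>R r = (x - y) /\<^sub>R r" by (simp add: algebra_simps)
    also have "norm ((x - y) /\<^sub>R r) = norm (x - y) / r" 
      by (rule norm_scaleR_inverse[OF r])
    finally show ?thesis by simp
  qed
  have g\<eta>: "norm (grad \<eta> x) \<le> L / r" for x
    using grad_scaled_bump[OF r, of y0 x] L(3)[of "(x - y0) /\<^sub>R r"] r 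
    unfolding \<eta>_def[abs_def] by (simp add: field_simps)
  have [measurable]: "\<eta> \<in> borel_measurable borel" "grad \<eta> \<in> borel_measurable borel"
    using \<eta>C smooth_grad(3)[OF \<eta>C] by (auto intro!: borel_measurable_continuous_onI C_k_imp_continuous)
  have [measurable]: "\<psi> \<in> borel_measurable borel" unfolding \<psi>_def[abs_def] by measurable
  have [simp]: "\<phi> n x \<ge> 0" "\<psi> x \<ge> 0" for n x by (simp_all add: \<phi>_def \<psi>_def \<eta>)
  have test: "\<phi> n \<in> test_functions U" for n
  proof -
    have "cball y0 r \<subseteq> ball y0 (3 * r)" using r by auto
    then show ?thesis unfolding \<phi>_def[abs_def] \<eta>_def using U
      by (intro scaled_bump_test_function r C_k_powr C_k_add C_k_const w)
        (use w(2) \<kappa> Q2 in \<open>auto simp: add_nonneg_pos\<close>)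
  qed
  note WI = weak[OF test, simplified]
  have in_S: "x \<in> S" if "\<eta> x \<noteq> 0" for x
    using that r unfolding \<eta>0 S_def by auto
  have pw_le: "(w n x + \<kappa>) powr (- e) \<le> \<kappa> powr (- e)" if "e \<ge> 0" for n x e
    using w(2)[of n x] \<kappa> that by (intro powr_mono2') auto
  have \<phi>_le: "\<phi> n x \<le> c0" for n x
  proof -
    have "\<phi> n x \<le> 1 * c0" unfolding \<phi>_def c0_def 
      using pw_le[of "q - 1" n x] q \<eta>Q by (intro mult_mono) auto
    then show ?thesis by simp
  qed
  have \<phi>_lim: "AE x in lborel. (\<lambda>n. \<phi> n x) \<longlonglongrightarrow> \<psi> x"
    using w(3)
  proof eventually_elim
    case (elim x)
    show ?case
    proof (cases "\<eta> x = 0")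
      case True then show ?thesis using Q2 by (simp add: \<phi>_def \<psi>_def zero_power)
    next
      case False
      from in_S[OF this] elim have "(\<lambda>n. w n x) \<longlonglongrightarrow> u x" by (simp add: S_def)
      then show ?thesis unfolding \<phi>_def \<psi>_def
        using u(2)[of x] \<kappa> by (intro tendsto_intros) auto
    qed
  qed
  have GM: "AE x in lborel. x \<in> S \<longrightarrow> ennreal (norm (G x) powr p) \<le> M x"
    using w(4)
  proof eventually_elim
    case (elim x)
    show ?case
    proof
      assume x: "x \<in> S"
      then have "(\<lambda>n. grad (w n) x) \<longlonglongrightarrow> G x" using elim by (simp add: S_def)
      then have "(\<lambda>n. ennreal (norm (grad (w n) x) powr p)) \<longlonglongrightarrow> ennreal (norm (G x) powr p)"
        using p1 by (intro tendsto_ennrealI tendsto_powr' tendsto_intros) auto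
      then show "ennreal (norm (G x) powr p) \<le> M x"
        by (rule LIMSEQ_le_const2) (use wM x in \<open>auto simp: S_def\<close>)
    qed
  qed

  \<comment> \<open>Local integrands: Young's inequality bounds them by a constant plus a multiple of \<open>M\<close>, on a bounded set.\<close>
  define P where "P n x = bracket_pow (G x) (p - 1) \<bullet> grad (\<phi> n) x" for n x
  define P' where "P' x = bracket_pow (G x) (p - 1) \<bullet> ((real Q * \<eta> x ^ (Q - 1) * (u x + \<kappa>) powr (1 - q)) *\<^sub>R grad \<eta> x 
      + ((1 - q) * \<eta> x ^ Q * (u x + \<kappa>) powr (- q)) *\<^sub>R G x)" for x
  have grad_\<phi>: "grad (\<phi> n) x = (real Q * \<eta> x ^ (Q - 1) * (w n x + \<kappa>) powr (1 - q)) *\<^sub>R grad \<eta> x 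
      + ((1 - q) * \<eta> x ^ Q * (w n x + \<kappa>) powr (- q)) *\<^sub>R grad (w n) x" for n x
    unfolding \<phi>_def[abs_def] by (rule grad_power_times_powr[OF \<eta>C w(1) w(2) \<kappa>])
  have P0: "P n x = 0" "P' x = 0" if "\<eta> x = 0" for n x
    using that Q2 by (simp_all add: P_def P'_def grad_\<phi> zero_power)
  have P_lim: "AE x in lborel. (\<lambda>n. P n x) \<longlonglongrightarrow> P' x"
    using w(3,4)
  proof eventually_elim
    case (elim x)
    show ?case
    proof (cases "\<eta> x = 0")
      case True then show ?thesis by (simp add: P0)
    next
      case False
      from in_S[OF this] elim have "(\<lambda>n. w n x) \<longlonglongrightarrow> u x" "(\<lambda>n. grad (w n) x) \<longlonglongrightarrow> G x" by (simp_all add: S_def)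
      then show ?thesis unfolding P_def P'_def grad_\<phi>
        using u(2)[of x] \<kappa> by (intro tendsto_intros) auto
    qed
  qed
  define IS :: "'a \<Rightarrow> ennreal" where "IS x = indicator S x" for x
  have IS[measurable]: "IS \<in> borel_measurable borel"
    unfolding IS_def[abs_def] S_def by (rule borel_measurable_indicator) simp
  have IS_fin: "(\<integral>\<^sup>+x. IS x \<partial>lborel) < \<infinity>"
    using emeasure_lborel_ball_finite[of y0 "3 * r"] by (simp add: IS_def S_def)
  define W1 where "W1 x = ennreal (ca powr p) * IS x + ennreal (2 + c1 powr p) * M x" for x
  have P_dom: "AE x in lborel. \<forall>n. ennreal \<bar>P n x\<bar> \<le> W1 x"
    using GM
  proof eventually_elim
    case (elim x)
    show ?case
    proof
      fix n
      show "ennreal \<bar>P n x\<bar> \<le> W1 x"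
      proof (cases "\<eta> x = 0")
        case True then show ?thesis by (simp add: P0)
      next
        case False
        then have x: "x \<in> S" by (rule in_S)
        define a where "a = norm (G x)"
        define b where "b = norm (grad (w n) x)"
        have ng: "norm (grad (\<phi> n) x) \<le> ca + c1 * b"
        proof -
          have "real Q * \<eta> x ^ (Q - 1) * (w n x + \<kappa>) powr (1 - q) \<le> real Q * 1 * c0"
            using \<eta>Q[of x "Q - 1"] pw_le[of "q - 1" n x] q by (intro mult_mono) (auto simp: c0_def)
          then have "norm ((real Q * \<eta> x ^ (Q - 1) * (w n x + \<kappa>) powr (1 - q)) *\<^sub>R grad \<eta> x) \<le> (real Q * 1 * c0) * (L / r)"
            using g\<eta>[of x] \<eta>Q(1)[of x "Q - 1"] c0 unfolding norm_scaleR by (intro mult_mono) auto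
          moreover have "(q - 1) * \<eta> x ^ Q * (w n x + \<kappa>) powr (- q) \<le> (q - 1) * 1 * \<kappa> powr (- q)"
            using \<eta>Q[of x Q] pw_le[of q n x] q by (intro mult_mono) auto
          then have "norm (((1 - q) * \<eta> x ^ Q * (w n x + \<kappa>) powr (- q)) *\<^sub>R grad (w n) x) \<le> ((q - 1) * 1 * \<kappa> powr (- q)) * b"
            using \<eta>Q(1)[of x Q] q unfolding norm_scaleR b_def by (intro mult_mono) (auto simp: abs_mult)
          ultimately show ?thesis unfolding grad_\<phi> ca_def c1_def
            using norm_triangle_ineq[of "(real Q * \<eta> x ^ (Q - 1) * (w n x + \<kappa>) powr (1 - q)) *\<^sub>R grad \<eta> x" 
              "((1 - q) * \<eta> x ^ Q * (w n x + \<kappa>) powr (- q)) *\<^sub>R grad (w n) x"] by simp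
        qed
        have "\<bar>P n x\<bar> \<le> norm (bracket_pow (G x) (p - 1)) * norm (grad (\<phi> n) x)"
          unfolding P_def by (rule Cauchy_Schwarz_ineq2)
        also have "\<dots> \<le> a powr (p - 1) * (ca + c1 * b)"
          using ng p1 by (simp add: norm_bracket_pow a_def mult_left_mono)
        also have "\<dots> = a powr (p - 1) * ca + a powr (p - 1) * (c1 * b)" by (simp add: algebra_simps)
        also have "\<dots> \<le> (a powr p + ca powr p) + (a powr p + (c1 * b) powr p)"
          using p1 ca c1 by (intro add_mono crude_Young) (auto simp: a_def b_def)
        also have "\<dots> = ca powr p + 2 * a powr p + c1 powr p * b powr p" by (simp add: powr_mult)
        finally have "ennreal \<bar>P n x\<bar> \<le> ennreal (ca powr p + 2 * a powr p + c1 powr p * b powr p)" by (rule ennreal_leI)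
        also have "\<dots> = ennreal (ca powr p) + (ennreal 2 * ennreal (a powr p) + ennreal (c1 powr p) * ennreal (b powr p))"
          by (simp add: ennreal_mult)
        also have "\<dots> \<le> ennreal (ca powr p) + (ennreal 2 * M x + ennreal (c1 powr p) * M x)"
          using elim x wM[of x n] by (intro add_left_mono add_mono mult_left_mono) (auto simp: a_def b_def S_def)
        also have "\<dots> = W1 x" using x by (simp add: W1_def IS_def distrib_right)
        finally show ?thesis .
      qed
    qed
  qed
  have W1m: "W1 \<in> borel_measurable lborel" unfolding W1_def[abs_def] by measurable
  have W1fin: "(\<integral>\<^sup>+x. W1 x \<partial>lborel) < \<infinity>"
  proof -
    have "(\<integral>\<^sup>+x. W1 x \<partial>lborel) = ennreal (ca powr p) * (\<integral>\<^sup>+x. IS x \<partial>lborel) + ennreal (2 + c1 powr p) * (\<integral>\<^sup>+x. M x \<partial>lborel)"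
      unfolding W1_def by (simp add: nn_integral_add nn_integral_cmult)
    also have "\<dots> < \<infinity>" using IS_fin Mfin by (simp add: ennreal_mult_less_top ennreal_add_less_top)
    finally show ?thesis .
  qed
  have P'm: "P' \<in> borel_measurable lborel" unfolding P'_def[abs_def] bracket_pow_def by measurable
  have Pm: "P n \<in> borel_measurable lborel" for n
    using WI[of n] unfolding P_def[abs_def] by (blast intro: borel_measurable_integrable)
  note local_limit = dominated_convergence_ennreal[OF Pm P'm P_lim P_dom W1m W1fin]
  have P'_le: "P' x \<le> real Q powr p / (q - 1) powr (p - 1) * (L / r) powr p * (indicator (ball y0 r) x * (u x + \<kappa>) powr (p - q))" for x
  proof (cases "\<eta> x = 0")
    case True
    then show ?thesis by (simp add: P0 \<eta>0)
  next
    case False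
    then have x: "x \<in> ball y0 r" using \<eta>0 by auto
    have pos: "0 < u x + \<kappa>" using u(2)[of x] \<kappa> by simp
    have "P' x = real Q * \<eta> x ^ (Q - 1) * (u x + \<kappa>) powr (1 - q) * (bracket_pow (G x) (p - 1) \<bullet> grad \<eta> x)
        + (1 - q) * \<eta> x ^ Q * (u x + \<kappa>) powr (- q) * norm (G x) powr p"
      unfolding P'_def using bracket_pow_inner_self[OF p1, of "G x"] by (simp add: inner_add_right)
    also have "\<dots> \<le> real Q * \<eta> x ^ (Q - 1) * (u x + \<kappa>) powr (1 - q) * (norm (G x) powr (p - 1) * (L / r))
        + (1 - q) * \<eta> x ^ Q * (u x + \<kappa>) powr (- q) * norm (G x) powr p"
    proof (intro add_right_mono mult_left_mono)
      have "bracket_pow (G x) (p - 1) \<bullet> grad \<eta> x \<le> norm (bracket_pow (G x) (p - 1)) * norm (grad \<eta> x)"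
        by (rule norm_cauchy_schwarz)
      also have "\<dots> \<le> norm (G x) powr (p - 1) * (L / r)"
        using mult_left_mono[OF g\<eta>[of x], of "norm (G x) powr (p - 1)"] p1 by (simp add: norm_bracket_pow)
      finally show "bracket_pow (G x) (p - 1) \<bullet> grad \<eta> x \<le> norm (G x) powr (p - 1) * (L / r)" .
    qed (use \<eta>Q in auto)
    also have "\<dots> = real Q * \<eta> x ^ (Q - 1) * (L / r) * norm (G x) powr (p - 1) * (u x + \<kappa>) powr (1 - q) 
        - (q - 1) * \<eta> x ^ Q * norm (G x) powr p * (u x + \<kappa>) powr (- q)" by (simp add: algebra_simps)
    also have "\<dots> \<le> (real Q powr p / (q - 1) powr (p - 1)) * (L / r) powr p * (u x + \<kappa>) powr (p - q)"
      using q p1 Q \<eta> pos L r by (intro gradient_absorption) auto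
    finally show ?thesis using x by simp
  qed
  have local_bound: "ennreal (\<integral>x. P' x \<partial>lborel) \<le> ennreal (real Q powr p / (q - 1) powr (p - 1) * (L / r) powr p) * 
         (\<integral>\<^sup>+x. indicator (ball y0 r) x * ennreal ((u x + \<kappa>) powr (p - q)) \<partial>lborel)"
  proof -
    have "ennreal (\<integral>x. P' x \<partial>lborel) \<le> (\<integral>\<^sup>+x. ennreal (real Q powr p / (q - 1) powr (p - 1) * (L / r) powr p) * 
         (indicator (ball y0 r) x * ennreal ((u x + \<kappa>) powr (p - q))) \<partial>lborel)"
    proof (rule ennreal_integral_le_nn_integral[OF local_limit(1)], intro AE_I2)
      fix x
      have "ennreal (P' x) \<le> ennreal (real Q powr p / (q - 1) powr (p - 1) * (L / r) powr p * (indicator (ball y0 r) x * (u x + \<kappa>) powr (p - q)))"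
        by (rule ennreal_leI[OF P'_le])
      also have "\<dots> = ennreal (real Q powr p / (q - 1) powr (p - 1) * (L / r) powr p) * 
         (indicator (ball y0 r) x * ennreal ((u x + \<kappa>) powr (p - q)))"
      proof -
        define K where "K = real Q powr p / (q - 1) powr (p - 1) * (L / r) powr p"
        have "K \<ge> 0" by (simp add: K_def)
        then show ?thesis unfolding K_def[symmetric]
          by (cases "x \<in> ball y0 r") (simp_all add: ennreal_mult')
      qed
      finally show "ennreal (P' x) \<le> \<dots>" .
    qed
    also have "\<dots> = ennreal (real Q powr p / (q - 1) powr (p - 1) * (L / r) powr p) * 
         (\<integral>\<^sup>+x. indicator (ball y0 r) x * ennreal ((u x + \<kappa>) powr (p - q)) \<partial>lborel)"
      by (rule nn_integral_cmult)
        (intro borel_measurable_times_ennreal borel_measurable_indicator; measurable)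
    finally show ?thesis .
  qed

  \<comment> \<open>Nonlocal integrands: a pair in the double ball is treated by Young's inequality, the difference quotients of \<open>w n\<close>
    and of \<open>u\<close> being bounded by line integrals of the majorant. For other pairs with a point in the support of \<open>\<eta>\<close>, the second point
    lies outside the double ball, and the integrand of the larger bump \<open>\<phi>0\<close>, whose integrability is part of the weak
    formulation, is a majorant.\<close>
  define B2 where "B2 = ball y0 (2 * r)"
  define b where "b = c - q"
  have b: "0 < b" "b < real DIM('a)"
  proof -
    have "q * s < q * 1" using s q by (intro mult_strict_left_mono) auto
    then show "b < real DIM('a)" by (simp add: b_def c_def algebra_simps)
    have "0 < s * q" using s q by simp
    then show "0 < b" using p q by (simp add: b_def c_def)
  qed
  define M' where "M' x = IS x + M x" for x
  have [measurable]: "M' \<in> borel_measurable borel" unfolding M'_def[abs_def] by measurable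
  have M'fin: "(\<integral>\<^sup>+x. M' x \<partial>lborel) < \<infinity>"
    unfolding M'_def using IS_fin Mfin by (simp add: nn_integral_add ennreal_add_less_top)
  define Li where "Li x y = (\<integral>\<^sup>+t. indicator {0..1} t * M' (y + t *\<^sub>R (x - y)) \<partial>lborel)" for x y
  have conv: "convex S" by (simp add: S_def)
  have Li_ge: "1 \<le> Li x y" if "x \<in> S" "y \<in> S" for x y
  proof -
    have "(1::ennreal) = (\<integral>\<^sup>+t. indicator {0..1::real} t \<partial>lborel)" by simp
    also have "\<dots> \<le> Li x y" unfolding Li_def
    proof (rule nn_integral_mono)
      fix t :: real
      have "y + t *\<^sub>R (x - y) \<in> S" if "t \<in> {0..1}"
      proof -
        have "y + t *\<^sub>R (x - y) = (1 - t) *\<^sub>R y + t *\<^sub>R x" by (simp add: algebra_simps)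
        then show ?thesis using conv \<open>x \<in> S\<close> \<open>y \<in> S\<close> that by (auto simp: convex_alt)
      qed
      then show "indicator {0..1} t \<le> indicator {0..1} t * M' (y + t *\<^sub>R (x - y))"
        by (auto simp: M'_def IS_def indicator_def)
    qed
    finally show ?thesis .
  qed
  have gradq: "ennreal (norm (grad (w n) x) powr q) \<le> M' x" if x: "x \<in> S" for n x
  proof -
    have "norm (grad (w n) x) powr q \<le> 1 + norm (grad (w n) x) powr p"
    proof (cases "norm (grad (w n) x) \<le> 1")
      case True
      then have "norm (grad (w n) x) powr q \<le> 1" using q by (intro powr_le1) auto
      then show ?thesis using powr_ge_zero[of "norm (grad (w n) x)" p] by linarith
    next
      case False
      then have "norm (grad (w n) x) powr q \<le> norm (grad (w n) x) powr p" using q by (intro powr_mono) auto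
      then show ?thesis by linarith
    qed
    then have "ennreal (norm (grad (w n) x) powr q) \<le> ennreal (1 + norm (grad (w n) x) powr p)" by (rule ennreal_leI)
    also have "\<dots> = 1 + ennreal (norm (grad (w n) x) powr p)" by (simp add: ennreal_plus)
    also have "\<dots> \<le> 1 + M x" using wM x by (intro add_left_mono) (auto simp: S_def)
    also have "\<dots> = M' x" using x by (simp add: M'_def IS_def)
    finally show ?thesis .
  qed
  have w_diff: "ennreal (\<bar>w n x - w n y\<bar> powr q) \<le> ennreal (norm (x - y) powr q) * Li x y" if "x \<in> S" "y \<in> S" for n x y
    unfolding Li_def using q by (intro powr_diff_le_line_integral[OF w(1) conv that _ gradq]) auto
  have u_diff: "AE z in lborel. fst z \<in> S \<longrightarrow> snd z \<in> S \<longrightarrow>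
     ennreal (\<bar>u (fst z) - u (snd z)\<bar> powr q) \<le> ennreal (norm (fst z - snd z) powr q) * Li (fst z) (snd z)"
    using AE_lborel_prod[OF w(3)]
  proof (eventually_elim, intro impI)
    fix z :: "'a \<times> 'a" 
    assume lim: "(fst z \<in> ball y0 (3 * r) \<longrightarrow> (\<lambda>n. w n (fst z)) \<longlonglongrightarrow> u (fst z)) \<and>
         (snd z \<in> ball y0 (3 * r) \<longrightarrow> (\<lambda>n. w n (snd z)) \<longlonglongrightarrow> u (snd z))" and z: "fst z \<in> S" "snd z \<in> S"
    then have "(\<lambda>n. ennreal (\<bar>w n (fst z) - w n (snd z)\<bar> powr q)) \<longlonglongrightarrow> ennreal (\<bar>u (fst z) - u (snd z)\<bar> powr q)"
      using q by (intro tendsto_ennrealI tendsto_powr' tendsto_intros) (auto simp: S_def)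
    then show "ennreal (\<bar>u (fst z) - u (snd z)\<bar> powr q) \<le> ennreal (norm (fst z - snd z) powr q) * Li (fst z) (snd z)"
      by (rule LIMSEQ_le_const2) (use w_diff z in auto)
  qed
  have \<phi>_diff: "\<bar>\<phi> n x - \<phi> n y\<bar> \<le> ca * norm (x - y) + c1 * \<bar>w n x - w n y\<bar>" for n x y
  proof -
    have "\<phi> n x - \<phi> n y = (\<eta> x ^ Q - \<eta> y ^ Q) * (w n x + \<kappa>) powr (1 - q) 
        + \<eta> y ^ Q * ((w n x + \<kappa>) powr (1 - q) - (w n y + \<kappa>) powr (1 - q))"
      by (simp add: \<phi>_def algebra_simps)
    also have "\<bar>\<dots>\<bar> \<le> \<bar>\<eta> x ^ Q - \<eta> y ^ Q\<bar> * (w n x + \<kappa>) powr (1 - q) 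
        + \<eta> y ^ Q * \<bar>(w n x + \<kappa>) powr (1 - q) - (w n y + \<kappa>) powr (1 - q)\<bar>"
      using \<eta>Q by (intro order_trans[OF abs_triangle_ineq]) (simp add: abs_mult)
    also have "\<dots> \<le> (real Q * (L / r * norm (x - y))) * c0 + 1 * (c1 * \<bar>w n x - w n y\<bar>)"
    proof (intro add_mono mult_mono)
      have "\<bar>\<eta> x ^ Q - \<eta> y ^ Q\<bar> \<le> real Q * \<bar>\<eta> x - \<eta> y\<bar>"
        using norm_power_diff[of "\<eta> x" "\<eta> y" Q] \<eta> by simp
      also have "\<dots> \<le> real Q * (L / r * norm (x - y))" using \<eta>L by (intro mult_left_mono) auto
      finally show "\<bar>\<eta> x ^ Q - \<eta> y ^ Q\<bar> \<le> real Q * (L / r * norm (x - y))" .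
      show "(w n x + \<kappa>) powr (1 - q) \<le> c0" using pw_le[of "q - 1" n x] q by (simp add: c0_def)
      show "\<bar>(w n x + \<kappa>) powr (1 - q) - (w n y + \<kappa>) powr (1 - q)\<bar> \<le> c1 * \<bar>w n x - w n y\<bar>"
        unfolding c1_def using q \<kappa> w(2) by (intro powr_neg_Lipschitz) auto
    qed (use \<eta>Q L r in auto)
    finally show ?thesis by (simp add: ca_def algebra_simps)
  qed
  define \<phi>0 where "\<phi>0 x = bump ((x - y0) /\<^sub>R (2 * r)) ^ 1 * exp 2" for x
  have \<phi>0_test: "\<phi>0 \<in> test_functions U"
  proof -
    have "cball y0 (2 * r) \<subseteq> ball y0 (3 * r)" using r by auto
    then show ?thesis unfolding \<phi>0_def[abs_def] using U r
      by (intro scaled_bump_test_function C_k_const) auto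
  qed
  have \<phi>0_out: "\<phi>0 x = 0" if "x \<notin> B2" for x
    using that mollifier_support_aux[of "2 * r" "x - y0"] r by (auto simp: \<phi>0_def B2_def dist_norm norm_minus_commute)
  have \<phi>0_in: "\<phi>0 x \<ge> 1" if "x \<in> ball y0 r" for x
  proof -
    have "norm (x - y0) / (2 * r) \<le> 1 / 2" using that r by (simp add: dist_norm norm_minus_commute)
    then have "norm ((x - y0) /\<^sub>R (2 * r)) \<le> 1 / 2" 
      using r by (subst norm_scaleR_inverse) auto
    from bump_ge[OF this] have "exp (-2) * exp 2 \<le> \<phi>0 x" 
      unfolding \<phi>0_def power_one_right by (rule mult_right_mono) simp
    then show ?thesis by (simp flip: exp_add)
  qed
  have \<phi>0_nn: "\<phi>0 x \<ge> 0" for x by (simp add: \<phi>0_def bump_nonneg)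
  have \<phi>0_int: "integrable lborel (nonlocal_integrand q s u \<phi>0)"
    using weak[OF \<phi>0_test \<phi>0_nn] by blast
  define T where "T n = nonlocal_integrand q s u (\<phi> n)" for n
  define T' where "T' = nonlocal_integrand q s u \<psi>"
  define near :: "'a \<times> 'a \<Rightarrow> ennreal" where "near = (\<lambda>(x, y). indicator B2 x * indicator B2 y * ennreal (norm (x - y) powr (- b)) * Li x y)"
  define CD where "CD = 2 + ca powr q + c1 powr q"
  define W2 where "W2 z = ennreal c0 * ennreal \<bar>nonlocal_integrand q s u \<phi>0 z\<bar> + ennreal CD * near z" for z
  have CD: "CD > 0" by (simp add: CD_def add_pos_nonneg)
  have abs_nl: "\<bar>nonlocal_integrand q s u h (x, y)\<bar> = \<bar>u x - u y\<bar> powr (q - 1) * \<bar>h x - h y\<bar> * norm (x - y) powr (- c)" for h x y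
    using norm_bracket_pow[of "q - 1" "u x - u y"] q
    by (simp add: nonlocal_integrand_def abs_mult c_def[symmetric] powr_minus divide_inverse)
  have T_dom: "AE z in lborel. \<forall>n. ennreal \<bar>T n z\<bar> \<le> W2 z"
    using u_diff
  proof eventually_elim
    fix z :: "'a \<times> 'a" 
    assume ud: "fst z \<in> S \<longrightarrow> snd z \<in> S \<longrightarrow>
     ennreal (\<bar>u (fst z) - u (snd z)\<bar> powr q) \<le> ennreal (norm (fst z - snd z) powr q) * Li (fst z) (snd z)"
    obtain x y where z: "z = (x, y)" by (cases z)
    show "\<forall>n. ennreal \<bar>T n z\<bar> \<le> W2 z"
    proof
      fix n
      have far: "ennreal \<bar>T n z\<bar> \<le> W2 z" if "\<bar>\<phi> n x - \<phi> n y\<bar> \<le> c0 * \<bar>\<phi>0 x - \<phi>0 y\<bar>"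
      proof -
        have "\<bar>T n z\<bar> = (\<bar>u x - u y\<bar> powr (q - 1) * norm (x - y) powr (- c)) * \<bar>\<phi> n x - \<phi> n y\<bar>"
          unfolding T_def z abs_nl by simp
        also have "\<dots> \<le> (\<bar>u x - u y\<bar> powr (q - 1) * norm (x - y) powr (- c)) * (c0 * \<bar>\<phi>0 x - \<phi>0 y\<bar>)"
          using that by (intro mult_left_mono) auto
        also have "\<dots> = c0 * \<bar>nonlocal_integrand q s u \<phi>0 z\<bar>" unfolding z abs_nl by simp
        finally have "ennreal \<bar>T n z\<bar> \<le> ennreal c0 * ennreal \<bar>nonlocal_integrand q s u \<phi>0 z\<bar>"
          using c0 by (simp add: ennreal_leI flip: ennreal_mult')
        also have "\<dots> \<le> W2 z" unfolding W2_def by (simp add: add_increasing2)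
        finally show ?thesis .
      qed
      have out: "\<phi> n x = 0" if "x \<notin> ball y0 r" for x using that \<eta>0[of x] Q2 by (simp add: \<phi>_def zero_power)
      consider "x \<in> B2" "y \<in> B2" | "x \<in> ball y0 r" "y \<notin> B2" | "y \<in> ball y0 r" "x \<notin> B2" 
        | "x \<notin> ball y0 r" "y \<notin> ball y0 r" using r unfolding B2_def by fastforce
      then show "ennreal \<bar>T n z\<bar> \<le> W2 z"
      proof cases
        case 1
        then have S: "x \<in> S" "y \<in> S" using r by (auto simp: B2_def S_def)
        define a where "a = \<bar>u x - u y\<bar>"
        define h where "h = norm (x - y)"
        define d where "d = \<bar>w n x - w n y\<bar>"
        have "a powr (q - 1) * \<bar>\<phi> n x - \<phi> n y\<bar> \<le> a powr (q - 1) * (ca * h + c1 * d)"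
          unfolding d_def h_def using \<phi>_diff by (intro mult_left_mono) auto
        also have "\<dots> = a powr (q - 1) * (ca * h) + a powr (q - 1) * (c1 * d)" by (simp add: algebra_simps)
        also have "\<dots> \<le> (a powr q + (ca * h) powr q) + (a powr q + (c1 * d) powr q)"
          using q ca c1 by (intro add_mono crude_Young) (auto simp: a_def h_def d_def)
        also have "\<dots> = 2 * a powr q + (ca powr q * h powr q + c1 powr q * d powr q)" by (simp add: powr_mult)
        finally have "ennreal (a powr (q - 1) * \<bar>\<phi> n x - \<phi> n y\<bar>) 
            \<le> ennreal (2 * a powr q + (ca powr q * h powr q + c1 powr q * d powr q))" by (rule ennreal_leI)
        also have "\<dots> = ennreal 2 * ennreal (a powr q) + (ennreal (ca powr q) * (ennreal (h powr q) * 1) + ennreal (c1 powr q) * ennreal (d powr q))"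
          by (simp add: ennreal_mult)
        also have "\<dots> \<le> ennreal 2 * (ennreal (h powr q) * Li x y) + (ennreal (ca powr q) * (ennreal (h powr q) * Li x y) 
            + ennreal (c1 powr q) * (ennreal (h powr q) * Li x y))"
          using ud S Li_ge[OF S] w_diff[OF S, of n] unfolding z a_def h_def d_def
          by (intro add_mono mult_left_mono) auto
        also have "\<dots> = ennreal CD * (ennreal (h powr q) * Li x y)"
          unfolding CD_def by (simp add: distrib_right add.assoc)
        finally have main: "ennreal (a powr (q - 1) * \<bar>\<phi> n x - \<phi> n y\<bar>) \<le> ennreal CD * (ennreal (h powr q) * Li x y)" .
        have "ennreal \<bar>T n z\<bar> = ennreal (a powr (q - 1) * \<bar>\<phi> n x - \<phi> n y\<bar>) * ennreal (h powr (- c))"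
          unfolding T_def z abs_nl a_def h_def by (simp add: ennreal_mult')
        also have "\<dots> \<le> ennreal CD * (ennreal (h powr q) * Li x y) * ennreal (h powr (- c))"
          using main by (rule mult_right_mono) simp
        also have "\<dots> = ennreal CD * (ennreal (h powr q) * ennreal (h powr (- c)) * Li x y)"
          by (simp add: mult_ac)
        also have "ennreal (h powr q) * ennreal (h powr (- c)) = ennreal (h powr (- b))"
          by (simp add: b_def flip: ennreal_mult' powr_add)
        also have "ennreal CD * (ennreal (h powr (- b)) * Li x y) = ennreal CD * near z"
          using 1 by (simp add: near_def z h_def)
        also have "\<dots> \<le> W2 z" unfolding W2_def by (simp add: add_increasing)
        finally show ?thesis .
      next
        case 2
        then have "y \<notin> ball y0 r" using r by (auto simp: B2_def)
        then have "\<bar>\<phi> n x - \<phi> n y\<bar> = \<phi> n x" using out[of y] by simp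
        also have "\<dots> \<le> c0 * 1" using \<phi>_le by simp
        also have "\<dots> \<le> c0 * \<bar>\<phi>0 x - \<phi>0 y\<bar>" 
          using \<phi>0_in[OF 2(1)] \<phi>0_out[OF 2(2)] c0 by (intro mult_left_mono) auto
        finally show ?thesis by (rule far)
      next
        case 3
        then have "x \<notin> ball y0 r" using r by (auto simp: B2_def)
        then have "\<bar>\<phi> n x - \<phi> n y\<bar> = \<phi> n y" using out[of x] by simp
        also have "\<dots> \<le> c0 * 1" using \<phi>_le by simp
        also have "\<dots> \<le> c0 * \<bar>\<phi>0 x - \<phi>0 y\<bar>" 
          using \<phi>0_in[OF 3(1)] \<phi>0_out[OF 3(2)] c0 by (intro mult_left_mono) auto
        finally show ?thesis by (rule far)
      next
        case 4
        then show ?thesis using out c0 by (intro far) auto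
      qed
    qed
  qed
  have near_m: "near \<in> borel_measurable lborel"
  proof -
    define J :: "'a \<Rightarrow> ennreal" where "J x = indicator B2 x" for x
    have [measurable]: "J \<in> borel_measurable borel"
      unfolding J_def[abs_def] B2_def by (rule borel_measurable_indicator) simp
    have "(\<lambda>(x, y). J x * J y * ennreal (norm (x - y) powr (- b)) * Li x y) \<in> borel_measurable (lborel \<Otimes>\<^sub>M lborel)"
      unfolding Li_def by measurable
    then show ?thesis unfolding near_def J_def lborel_prod .
  qed
  have W2m: "W2 \<in> borel_measurable lborel"
    unfolding W2_def[abs_def] using near_m borel_measurable_integrable[OF \<phi>0_int] by measurable
  have W2fin: "(\<integral>\<^sup>+z. W2 z \<partial>lborel) < \<infinity>"
  proof -
    have "(\<integral>\<^sup>+z. W2 z \<partial>lborel) = ennreal c0 * (\<integral>\<^sup>+z. ennreal \<bar>nonlocal_integrand q s u \<phi>0 z\<bar> \<partial>lborel) + ennreal CD * (\<integral>\<^sup>+z. near z \<partial>lborel)"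
      unfolding W2_def using near_m borel_measurable_integrable[OF \<phi>0_int] by (simp add: nn_integral_add nn_integral_cmult)
    moreover have "(\<integral>\<^sup>+z. near z \<partial>lborel) < \<infinity>"
      unfolding near_def B2_def Li_def by (rule line_integral_kernel_finite[OF _ M'fin b]) measurable
    moreover have "(\<integral>\<^sup>+z. ennreal \<bar>nonlocal_integrand q s u \<phi>0 z\<bar> \<partial>lborel) < \<infinity>"
      using \<phi>0_int by (simp add: integrable_iff_bounded)
    ultimately show ?thesis by (simp add: ennreal_mult_less_top ennreal_add_less_top)
  qed
  have T_lim: "AE z in lborel. (\<lambda>n. T n z) \<longlonglongrightarrow> T' z"
    using AE_lborel_prod[OF \<phi>_lim]
  proof eventually_elim
    fix z :: "'a \<times> 'a"
    assume "(\<lambda>n. \<phi> n (fst z)) \<longlonglongrightarrow> \<psi> (fst z) \<and> (\<lambda>n. \<phi> n (snd z)) \<longlonglongrightarrow> \<psi> (snd z)"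
    then show "(\<lambda>n. T n z) \<longlonglongrightarrow> T' z"
      unfolding T_def T'_def nonlocal_integrand_def case_prod_beta divide_inverse by (intro tendsto_intros) auto
  qed
  have T'm: "T' \<in> borel_measurable lborel"
    unfolding T'_def nonlocal_integrand_def bracket_pow_def lborel_prod[symmetric] by measurable
  have Tm: "T n \<in> borel_measurable lborel" for n
    using WI[of n] unfolding T_def by (blast intro: borel_measurable_integrable)
  note nonlocal_limit = dominated_convergence_ennreal[OF Tm T'm T_lim T_dom W2m W2fin]
  define A where "A x = \<eta> x powr (real Q / q)" for x
  have A: "A x \<ge> 0" "A x powr q = \<eta> x ^ Q" for x
    using q Q2 \<eta>[of x] by (auto simp: A_def powr_powr powr_realpow' zero_power)
  have T'_le: "T' (x, y) \<le> \<bar>A x - A y\<bar> powr q * norm (x - y) powr (- c)" for x y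
  proof -
    have "bracket_pow ((u x + \<kappa>) - (u y + \<kappa>)) (q - 1) * (A x powr q * (u x + \<kappa>) powr (1 - q) - A y powr q * (u y + \<kappa>) powr (1 - q)) 
       \<le> \<bar>A x - A y\<bar> powr q"
      using q A(1) u(2)[of x] u(2)[of y] \<kappa> by (intro discrete_Picone) auto
    then have "bracket_pow (u x - u y) (q - 1) * (\<psi> x - \<psi> y) \<le> \<bar>A x - A y\<bar> powr q"
      by (simp add: A(2) \<psi>_def)
    then have "bracket_pow (u x - u y) (q - 1) * (\<psi> x - \<psi> y) * norm (x - y) powr (- c) \<le> \<bar>A x - A y\<bar> powr q * norm (x - y) powr (- c)"
      by (rule mult_right_mono) simp
    then show ?thesis
      by (simp add: T'_def nonlocal_integrand_def c_def[symmetric] powr_minus divide_inverse)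
  qed
  have nonlocal_bound: "ennreal (\<integral>z. T' z \<partial>lborel) 
      \<le> ennreal (r powr (real DIM('a) - s * q)) * bump_energy TYPE('a) q (real DIM('a) + s * q) (real Q / q)"
  proof -
    have [measurable]: "A \<in> borel_measurable borel" unfolding A_def[abs_def] by measurable
    have "ennreal (\<integral>z. T' z \<partial>lborel) \<le> (\<integral>\<^sup>+(x, y). ennreal (\<bar>A x - A y\<bar> powr q * norm (x - y) powr (- c)) \<partial>lborel)"
      by (rule ennreal_integral_le_nn_integral[OF nonlocal_limit(1)]) (auto intro!: AE_I2 ennreal_leI T'_le)
    also have "\<dots> = (\<integral>\<^sup>+x. \<integral>\<^sup>+y. ennreal (\<bar>A x - A y\<bar> powr q * norm (x - y) powr (- c)) \<partial>lborel \<partial>lborel)"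
      by (subst lborel_prod[symmetric], subst lborel.nn_integral_fst[symmetric]) (auto simp: case_prod_beta)
    also have "\<dots> = ennreal (r powr (2 * real DIM('a) - c)) * bump_energy TYPE('a) q c (real Q / q)"
      unfolding A_def \<eta>_def by (rule bump_energy_scaled[OF r])
    also have "2 * real DIM('a) - c = real DIM('a) - s * q" by (simp add: c_def)
    finally show ?thesis by (simp only: c_def)
  qed

  \<comment> \<open>Fatou's lemma suffices for the singular term, which is nonnegative and has to be bounded from above only.\<close>
  have "(\<integral>\<^sup>+x. ennreal (Fl x * \<psi> x) \<partial>lborel) \<le> (\<integral>\<^sup>+x. liminf (\<lambda>n. ennreal (Fl x * \<phi> n x)) \<partial>lborel)"
  proof (rule nn_integral_mono_AE, use \<phi>_lim in eventually_elim)
    fix x assume "(\<lambda>n. \<phi> n x) \<longlonglongrightarrow> \<psi> x"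
    then have "(\<lambda>n. ennreal (Fl x * \<phi> n x)) \<longlonglongrightarrow> ennreal (Fl x * \<psi> x)" by (intro tendsto_ennrealI tendsto_intros)
    then show "ennreal (Fl x * \<psi> x) \<le> liminf (\<lambda>n. ennreal (Fl x * \<phi> n x))"
      using lim_imp_Liminf by (metis order_refl sequentially_bot)
  qed
  also have "\<dots> \<le> liminf (\<lambda>n. \<integral>\<^sup>+x. ennreal (Fl x * \<phi> n x) \<partial>lborel)"
  proof (rule nn_integral_liminf)
    fix n
    have "(\<lambda>x. Fl x * \<phi> n x) \<in> borel_measurable lborel"
      using WI[of n] by (blast intro: borel_measurable_integrable)
    then show "(\<lambda>x. ennreal (Fl x * \<phi> n x)) \<in> borel_measurable lborel" by measurable
  qed
  also have "\<dots> \<le> liminf (\<lambda>n. ennreal ((\<integral>x. P n x \<partial>lborel) + (\<integral>z. T n z \<partial>lborel)))"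
  proof (intro Liminf_mono always_eventually allI)
    fix n
    have "(\<integral>\<^sup>+x. ennreal (Fl x * \<phi> n x) \<partial>lborel) = ennreal (\<integral>x. Fl x * \<phi> n x \<partial>lborel)"
      using WI[of n] Fl(2) by (intro nn_integral_eq_integral) auto
    also have "\<dots> \<le> ennreal ((\<integral>x. P n x \<partial>lborel) + (\<integral>z. T n z \<partial>lborel))"
      using WI[of n] by (intro ennreal_leI) (simp add: P_def T_def)
    finally show "(\<integral>\<^sup>+x. ennreal (Fl x * \<phi> n x) \<partial>lborel) \<le> ennreal ((\<integral>x. P n x \<partial>lborel) + (\<integral>z. T n z \<partial>lborel))" .
  qed
  also have "\<dots> = ennreal ((\<integral>x. P' x \<partial>lborel) + (\<integral>z. T' z \<partial>lborel))"
    by (intro lim_imp_Liminf tendsto_ennrealI tendsto_add local_limit(2) nonlocal_limit(2)) simp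
  also have "\<dots> \<le> ennreal (\<integral>x. P' x \<partial>lborel) + ennreal (\<integral>z. T' z \<partial>lborel)"
    by (rule ennreal_add_le)
  also have "\<dots> \<le> ennreal (real Q powr p / (q - 1) powr (p - 1) * (L / r) powr p) * 
         (\<integral>\<^sup>+x. indicator (ball y0 r) x * ennreal ((u x + \<kappa>) powr (p - q)) \<partial>lborel)
       + ennreal (r powr (real DIM('a) - s * q)) * bump_energy TYPE('a) q (real DIM('a) + s * q) (real Q / q)"
    by (intro add_mono local_bound nonlocal_bound)
  finally show ?thesis by (simp add: \<psi>_def \<eta>_def)
qed

section \<open>A boundary layer\<close>

lemma C1_locally_Lipschitz:
  fixes \<gamma> :: "'a::euclidean_space \<Rightarrow> real"
  assumes "C_k 1 \<gamma>"
  obtains M where "M \<ge> 0" "\<And>x y. x \<in> cball z R \<Longrightarrow> y \<in> cball z R \<Longrightarrow> \<bar>\<gamma> x - \<gamma> y\<bar> \<le> M * norm (x - y)"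
proof -
  obtain \<gamma>' where d: "\<And>x. (\<gamma> has_derivative \<gamma>' x) (at x)" and c: "\<And>v. continuous_on UNIV (\<lambda>x. \<gamma>' x v)"
    using assms by auto
  have "\<exists>B. \<forall>x\<in>cball z R. \<bar>\<gamma>' x b\<bar> \<le> B" for b
  proof -
    have "bounded ((\<lambda>x. \<gamma>' x b) ` cball z R)"
      using c[of b] by (intro compact_imp_bounded compact_continuous_image) (auto intro: continuous_on_subset)
    then show ?thesis by (auto simp: bounded_iff)
  qed
  then obtain B where B: "\<And>b x. x \<in> cball z R \<Longrightarrow> \<bar>\<gamma>' x b\<bar> \<le> B b" by metis
  define M where "M = (\<Sum>b\<in>Basis. \<bar>B b\<bar>)"
  have M: "M \<ge> 0" by (simp add: M_def sum_nonneg)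
  have "norm (\<gamma> x - \<gamma> y) \<le> M * norm (x - y)" if "x \<in> cball z R" "y \<in> cball z R" for x y
  proof (rule differentiable_bound[OF convex_cball _ _ that])
    fix x assume x: "x \<in> cball z R"
    show "(\<gamma> has_derivative \<gamma>' x) (at x within cball z R)" using d by (rule has_derivative_at_withinI)
    show "onorm (\<gamma>' x) \<le> M"
    proof (rule onorm_bound[OF M])
      fix v
      have lin: "linear (\<gamma>' x)" using d[of x] by (rule has_derivative_linear)
      have "\<gamma>' x v = \<gamma>' x (\<Sum>b\<in>Basis. (v \<bullet> b) *\<^sub>R b)" by (simp add: euclidean_representation)
      also have "\<dots> = (\<Sum>b\<in>Basis. (v \<bullet> b) * \<gamma>' x b)" using lin by (simp add: linear_sum linear_scale)
      also have "norm \<dots> \<le> (\<Sum>b\<in>Basis. norm v * \<bar>B b\<bar>)"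
      proof (rule sum_norm_le)
        fix b :: 'a assume "b \<in> Basis"
        then show "norm ((v \<bullet> b) * \<gamma>' x b) \<le> norm v * \<bar>B b\<bar>"
          using B[OF x, of b] Basis_le_norm[of b v] by (auto simp: abs_mult intro!: mult_mono)
      qed
      also have "\<dots> = M * norm v" by (simp add: M_def sum_distrib_left mult.commute)
      finally show "norm (\<gamma>' x v) \<le> M * norm v" .
    qed
  qed
  then show ?thesis using that M by auto
qed

text \<open>
  At height about \<open>5 L r\<close> over the boundary graph there is a layer of centres, of measure at least
  \<open>c r\<close>, whose balls of radius \<open>4 r\<close> stay inside the domain, are at distance at most \<open>10 L r\<close> from the boundary,
  and leave the domain after the shift by \<open>8 L r\<close> across the boundary. The measure bound holds since a fixed
  ball is covered by about \<open>1/r\<close> slabs of height \<open>L r\<close>, each of which can be translated into the layer.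
\<close>

lemma boundary_layer:
  fixes \<Omega> :: "'a::euclidean_space set"
  assumes \<Omega>: "open \<Omega>" "\<Omega> \<noteq> {}" "bounded \<Omega>" "C2_boundary \<Omega>"
  obtains x0 e :: 'a and r0 \<rho> L c :: real where "norm e = 1" "r0 > 0" "\<rho> > 0" "L \<ge> 1" "c > 0"
    "\<And>r. 0 < r \<Longrightarrow> r < \<rho> \<Longrightarrow> \<exists>S\<in>sets borel. ennreal (c * r) \<le> emeasure lborel S \<and>
       (\<forall>y\<in>S. cball y (4 * r) \<subseteq> \<Omega> \<inter> ball x0 r0 \<and> (\<forall>x\<in>ball y (4 * r). boundary_dist \<Omega> x \<le> 10 * L * r) \<and>
          (\<forall>x\<in>ball y r. x - (8 * L * r) *\<^sub>R e \<in> ball x0 r0 - \<Omega>))"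
proof -
  have "\<Omega> \<noteq> UNIV" using \<Omega>(3) not_bounded_UNIV by blast
  then have "frontier \<Omega> \<noteq> {}" using \<Omega>(2) by (simp add: frontier_eq_empty)
  then obtain x0 where x0: "x0 \<in> frontier \<Omega>" by blast
  then obtain r0 e \<gamma> where r0: "r0 > 0" and e: "norm e = 1" and \<gamma>: "C_k 2 \<gamma>"
    and graph: "\<Omega> \<inter> ball x0 r0 = {x \<in> ball x0 r0. x \<bullet> e > \<gamma> (x - (x \<bullet> e) *\<^sub>R e)}"
    using \<Omega>(4) unfolding C2_boundary_def by blast
  define \<pi> where "\<pi> x = x - (x \<bullet> e) *\<^sub>R e" for x
  define h where "h x = x \<bullet> e - \<gamma> (\<pi> x)" for x
  have ee: "e \<bullet> e = 1" using e by (simp add: norm_eq_1)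
  have in_\<Omega>: "x \<in> \<Omega> \<longleftrightarrow> h x > 0" if "x \<in> ball x0 r0" for x
  proof -
    have "x \<in> \<Omega> \<longleftrightarrow> x \<in> \<Omega> \<inter> ball x0 r0" using that by blast
    also have "\<dots> \<longleftrightarrow> h x > 0" unfolding graph using that by (simp add: h_def \<pi>_def)
    finally show ?thesis .
  qed
  have h_shift: "h (x + t *\<^sub>R e) = h x + t" for x t
  proof -
    have "\<pi> (x + t *\<^sub>R e) = \<pi> x" by (simp add: \<pi>_def inner_add_left ee algebra_simps)
    then show ?thesis by (simp add: h_def inner_add_left ee)
  qed
  have "C_k 1 \<gamma>" using \<gamma> C_k_mono_Suc[of 1 \<gamma>] by (simp add: numeral_2_eq_2)
  then obtain M where M: "M \<ge> 0" 
    "\<And>x y. x \<in> cball (\<pi> x0) (2 * r0) \<Longrightarrow> y \<in> cball (\<pi> x0) (2 * r0) \<Longrightarrow> \<bar>\<gamma> x - \<gamma> y\<bar> \<le> M * norm (x - y)"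
    using C1_locally_Lipschitz[of \<gamma>] by metis
  define L where "L = 1 + 2 * M"
  have L: "L \<ge> 1" using M by (simp add: L_def)
  have \<pi>_Lip: "norm (\<pi> x - \<pi> y) \<le> 2 * norm (x - y)" for x y
  proof -
    have "\<pi> x - \<pi> y = (x - y) - ((x - y) \<bullet> e) *\<^sub>R e" by (simp add: \<pi>_def algebra_simps)
    also have "norm \<dots> \<le> norm (x - y) + norm (((x - y) \<bullet> e) *\<^sub>R e)" by (rule norm_triangle_ineq4)
    also have "norm (((x - y) \<bullet> e) *\<^sub>R e) \<le> norm (x - y)" using Cauchy_Schwarz_ineq2[of "x - y" e] e by simp
    finally show ?thesis by simp
  qed
  have h_Lip: "\<bar>h x - h y\<bar> \<le> L * norm (x - y)" if "x \<in> ball x0 r0" "y \<in> ball x0 r0" for x y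
  proof -
    have "\<pi> z \<in> cball (\<pi> x0) (2 * r0)" if "z \<in> ball x0 r0" for z
      using \<pi>_Lip[of x0 z] that by (auto simp: dist_norm)
    then have "\<bar>\<gamma> (\<pi> x) - \<gamma> (\<pi> y)\<bar> \<le> M * norm (\<pi> x - \<pi> y)" using that by (intro M(2)) auto
    also have "\<dots> \<le> M * (2 * norm (x - y))" using \<pi>_Lip M(1) by (intro mult_left_mono) auto
    finally have "\<bar>\<gamma> (\<pi> x) - \<gamma> (\<pi> y)\<bar> \<le> 2 * M * norm (x - y)" by simp
    moreover have "\<bar>x \<bullet> e - y \<bullet> e\<bar> \<le> norm (x - y)"
      using Cauchy_Schwarz_ineq2[of "x - y" e] e by (simp add: inner_diff_left)
    ultimately show ?thesis by (simp add: h_def L_def distrib_right)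
  qed
  have h_cont: "continuous_on UNIV h"
    unfolding h_def[abs_def] \<pi>_def
    by (intro continuous_intros continuous_on_compose2[OF C_k_imp_continuous[OF \<gamma>, of UNIV]]) auto
  then have [measurable]: "h \<in> borel_measurable borel" by (rule borel_measurable_continuous_onI)
  have x0b: "x0 \<in> ball x0 r0" using r0 by simp
  have graph_frontier: "z \<in> frontier \<Omega>" if z: "z \<in> ball x0 r0" "h z = 0" for z
  proof -
    have "z \<notin> \<Omega>" using in_\<Omega>[OF z(1)] z(2) by simp
    moreover have "z \<in> closure \<Omega>"
      unfolding closure_approachable
    proof (intro allI impI)
      fix \<epsilon> :: real assume "\<epsilon> > 0"
      define t where "t = min (\<epsilon> / 2) ((r0 - dist x0 z) / 2)"
      have t: "t > 0" "t < \<epsilon>" "t < r0 - dist x0 z" using \<open>\<epsilon> > 0\<close> z(1) by (auto simp: t_def min_def)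
      have "dist (z + t *\<^sub>R e) z = t" using t by (simp add: dist_norm e)
      moreover have "z + t *\<^sub>R e \<in> ball x0 r0"
        using dist_triangle[of x0 "z + t *\<^sub>R e" z] calculation t by (simp add: dist_commute)
      then have "z + t *\<^sub>R e \<in> \<Omega>" using in_\<Omega> h_shift[of z t] z(2) t by simp
      ultimately show "\<exists>y\<in>\<Omega>. dist y z < \<epsilon>" using t by (intro bexI[of _ "z + t *\<^sub>R e"]) auto
    qed
    ultimately show ?thesis using \<Omega>(1) by (simp add: frontier_def interior_open)
  qed
  have hx0: "h x0 = 0"
  proof -
    have "x0 \<notin> \<Omega>" "x0 \<in> closure \<Omega>" using x0 \<Omega>(1) by (auto simp: frontier_def interior_open)
    then have le: "h x0 \<le> 0" using in_\<Omega>[OF x0b] by simp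
    have "\<not> h x0 < 0"
    proof
      assume neg: "h x0 < 0"
      define \<epsilon> where "\<epsilon> = min r0 (- h x0 / L)"
      have \<epsilon>: "\<epsilon> > 0" "\<epsilon> \<le> r0" "L * \<epsilon> \<le> - h x0" 
      proof -
        have "h x0 / L < 0" using neg L by (intro divide_neg_pos) auto
        then show "\<epsilon> > 0" "\<epsilon> \<le> r0" using r0 by (auto simp: \<epsilon>_def)
        have "L * \<epsilon> \<le> L * (- h x0 / L)" using L by (intro mult_left_mono) (auto simp: \<epsilon>_def)
        then show "L * \<epsilon> \<le> - h x0" using L by simp
      qed
      obtain y where y: "y \<in> \<Omega>" "dist y x0 < \<epsilon>"
        using \<open>x0 \<in> closure \<Omega>\<close> \<epsilon>(1) by (auto simp: closure_approachable)
      then have yb: "y \<in> ball x0 r0" using \<epsilon> by (simp add: dist_commute)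
      have "L * norm (y - x0) < L * \<epsilon>" using y L by (intro mult_strict_left_mono) (auto simp: dist_norm)
      then have "h y < 0" using h_Lip[OF yb x0b] \<epsilon>(3) by linarith
      then show False using in_\<Omega>[OF yb] y(1) by simp
    qed
    with le show ?thesis by simp
  qed
  define \<rho> where "\<rho> = r0 / (4 * (1 + L))"
  define \<rho>' where "\<rho>' = min \<rho> (r0 / (28 * L))"
  have \<rho>: "\<rho> > 0" "\<rho> * (1 + L) = r0 / 4" using r0 L by (auto simp: \<rho>_def field_simps)
  have \<rho>': "\<rho>' > 0" using \<rho> r0 L by (simp add: \<rho>'_def)
  define m where "m = measure lborel (ball x0 \<rho>)"
  have m: "m > 0" using \<rho>(1) by (simp add: m_def)
  show ?thesis
  proof (rule that[of e r0 \<rho>' L "m / (7 * \<rho>)" x0, OF e r0 \<rho>' L])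
    show "m / (7 * \<rho>) > 0" using m \<rho> by simp
    fix r assume r: "0 < r" "r < \<rho>'"
    have r1: "r < \<rho>" "28 * (L * r) < r0" using r L by (auto simp: \<rho>'_def field_simps)
    have Lr: "r \<le> L * r" "0 < L * r" using L r by auto
    define S where "S = {x \<in> ball x0 (r0 / 2). 5 * (L * r) < h x \<and> h x \<le> 6 * (L * r)}"
    have S[measurable]: "S \<in> sets borel" unfolding S_def by measurable
    have Sm: "ennreal (m / (7 * \<rho>) * r) \<le> emeasure lborel S"
    proof -
      define J where "J = \<lceil>\<rho> / r\<rceil> + 1"
      define T where "T j = {x \<in> ball x0 \<rho>. of_int j * (L * r) < h x \<and> h x \<le> (of_int j + 1) * (L * r)}" for j :: int
      have [measurable]: "T j \<in> sets borel" for j unfolding T_def by measurable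
      have J: "real_of_int J < \<rho> / r + 2" "\<rho> / r + 1 \<le> real_of_int J" 
        unfolding J_def by linarith+
      have cover: "ball x0 \<rho> \<subseteq> (\<Union>j\<in>{-J..J}. T j)"
      proof
        fix x assume x: "x \<in> ball x0 \<rho>"
        have "\<rho> \<le> \<rho> * (1 + L)" using \<rho> L by simp
        then have xb: "x \<in> ball x0 r0" using x \<rho>(2) r0 by auto
        have "L * norm (x - x0) \<le> L * \<rho>" using x L by (intro mult_left_mono) (auto simp: dist_norm norm_minus_commute)
        then have hx: "\<bar>h x\<bar> \<le> L * \<rho>" using h_Lip[OF xb x0b] hx0 by simp
        define t where "t = h x / (L * r)"
        have t: "\<bar>t\<bar> \<le> \<rho> / r" 
        proof -
          have "\<bar>h x\<bar> / (L * r) \<le> (L * \<rho>) / (L * r)" using hx Lr by (intro divide_right_mono) auto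
          then show ?thesis using L Lr by (simp add: t_def abs_divide)
        qed
        define j where "j = \<lceil>t\<rceil> - 1"
        have j: "of_int j < t" "t \<le> of_int j + 1" by (simp_all add: j_def) linarith+
        have "of_int j * (L * r) < t * (L * r)" "t * (L * r) \<le> (of_int j + 1) * (L * r)"
          using j Lr by (auto intro: mult_strict_right_mono mult_right_mono)
        moreover have "t * (L * r) = h x" using Lr(2) unfolding t_def by (intro nonzero_eq_divide_eq[THEN iffD1]) auto
        ultimately have "x \<in> T j" using x by (simp add: T_def)
        moreover have "j \<in> {-J..J}" using j t J(2) by auto
        ultimately show "x \<in> (\<Union>j\<in>{-J..J}. T j)" by blast
      qed
      have Tj: "emeasure lborel (T j) \<le> emeasure lborel S" if j: "j \<in> {-J..J}" for j
      proof -
        define a where "a = (5 - of_int j) * (L * r)"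
        have abs_a: "\<bar>a\<bar> \<le> 7 * (L * r) + L * \<rho>"
        proof -
          have "\<bar>5 - real_of_int j\<bar> \<le> 7 + \<rho> / r" using j J(1) by auto
          moreover have "\<bar>a\<bar> = \<bar>5 - real_of_int j\<bar> * (L * r)"
            unfolding a_def by (subst abs_mult) (simp only: abs_of_pos[OF Lr(2)])
          ultimately have "\<bar>a\<bar> \<le> (7 + \<rho> / r) * (L * r)" 
            using Lr(2) by (simp only:) (intro mult_right_mono, simp_all)
          also have "\<dots> = 7 * (L * r) + L * \<rho>" using r by (simp add: field_simps)
          finally show ?thesis .
        qed
        have sub: "x \<in> S" if "x - a *\<^sub>R e \<in> T j" for x
        proof -
          define y where "y = x - a *\<^sub>R e"
          have y: "y \<in> ball x0 \<rho>" "of_int j * (L * r) < h y" "h y \<le> (of_int j + 1) * (L * r)"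
            using that by (auto simp: T_def y_def)
          have "h x = h y + a" using h_shift[of y a] by (simp add: y_def)
          then have "5 * (L * r) < h x" "h x \<le> 6 * (L * r)" using y by (auto simp: a_def algebra_simps)
          moreover have "dist x0 x < r0 / 2"
          proof -
            have "dist x0 x \<le> dist x0 y + dist y x" by (rule dist_triangle)
            also have "dist y x = \<bar>a\<bar>" by (simp add: y_def dist_norm e)
            finally have "dist x0 x < \<rho> + (7 * (L * r) + L * \<rho>)" using y(1) abs_a by auto
            also have "\<dots> = \<rho> * (1 + L) + 7 * (L * r)" by (simp add: algebra_simps)
            also have "\<dots> < r0 / 2" using \<rho>(2) r1(2) by simp
            finally show ?thesis .
          qed
          ultimately show ?thesis by (simp add: S_def)
        qed
        have "emeasure lborel (T j) = (\<integral>\<^sup>+x. indicator (T j) x \<partial>lborel)" by simp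
        also have "\<dots> = (\<integral>\<^sup>+x. indicator (T j) (x + - (a *\<^sub>R e)) \<partial>lborel)"
          by (rule nn_integral_translate[symmetric]) simp
        also have "\<dots> \<le> (\<integral>\<^sup>+x. indicator S x \<partial>lborel)"
          using sub by (intro nn_integral_mono) (auto simp: indicator_def)
        finally show ?thesis by simp
      qed
      have Sfin: "emeasure lborel S < \<infinity>"
      proof -
        have "S \<subseteq> ball x0 (r0 / 2)" by (auto simp: S_def)
        then have "emeasure lborel S \<le> emeasure lborel (ball x0 (r0 / 2))" by (intro emeasure_mono) auto
        then show ?thesis using emeasure_lborel_ball_finite[of x0 "r0 / 2"] by (rule le_less_trans)
      qed
      have Seq: "emeasure lborel S = ennreal (measure lborel S)"
        using Sfin by (intro emeasure_eq_ennreal_measure) auto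
      have beq: "emeasure lborel (ball x0 \<rho>) = ennreal m"
        unfolding m_def using emeasure_lborel_ball_finite[of x0 \<rho>] by (intro emeasure_eq_ennreal_measure) auto
      have "emeasure lborel (ball x0 \<rho>) \<le> emeasure lborel (\<Union>j\<in>{-J..J}. T j)"
        using cover by (intro emeasure_mono) auto
      also have "\<dots> \<le> (\<Sum>j\<in>{-J..J}. emeasure lborel (T j))"
        by (intro emeasure_subadditive_finite) auto
      also have "\<dots> \<le> (\<Sum>j\<in>{-J..J}. emeasure lborel S)" by (intro sum_mono Tj)
      also have "\<dots> = ennreal (real (card {-J..J}) * measure lborel S)"
        by (simp add: Seq ennreal_mult' ennreal_of_nat_eq_real_of_nat)
      finally have "m \<le> real (card {-J..J}) * measure lborel S"
        unfolding beq by (subst (asm) ennreal_le_iff) auto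
      also have "\<dots> \<le> (7 * \<rho> / r) * measure lborel S"
      proof (intro mult_right_mono)
        have J0: "J \<ge> 0" using J(2) \<rho> r by (metis add_nonneg_nonneg divide_nonneg_nonneg less_eq_real_def of_int_0_le_iff order_trans zero_le_one)
        have "real (card {-J..J}) = 2 * real_of_int J + 1" using J0 by simp
        also have "\<dots> \<le> 2 * (\<rho> / r) + 5" using J(1) by simp
        also have "\<dots> \<le> 7 * \<rho> / r" using r1(1) r by (simp add: field_simps)
        finally show "real (card {-J..J}) \<le> 7 * \<rho> / r" .
      qed simp
      finally have "m / (7 * \<rho>) * r \<le> measure lborel S" using \<rho> r by (simp add: field_simps)
      then show ?thesis unfolding Seq by (rule ennreal_leI)
    qed
    have inner: "cball y (4 * r) \<subseteq> \<Omega> \<inter> ball x0 r0 \<and> (\<forall>x\<in>ball y (4 * r). boundary_dist \<Omega> x \<le> 10 * L * r) \<and>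
          (\<forall>x\<in>ball y r. x - (8 * L * r) *\<^sub>R e \<in> ball x0 r0 - \<Omega>)" if y: "y \<in> S" for y
    proof -
      have yd: "dist x0 y < r0 / 2" and hy: "5 * (L * r) < h y" "h y \<le> 6 * (L * r)" using y by (auto simp: S_def)
      have yb: "y \<in> ball x0 r0" using yd r0 by simp
      have *: "x \<in> ball x0 r0 \<and> dist x0 x < r0 / 2 + t \<and> \<bar>h x - h y\<bar> \<le> L * t" if "dist y x \<le> t" "t \<le> 4 * r" for x t
      proof -
        have d: "dist x0 x < r0 / 2 + t" using dist_triangle[of x0 x y] yd that by simp
        then have xb: "x \<in> ball x0 r0" using that Lr r1(2) by simp
        have "L * norm (x - y) \<le> L * t" using that L by (intro mult_left_mono) (auto simp: dist_norm norm_minus_commute)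
        with d xb h_Lip[OF xb yb] show ?thesis by simp
      qed
      show ?thesis
      proof (intro conjI ballI subsetI)
        fix x assume x: "x \<in> cball y (4 * r)"
        then have "x \<in> ball x0 r0" "\<bar>h x - h y\<bar> \<le> L * (4 * r)" using *[of x "4 * r"] by auto
        then show "x \<in> \<Omega> \<inter> ball x0 r0" using in_\<Omega>[of x] hy Lr by auto
      next
        fix x assume x: "x \<in> ball y (4 * r)"
        then have x': "x \<in> ball x0 r0" "dist x0 x < r0 / 2 + 4 * r" "\<bar>h x - h y\<bar> \<le> L * (4 * r)" using *[of x "4 * r"] by auto
        have hx: "0 < h x" "h x \<le> 10 * (L * r)" using x'(3) hy Lr by auto
        define z where "z = x + (- h x) *\<^sub>R e"
        have dz: "dist x z = h x" using hx by (simp add: z_def dist_norm e)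
        have "z \<in> ball x0 r0" using dist_triangle[of x0 z x] dz x'(2) hx Lr r1(2) by simp
        moreover have "h z = 0" unfolding z_def h_shift by simp
        ultimately have "z \<in> frontier \<Omega>" by (rule graph_frontier)
        then have "boundary_dist \<Omega> x \<le> dist x z" unfolding boundary_dist_def by (rule infdist_le)
        then show "boundary_dist \<Omega> x \<le> 10 * L * r" using dz hx by (simp add: mult.assoc)
      next
        fix x assume x: "x \<in> ball y r"
        then have x': "dist x0 x < r0 / 2 + r" "\<bar>h x - h y\<bar> \<le> L * r" using *[of x r] r by auto
        define z where "z = x + (- (8 * (L * r))) *\<^sub>R e"
        have dz: "dist x z = 8 * (L * r)" using Lr(2) by (simp add: z_def dist_norm e abs_mult[symmetric] del: abs_mult)
        have zb: "z \<in> ball x0 r0" using dist_triangle[of x0 z x] dz x'(1) Lr r1(2) by simp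
        have "h z = h x - 8 * (L * r)" unfolding z_def h_shift by simp
        then have "z \<notin> \<Omega>" using in_\<Omega>[OF zb] x'(2) hy Lr by auto
        with zb show "x - (8 * L * r) *\<^sub>R e \<in> ball x0 r0 - \<Omega>" by (simp add: z_def mult.assoc)
      qed
    qed
    show "\<exists>S\<in>sets borel. ennreal (m / (7 * \<rho>) * r) \<le> emeasure lborel S \<and>
       (\<forall>y\<in>S. cball y (4 * r) \<subseteq> \<Omega> \<inter> ball x0 r0 \<and> (\<forall>x\<in>ball y (4 * r). boundary_dist \<Omega> x \<le> 10 * L * r) \<and>
          (\<forall>x\<in>ball y r. x - (8 * L * r) *\<^sub>R e \<in> ball x0 r0 - \<Omega>))"
      using S Sm inner by blast
  qed
qed

section \<open>Sobolev functions near the boundary\<close>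

lemma grad_eq_0_outside_closure:
  assumes "x \<notin> closure {x. \<phi> x \<noteq> 0}" shows "grad \<phi> x = 0"
proof (rule grad_eqI)
  have "((\<lambda>x. 0) has_derivative (\<lambda>v. 0)) (at x)" by simp
  then have "(\<phi> has_derivative (\<lambda>v. 0)) (at x)"
  proof (rule has_derivative_transform_within_open)
    show "open (- closure {x. \<phi> x \<noteq> 0})" by auto
    show "0 = \<phi> y" if "y \<in> - closure {x. \<phi> x \<noteq> 0}" for y 
      using that closure_subset[of "{x. \<phi> x \<noteq> 0}"] by force
  qed (use assms in auto)
  then show "(\<phi> has_derivative (\<lambda>v. 0 \<bullet> v)) (at x)" by simp
qed

lemma test_functions_outside:
  assumes "\<phi> \<in> test_functions V" "x \<notin> V"
  shows "\<phi> x = 0" "grad \<phi> x = 0"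
proof -
  have "x \<notin> closure {x. \<phi> x \<noteq> 0}" using assms by (auto simp: test_functions_def compactly_contained_def)
  then show "grad \<phi> x = 0" by (rule grad_eq_0_outside_closure)
  show "\<phi> x = 0" using \<open>x \<notin> closure _\<close> closure_subset[of "{x. \<phi> x \<noteq> 0}"] by blast
qed

lemma test_functions_mono: "V \<subseteq> U \<Longrightarrow> test_functions V \<subseteq> test_functions U"
  by (auto simp: test_functions_def compactly_contained_def)

lemma integral_lebesgue_on_subset:
  fixes h :: "'a::euclidean_space \<Rightarrow> 'b::euclidean_space"
  assumes "V \<subseteq> U" "V \<in> sets lebesgue" "U \<in> sets lebesgue" "\<And>x. x \<notin> V \<Longrightarrow> h x = 0"
  shows "(\<integral>x. h x \<partial>lebesgue_on V) = (\<integral>x. h x \<partial>lebesgue_on U)"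
proof -
  have "(\<lambda>x. indicator V x *\<^sub>R h x) = (\<lambda>x. indicator U x *\<^sub>R h x)"
    using assms(1,4) by (auto simp: indicator_def fun_eq_iff)
  then show ?thesis using assms by (simp add: integral_restrict_space)
qed

lemma in_Lp_subset:
  assumes "in_Lp p U h" "V \<subseteq> U" "V \<in> sets lebesgue" "U \<in> sets lebesgue"
  shows "in_Lp p V h"
proof -
  have "h \<in> borel_measurable (lebesgue_on V)"
    using assms by (auto simp: in_Lp_def intro: measurable_restrict_mono)
  moreover have "integrable (lebesgue_on V) (\<lambda>x. norm (h x) powr p)"
  proof -
    have "integrable lebesgue (\<lambda>x. indicator U x *\<^sub>R norm (h x) powr p)"
      using assms(1,4) by (simp add: in_Lp_def integrable_restrict_space)
    then have "integrable lebesgue (\<lambda>x. indicator V x *\<^sub>R (indicator U x *\<^sub>R norm (h x) powr p))"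
      by (rule integrable_mult_indicator[OF assms(3)])
    also have "(\<lambda>x. indicator V x *\<^sub>R (indicator U x *\<^sub>R norm (h x) powr p)) = (\<lambda>x. indicator V x *\<^sub>R norm (h x) powr p)"
      using assms(2) by (auto simp: indicator_def fun_eq_iff)
    finally show ?thesis using assms(3) by (simp add: integrable_restrict_space)
  qed
  ultimately show ?thesis by (simp add: in_Lp_def)
qed

lemma W1p_subset:
  assumes W: "W1p p U u G" and V: "V \<subseteq> U" "V \<in> sets lebesgue" "U \<in> sets lebesgue"
  shows "W1p p V u G"
proof -
  have wg: "has_weak_gradient U u G" using W by (simp add: W1p_def)
  have "has_weak_gradient V u G"
    unfolding has_weak_gradient_def
  proof (intro conjI ballI)
    show "locally_integrable V u" "locally_integrable V G"
      using wg V by (auto simp: has_weak_gradient_def locally_integrable_def)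
    fix \<phi> assume \<phi>: "\<phi> \<in> test_functions V"
    note out = test_functions_outside[OF \<phi>]
    have "(\<integral>x. u x *\<^sub>R grad \<phi> x \<partial>lebesgue_on V) = (\<integral>x. u x *\<^sub>R grad \<phi> x \<partial>lebesgue_on U)"
      by (rule integral_lebesgue_on_subset[OF V]) (simp add: out)
    also have "\<dots> = - (\<integral>x. \<phi> x *\<^sub>R G x \<partial>lebesgue_on U)"
      using wg \<phi> test_functions_mono[OF V(1)] by (auto simp: has_weak_gradient_def)
    also have "(\<integral>x. \<phi> x *\<^sub>R G x \<partial>lebesgue_on U) = (\<integral>x. \<phi> x *\<^sub>R G x \<partial>lebesgue_on V)"
      by (rule integral_lebesgue_on_subset[OF V, symmetric]) (simp add: out)
    finally show "(\<integral>x. u x *\<^sub>R grad \<phi> x \<partial>lebesgue_on V) = - (\<integral>x. \<phi> x *\<^sub>R G x \<partial>lebesgue_on V)" .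
  qed
  then show ?thesis using W in_Lp_subset[of p U u, OF _ V] in_Lp_subset[of p U G, OF _ V] by (simp add: W1p_def)
qed

text \<open>
  A one-sided Hardy inequality: a Sobolev function is of order \<open>|h|\<close> in the \<open>L\<^sup>p\<close> sense on sets that the shift
  by \<open>h\<close> moves to where it vanishes.
\<close>

lemma shift_to_zero_set_estimate:
  fixes v :: "'a::euclidean_space \<Rightarrow> real"
  assumes W: "W1p p (ball z (R + 1)) v H" and p: "p \<ge> 1" and R: "R > 0"
    and nonneg: "AE x in lborel. v x \<ge> 0" and zero: "AE x in lborel. x \<notin> \<Omega> \<longrightarrow> v x = 0"
  obtains K where "K \<ge> 0" "\<And>A h. A \<subseteq> ball z R \<Longrightarrow> (\<And>x. x \<in> A \<Longrightarrow> x - h \<in> ball z R - \<Omega>) \<Longrightarrow>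
     (\<integral>\<^sup>+x. indicator A x * ennreal (v x powr p) \<partial>lborel) \<le> ennreal (K * norm h powr p)"
proof -
  have nn: "AE x in lborel. x \<in> ball z (R + 1) \<longrightarrow> v x \<ge> 0" using nonneg by eventually_elim simp
  have RR: "R < R + 1" by simp
  obtain w :: "nat \<Rightarrow> 'a \<Rightarrow> real" and M where w: "\<And>n k. C_k k (w n)" "\<And>n x. w n x \<ge> 0"
    "AE x in lborel. x \<in> ball z R \<longrightarrow> (\<lambda>n. w n x) \<longlonglongrightarrow> v x"
    and M[measurable]: "M \<in> borel_measurable borel" and Mfin: "(\<integral>\<^sup>+x. M x \<partial>lborel) < \<infinity>"
    and wM: "\<And>n x. x \<in> ball z R \<Longrightarrow> ennreal (norm (grad (w n) x) powr p) \<le> M x"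
    by (rule W1p_smooth_approximation[OF W p R RR nn]) (rule that; (assumption | blast))
  define K where "K = enn2real (\<integral>\<^sup>+x. M x \<partial>lborel)"
  have K: "ennreal K = (\<integral>\<^sup>+x. M x \<partial>lborel)" "K \<ge> 0" using Mfin by (auto simp: K_def)
  show ?thesis
  proof (rule that[OF K(2)])
    fix A h assume A: "A \<subseteq> ball z R" and shift: "\<And>x. x \<in> A \<Longrightarrow> x - h \<in> ball z R - \<Omega>"
    define Li where "Li x = (\<integral>\<^sup>+t. indicator {0..1} t * M ((x - h) + t *\<^sub>R h) \<partial>lborel)" for x
    have lim2: "AE x in lborel. x + (-h) \<in> ball z R \<longrightarrow> (\<lambda>n. w n (x + (-h))) \<longlonglongrightarrow> v (x + (-h))"
      by (rule AE_translate[OF w(3)])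
    have zero2: "AE x in lborel. x + (-h) \<notin> \<Omega> \<longrightarrow> v (x + (-h)) = 0"
      by (rule AE_translate[OF zero])
    have "(\<integral>\<^sup>+x. indicator A x * ennreal (v x powr p) \<partial>lborel) \<le> (\<integral>\<^sup>+x. ennreal (norm h powr p) * Li x \<partial>lborel)"
    proof (rule nn_integral_mono_AE, use w(3) lim2 zero2 nonneg in eventually_elim)
      fix x 
      assume l1: "x \<in> ball z R \<longrightarrow> (\<lambda>n. w n x) \<longlonglongrightarrow> v x" 
        and l2: "x + (-h) \<in> ball z R \<longrightarrow> (\<lambda>n. w n (x + (-h))) \<longlonglongrightarrow> v (x + (-h))"
        and z2: "x + (-h) \<notin> \<Omega> \<longrightarrow> v (x + (-h)) = 0" and nn: "v x \<ge> 0"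
      show "indicator A x * ennreal (v x powr p) \<le> ennreal (norm h powr p) * Li x"
      proof (cases "x \<in> A")
        case True
        have xb: "x \<in> ball z R" "x - h \<in> ball z R" "x - h \<notin> \<Omega>" using A shift[OF True] True by auto
        have "(\<lambda>n. w n x - w n (x - h)) \<longlonglongrightarrow> v x - 0" using l1 l2 z2 xb by (intro tendsto_diff) auto
        then have "(\<lambda>n. ennreal (\<bar>w n x - w n (x - h)\<bar> powr p)) \<longlonglongrightarrow> ennreal (\<bar>v x - 0\<bar> powr p)"
          using p by (intro tendsto_ennrealI tendsto_powr' tendsto_rabs tendsto_const) auto
        then have "ennreal (\<bar>v x - 0\<bar> powr p) \<le> ennreal (norm h powr p) * Li x"
        proof (rule LIMSEQ_le_const2, intro exI allI impI)
          fix n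
          show "ennreal (\<bar>w n x - w n (x - h)\<bar> powr p) \<le> ennreal (norm h powr p) * Li x"
            using powr_diff_le_line_integral[OF w(1) convex_ball xb(1,2) p wM] by (simp add: Li_def)
        qed
        then show ?thesis using True nn by simp
      qed simp
    qed
    also have "\<dots> = ennreal (norm h powr p) * (\<integral>\<^sup>+x. Li x \<partial>lborel)"
      unfolding Li_def by (rule nn_integral_cmult) measurable
    also have "(\<integral>\<^sup>+x. Li x \<partial>lborel) = (\<integral>\<^sup>+t. \<integral>\<^sup>+x. indicator {0..1::real} t * M ((x - h) + t *\<^sub>R h) \<partial>lborel \<partial>lborel)"
      unfolding Li_def by (rule lborel_pair.Fubini') measurable
    also have "\<dots> = (\<integral>\<^sup>+t. indicator {0..1::real} t * (\<integral>\<^sup>+x. M x \<partial>lborel) \<partial>lborel)"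
    proof (rule nn_integral_cong)
      fix t :: real
      have "(\<integral>\<^sup>+x. M ((x - h) + t *\<^sub>R h) \<partial>lborel) = (\<integral>\<^sup>+x. M x \<partial>lborel)"
        using nn_integral_translate[OF M, of "t *\<^sub>R h - h"] by (simp add: algebra_simps)
      then show "(\<integral>\<^sup>+x. indicator {0..1} t * M ((x - h) + t *\<^sub>R h) \<partial>lborel) = indicator {0..1} t * (\<integral>\<^sup>+x. M x \<partial>lborel)"
        by (subst nn_integral_cmult) simp_all
    qed
    also have "\<dots> = (\<integral>\<^sup>+x. M x \<partial>lborel)"
      by (subst nn_integral_multc) auto
    also have "ennreal (norm h powr p) * (\<integral>\<^sup>+x. M x \<partial>lborel) = ennreal (K * norm h powr p)"
      using K by (simp add: ennreal_mult mult.commute)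
    finally show "(\<integral>\<^sup>+x. indicator A x * ennreal (v x powr p) \<partial>lborel) \<le> ennreal (K * norm h powr p)" .
  qed
qed

text \<open>Averaging over the layer of centres selects a ball on which the function is small.\<close>

lemma ball_with_small_norm:
  fixes \<Omega> :: "'a::euclidean_space set" and v v0 :: "'a \<Rightarrow> real"
  assumes \<Omega>: "open \<Omega>" "\<Omega> \<noteq> {}" "bounded \<Omega>" "C2_boundary \<Omega>"
    and W: "W1p p UNIV v0 H" and p: "p \<ge> 1" 
    and v[measurable]: "v \<in> borel_measurable borel" and v0: "AE x in lborel. v0 x = v x"
    and nonneg: "\<And>x. v x \<ge> 0" and zero: "AE x in lborel. x \<notin> \<Omega> \<longrightarrow> v x = 0"
  obtains \<rho> L K where "\<rho> > 0" "L \<ge> 1" "K \<ge> 0"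
    "\<And>r. 0 < r \<Longrightarrow> r < \<rho> \<Longrightarrow> \<exists>y. cball y (4 * r) \<subseteq> \<Omega> \<and> (\<forall>x\<in>ball y (4 * r). boundary_dist \<Omega> x \<le> 10 * L * r) \<and>
      (\<integral>\<^sup>+x. indicator (ball y r) x * ennreal (v x powr p) \<partial>lborel) \<le> ennreal (K * r powr (real DIM('a) + p - 1))"
proof -
  obtain x0 e :: 'a and r0 \<rho> L c where layer: "norm e = 1" "r0 > 0" "\<rho> > 0" "L \<ge> 1" "c > 0"
    "\<And>r. 0 < r \<Longrightarrow> r < \<rho> \<Longrightarrow> \<exists>S\<in>sets borel. ennreal (c * r) \<le> emeasure lborel S \<and>
       (\<forall>y\<in>S. cball y (4 * r) \<subseteq> \<Omega> \<inter> ball x0 r0 \<and> (\<forall>x\<in>ball y (4 * r). boundary_dist \<Omega> x \<le> 10 * L * r) \<and>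
          (\<forall>x\<in>ball y r. x - (8 * L * r) *\<^sub>R e \<in> ball x0 r0 - \<Omega>))"
    by (rule boundary_layer[OF \<Omega>]) (rule that; (assumption | blast))
  have W': "W1p p (ball x0 (r0 + 1)) v0 H" by (rule W1p_subset[OF W]) auto
  have n0: "AE x in lborel. v0 x \<ge> 0" using v0 by eventually_elim (simp add: nonneg)
  have z0: "AE x in lborel. x \<notin> \<Omega> \<longrightarrow> v0 x = 0" using v0 zero by eventually_elim simp
  obtain K where K: "K \<ge> 0" "\<And>A h. A \<subseteq> ball x0 r0 \<Longrightarrow> (\<And>x. x \<in> A \<Longrightarrow> x - h \<in> ball x0 r0 - \<Omega>) \<Longrightarrow>
     (\<integral>\<^sup>+x. indicator A x * ennreal (v0 x powr p) \<partial>lborel) \<le> ennreal (K * norm h powr p)"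
    using shift_to_zero_set_estimate[OF W' p layer(2) n0 z0] by blast
  define N where "N = DIM('a)"
  define \<omega> where "\<omega> = unit_ball_vol (real N)"
  have \<omega>: "\<omega> \<ge> 0" by (simp add: \<omega>_def unit_ball_vol_nonneg)
  define K' where "K' = (\<omega> * K * (8 * L) powr p + 1) / c"
  have K': "K' \<ge> 0" using \<omega> K layer by (simp add: K'_def)
  show ?thesis
  proof (rule that[OF layer(3,4) K'])
    fix r assume r: "0 < r" "r < \<rho>"
    from layer(6)[OF r] obtain S where S[measurable]: "S \<in> sets borel" and Sm: "ennreal (c * r) \<le> emeasure lborel S"
      and Sy: "\<And>y. y \<in> S \<Longrightarrow> cball y (4 * r) \<subseteq> \<Omega> \<inter> ball x0 r0 \<and> (\<forall>x\<in>ball y (4 * r). boundary_dist \<Omega> x \<le> 10 * L * r) \<and>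
          (\<forall>x\<in>ball y r. x - (8 * L * r) *\<^sub>R e \<in> ball x0 r0 - \<Omega>)"
      by blast
    define A where "A = (\<Union>y\<in>S. ball y r)"
    have A[measurable]: "A \<in> sets borel" unfolding A_def by (intro borel_open) auto
    define h where "h = (8 * L * r) *\<^sub>R e"
    have nh: "norm h = 8 * L * r" using layer r by (simp add: h_def)
    have A_sub: "A \<subseteq> ball x0 r0" 
    proof
      fix x assume "x \<in> A"
      then obtain y where y: "y \<in> S" "x \<in> ball y r" by (auto simp: A_def)
      then have "x \<in> cball y (4 * r)" using r by auto
      then show "x \<in> ball x0 r0" using Sy[OF y(1)] by blast
    qed
    have A_shift: "x - h \<in> ball x0 r0 - \<Omega>" if "x \<in> A" for x
      using that Sy by (auto simp: A_def h_def)
    have KA: "(\<integral>\<^sup>+x. indicator A x * ennreal (v x powr p) \<partial>lborel) \<le> ennreal (K * (8 * L * r) powr p)"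
    proof -
      have "(\<integral>\<^sup>+x. indicator A x * ennreal (v x powr p) \<partial>lborel) = (\<integral>\<^sup>+x. indicator A x * ennreal (v0 x powr p) \<partial>lborel)"
        by (rule nn_integral_cong_AE, use v0 in eventually_elim) simp
      also have "\<dots> \<le> ennreal (K * norm h powr p)" by (rule K(2)[OF A_sub A_shift])
      finally show ?thesis by (simp only: nh)
    qed
    define t where "t = K' * r powr (real N + p - 1)"
    define F where "F y = (\<integral>\<^sup>+x. indicator (ball y r) x * ennreal (v x powr p) \<partial>lborel)" for y
    define B :: "'a \<Rightarrow> 'a \<Rightarrow> ennreal" where "B y x = indicator {z. norm z < r} (x - y)" for y x
    have Bm[measurable]: "(\<lambda>z. indicator {z. norm z < r} z :: ennreal) \<in> borel_measurable (borel :: 'a measure)" by measurable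
    have [measurable]: "(\<lambda>(y, x). B y x) \<in> borel_measurable (borel \<Otimes>\<^sub>M borel)" unfolding B_def by measurable
    have BF: "F y = (\<integral>\<^sup>+x. B y x * ennreal (v x powr p) \<partial>lborel)" for y
      unfolding F_def B_def by (intro nn_integral_cong) (auto simp: indicator_def dist_norm norm_minus_commute)
    have Bint: "(\<integral>\<^sup>+y. B y x \<partial>lborel) = ennreal (\<omega> * r ^ N)" for x
    proof -
      have "B y x = indicator (ball x r) y" for y by (auto simp: B_def indicator_def dist_norm)
      then have "(\<integral>\<^sup>+y. B y x \<partial>lborel) = emeasure lborel (ball x r)" by simp
      then show ?thesis using r by (simp add: emeasure_ball \<omega>_def N_def)
    qed
    have "(\<integral>\<^sup>+y. indicator S y * F y \<partial>lborel) 
       \<le> (\<integral>\<^sup>+y. \<integral>\<^sup>+x. B y x * (indicator A x * ennreal (v x powr p)) \<partial>lborel \<partial>lborel)"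
    proof (rule nn_integral_mono)
      fix y
      show "indicator S y * F y \<le> (\<integral>\<^sup>+x. B y x * (indicator A x * ennreal (v x powr p)) \<partial>lborel)"
      proof (cases "y \<in> S")
        case True
        have "F y \<le> (\<integral>\<^sup>+x. B y x * (indicator A x * ennreal (v x powr p)) \<partial>lborel)"
          unfolding BF
        proof (rule nn_integral_mono)
          fix x
          have "x \<in> A" if "norm (x - y) < r" using that True by (auto simp: A_def dist_norm norm_minus_commute)
          then show "B y x * ennreal (v x powr p) \<le> B y x * (indicator A x * ennreal (v x powr p))"
            by (auto simp: B_def indicator_def)
        qed
        then show ?thesis using True by simp
      qed simp
    qed
    also have "\<dots> = (\<integral>\<^sup>+x. \<integral>\<^sup>+y. B y x * (indicator A x * ennreal (v x powr p)) \<partial>lborel \<partial>lborel)"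
      by (rule lborel_pair.Fubini') measurable
    also have "\<dots> = (\<integral>\<^sup>+x. ennreal (\<omega> * r ^ N) * (indicator A x * ennreal (v x powr p)) \<partial>lborel)"
      by (intro nn_integral_cong) (simp add: nn_integral_multc Bint)
    also have "\<dots> = ennreal (\<omega> * r ^ N) * (\<integral>\<^sup>+x. indicator A x * ennreal (v x powr p) \<partial>lborel)"
      by (rule nn_integral_cmult) measurable
    also have "\<dots> \<le> ennreal (\<omega> * r ^ N) * ennreal (K * (8 * L * r) powr p)"
      using KA by (rule mult_left_mono) simp
    also have "\<dots> = ennreal (\<omega> * r ^ N * (K * (8 * L * r) powr p))"
      using \<omega> K r by (intro ennreal_mult[symmetric]) auto
    finally have upper: "(\<integral>\<^sup>+y. indicator S y * F y \<partial>lborel) \<le> ennreal (\<omega> * r ^ N * (K * (8 * L * r) powr p))" .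
    have "\<exists>y\<in>S. F y \<le> ennreal t"
    proof (rule ccontr)
      assume "\<not> (\<exists>y\<in>S. F y \<le> ennreal t)"
      then have big: "ennreal t \<le> F y" if "y \<in> S" for y using that by (meson le_cases)
      have "ennreal (t * (c * r)) = ennreal t * ennreal (c * r)" using K' layer r by (intro ennreal_mult) (auto simp: t_def)
      also have "\<dots> \<le> ennreal t * emeasure lborel S" using Sm by (rule mult_left_mono) simp
      also have "\<dots> = (\<integral>\<^sup>+y. ennreal t * indicator S y \<partial>lborel)" by (simp add: nn_integral_cmult_indicator)
      also have "\<dots> \<le> (\<integral>\<^sup>+y. indicator S y * F y \<partial>lborel)"
        using big by (intro nn_integral_mono) (auto simp: indicator_def)
      also note upper
      finally have "t * (c * r) \<le> \<omega> * r ^ N * (K * (8 * L * r) powr p)"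
        using \<omega> K r by (subst (asm) ennreal_le_iff) auto
      also have "(8 * L * r) powr p = (8 * L) powr p * r powr p" by (rule powr_mult)
      also have "\<omega> * r ^ N * (K * ((8 * L) powr p * r powr p)) = (K' * c - 1) * (r ^ N * r powr p)"
      proof -
        have "K' * c = \<omega> * K * (8 * L) powr p + 1" using layer(5) by (simp add: K'_def)
        then show ?thesis by (simp only:) (simp add: algebra_simps)
      qed
      also have "t * (c * r) = (K' * c) * (r ^ N * r powr p)"
        using r by (simp add: t_def powr_add powr_diff powr_realpow)
      finally have "r ^ N * r powr p \<le> 0" by (simp add: algebra_simps)
      moreover have "r ^ N * r powr p > 0" using r by simp
      ultimately show False by linarith
    qed
    then show "\<exists>y. cball y (4 * r) \<subseteq> \<Omega> \<and> (\<forall>x\<in>ball y (4 * r). boundary_dist \<Omega> x \<le> 10 * L * r) \<and>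
      (\<integral>\<^sup>+x. indicator (ball y r) x * ennreal (v x powr p) \<partial>lborel) \<le> ennreal (K' * r powr (real DIM('a) + p - 1))"
      using Sy unfolding F_def t_def N_def by blast
  qed
qed

section \<open>Nonexistence\<close>

text \<open>
  The preceding estimate for a weak solution, with Borel versions of \<open>u\<close> and of its gradient. The function \<open>f\<close> is replaced by its
  lower bound \<open>\<Lambda>\<close>, the term with \<open>g\<close> is dropped because it is nonnegative, and the bump is bounded below by \<open>exp (-2)\<close> on the
  ball of half the radius.
\<close>

lemma weak_solution_ball_estimate:
  fixes u u0 f g :: "'a::euclidean_space \<Rightarrow> real" and G :: "'a \<Rightarrow> 'a" and y :: 'a and Q :: nat
  assumes s: "0 < s" "s < 1" and q: "1 < q" "q \<le> p" and p: "p < real DIM('a)" and Q: "p \<le> real Q"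
    and \<kappa>: "\<kappa> > 0" and r: "r > 0" and \<alpha>: "\<alpha> > 0"
    and u[measurable]: "u \<in> borel_measurable borel" "\<And>x. u x \<ge> 0" "AE x in lborel. u0 x = u x"
    and pos: "AE x in lborel. x \<in> \<Omega> \<longrightarrow> u x > 0"
    and \<Omega>: "open \<Omega>" "cball y (4 * r) \<subseteq> \<Omega>"
    and f: "\<And>x. x \<in> \<Omega> \<Longrightarrow> 0 \<le> f x" "\<And>x. x \<in> ball y (4 * r) \<Longrightarrow> \<Lambda> \<le> f x" "\<Lambda> \<ge> 0" 
    and g: "\<And>x. x \<in> \<Omega> \<Longrightarrow> 0 \<le> g x"
    and weak: "weak_formulation \<Omega> p q s \<alpha> \<beta> f g u0 G"
    and W: "W1p p (ball y (4 * r)) u0 G"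
    and L: "L > 0" "\<And>x y :: 'a. \<bar>bump x - bump y\<bar> \<le> L * norm (x - y)" "\<And>x :: 'a. norm (grad bump x) \<le> L"
  shows "ennreal (\<Lambda> * exp (-2) ^ Q) * (\<integral>\<^sup>+x. indicator (ball y (r / 2)) x * ennreal ((u x + \<kappa>) powr (- (q - 1 + \<alpha>))) \<partial>lborel)
     \<le> ennreal (real Q powr p / (q - 1) powr (p - 1) * (L / r) powr p) * 
         (\<integral>\<^sup>+x. indicator (ball y r) x * ennreal ((u x + \<kappa>) powr (p - q)) \<partial>lborel)
       + ennreal (r powr (real DIM('a) - s * q)) * bump_energy TYPE('a) q (real DIM('a) + s * q) (real Q / q)"
proof -
  define V where "V = ball y (4 * r)"
  have V: "V \<in> sets borel" "V \<subseteq> \<Omega>" using \<Omega> by (auto simp: V_def)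
  have \<Omega>b: "\<Omega> \<in> sets borel" using \<Omega>(1) by simp
  have U: "ball y (3 * r) \<subseteq> V" using r by (auto simp: V_def)
  have "G \<in> borel_measurable (lebesgue_on V)" using W by (simp add: W1p_def in_Lp_def V_def)
  then obtain G' where G'[measurable]: "G' \<in> borel_measurable borel" 
    and GG': "AE x in lborel. x \<in> V \<longrightarrow> G x = G' x" "\<And>x. x \<notin> V \<Longrightarrow> G' x = 0"
    using borel_representative[OF _ V(1)] by blast
  define Fl where "Fl x = indicator V x * (\<Lambda> * u x powr (- \<alpha>))" for x
  have Vm[measurable]: "(\<lambda>x. indicator V x :: real) \<in> borel_measurable borel" 
    using V(1) by (rule borel_measurable_indicator)
  have Fl[measurable]: "Fl \<in> borel_measurable borel" unfolding Fl_def[abs_def] by measurable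
  have Fl0: "Fl x \<ge> 0" for x using f(3) by (simp add: Fl_def)
  have p1: "p \<ge> 1" using q by simp
  have R3: "0 < 3 * r" "3 * r < 4 * r" using r by auto
  have nn: "AE x in lborel. x \<in> ball y (4 * r) \<longrightarrow> u0 x \<ge> 0" using u(3) by eventually_elim (simp add: u(2))
  obtain w :: "nat \<Rightarrow> 'a \<Rightarrow> real" and M where w: "\<And>n k. C_k k (w n)" "\<And>n x. w n x \<ge> 0"
    "AE x in lborel. x \<in> ball y (3 * r) \<longrightarrow> (\<lambda>n. w n x) \<longlonglongrightarrow> u0 x"
    "AE x in lborel. x \<in> ball y (3 * r) \<longrightarrow> (\<lambda>n. grad (w n) x) \<longlonglongrightarrow> G x"
    and M: "M \<in> borel_measurable borel" and Mfin: "(\<integral>\<^sup>+x. M x \<partial>lborel) < \<infinity>"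
    and wM: "\<And>n x. x \<in> ball y (3 * r) \<Longrightarrow> ennreal (norm (grad (w n) x) powr p) \<le> M x"
    by (rule W1p_smooth_approximation[OF W p1 R3 nn]) (rule that; (assumption | blast))
  have wu: "AE x in lborel. x \<in> ball y (3 * r) \<longrightarrow> (\<lambda>n. w n x) \<longlonglongrightarrow> u x"
    using w(3) u(3) by eventually_elim simp
  have wG: "AE x in lborel. x \<in> ball y (3 * r) \<longrightarrow> (\<lambda>n. grad (w n) x) \<longlonglongrightarrow> G' x"
    using w(4) GG'(1) by eventually_elim (use U in auto)
  have weak': "integrable lborel (\<lambda>x. bracket_pow (G' x) (p - 1) \<bullet> grad \<phi> x) \<and>
        integrable lborel (nonlocal_integrand q s u \<phi>) \<and> integrable lborel (\<lambda>x. Fl x * \<phi> x) \<and>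
        (\<integral>x. Fl x * \<phi> x \<partial>lborel) 
          \<le> (\<integral>x. bracket_pow (G' x) (p - 1) \<bullet> grad \<phi> x \<partial>lborel) + (\<integral>z. nonlocal_integrand q s u \<phi> z \<partial>lborel)"
    if \<phi>: "\<phi> \<in> test_functions (ball y (3 * r))" and \<phi>0: "\<And>x. \<phi> x \<ge> 0" for \<phi>
  proof -
    have "\<phi> \<in> test_functions \<Omega>" using \<phi> test_functions_mono[of "ball y (3 * r)" \<Omega>] U V by blast
    then have wf: "integrable (lebesgue_on \<Omega>) (\<lambda>x. bracket_pow (G x) (p - 1) \<bullet> grad \<phi> x)"
      "integrable lebesgue (nonlocal_integrand q s u0 \<phi>)"
      "integrable (lebesgue_on \<Omega>) (\<lambda>x. f x * u0 x powr (- \<alpha>) * \<phi> x)"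
      "integrable (lebesgue_on \<Omega>) (\<lambda>x. g x * u0 x powr \<beta> * \<phi> x)"
      "(\<integral>x. bracket_pow (G x) (p - 1) \<bullet> grad \<phi> x \<partial>lebesgue_on \<Omega>)
        + (\<integral>z. nonlocal_integrand q s u0 \<phi> z \<partial>lebesgue)
      = (\<integral>x. f x * u0 x powr (- \<alpha>) * \<phi> x \<partial>lebesgue_on \<Omega>)
        + (\<integral>x. g x * u0 x powr \<beta> * \<phi> x \<partial>lebesgue_on \<Omega>)"
      using weak unfolding weak_formulation_def by blast+
    have \<phi>C: "C_k k \<phi>" for k using \<phi> by (simp add: test_functions_def)
    have [measurable]: "\<phi> \<in> borel_measurable borel" "grad \<phi> \<in> borel_measurable borel"
      using \<phi>C smooth_grad(3)[OF \<phi>C] by (auto intro!: borel_measurable_continuous_onI C_k_imp_continuous)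
    have out: "\<phi> x = 0" "grad \<phi> x = 0" if "x \<notin> V" for x
    proof -
      have "x \<notin> ball y (3 * r)" using that U by blast
      then show "\<phi> x = 0" "grad \<phi> x = 0" by (rule test_functions_outside[OF \<phi>])+
    qed
    have m1: "(\<lambda>x. bracket_pow (G' x) (p - 1) \<bullet> grad \<phi> x) \<in> borel_measurable borel"
      unfolding bracket_pow_def by measurable
    have a1: "AE x in lborel. x \<in> \<Omega> \<longrightarrow> bracket_pow (G x) (p - 1) \<bullet> grad \<phi> x = bracket_pow (G' x) (p - 1) \<bullet> grad \<phi> x"
      using GG'(1)
    proof eventually_elim
      case (elim x)
      then show ?case using out(2)[of x] by (cases "x \<in> V") auto
    qed
    have z1: "bracket_pow (G' x) (p - 1) \<bullet> grad \<phi> x = 0" if "x \<notin> \<Omega>" for x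
      using out(2)[of x] that V(2) by (metis inner_zero_right subsetD)
    have T1: "integrable (lebesgue_on \<Omega>) (\<lambda>x. bracket_pow (G x) (p - 1) \<bullet> grad \<phi> x) 
        \<longleftrightarrow> integrable lborel (\<lambda>x. bracket_pow (G' x) (p - 1) \<bullet> grad \<phi> x)"
      "(\<integral>x. bracket_pow (G x) (p - 1) \<bullet> grad \<phi> x \<partial>lebesgue_on \<Omega>) = (\<integral>x. bracket_pow (G' x) (p - 1) \<bullet> grad \<phi> x \<partial>lborel)"
      by (rule lebesgue_on_transfer[OF \<Omega>b m1 a1 z1]; assumption)+
    have m2: "nonlocal_integrand q s u \<phi> \<in> borel_measurable borel"
    proof -
      have "nonlocal_integrand q s u \<phi> \<in> borel_measurable (lborel \<Otimes>\<^sub>M lborel)"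
        unfolding nonlocal_integrand_def bracket_pow_def by measurable
      then show ?thesis by (simp add: lborel_prod)
    qed
    have a2: "AE z in lborel. z \<in> UNIV \<longrightarrow> nonlocal_integrand q s u0 \<phi> z = nonlocal_integrand q s u \<phi> z"
      using AE_lborel_prod[OF u(3)]
      by eventually_elim (simp add: nonlocal_integrand_def case_prod_beta)
    note T2 = lebesgue_on_transfer[OF _ m2 a2, unfolded lebesgue_on_UNIV_eq, simplified]
    have m3: "(\<lambda>x. Fl x * \<phi> x) \<in> borel_measurable borel" by measurable
    have "(\<lambda>x. Fl x * \<phi> x) \<in> borel_measurable lborel" by measurable
    then have m3': "(\<lambda>x. Fl x * \<phi> x) \<in> borel_measurable (lebesgue_on \<Omega>)"
      by (intro measurable_restrict_space1 measurable_completion)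
    have z3: "Fl x * \<phi> x = 0" if "x \<notin> \<Omega>" for x using out(1)[of x] that V(2) by (metis mult_zero_right subsetD)
    note T3 = lebesgue_on_transfer[OF \<Omega>b m3 _ z3, of "\<lambda>x. Fl x * \<phi> x", simplified]
    have \<Omega>l: "\<Omega> \<inter> space lebesgue \<in> sets lebesgue" using \<Omega>b by simp
    have dom: "AE x in lebesgue_on \<Omega>. Fl x * \<phi> x \<le> f x * u0 x powr (- \<alpha>) * \<phi> x"
      unfolding AE_restrict_space_iff[OF \<Omega>l]
    proof (rule AE_completion, use u(3) in eventually_elim, intro impI)
      fix x assume x: "x \<in> \<Omega>" "u0 x = u x"
      have "Fl x \<le> f x * u0 x powr (- \<alpha>)"
        unfolding Fl_def using x f(1)[OF x(1)] f(2)[of x] by (auto simp: V_def indicator_def intro!: mult_right_mono)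
      then show "Fl x * \<phi> x \<le> f x * u0 x powr (- \<alpha>) * \<phi> x" using \<phi>0 by (intro mult_right_mono)
    qed
    have i3: "integrable (lebesgue_on \<Omega>) (\<lambda>x. Fl x * \<phi> x)"
    proof (rule Bochner_Integration.integrable_bound[OF wf(3) m3'], use dom in eventually_elim)
      fix x assume "Fl x * \<phi> x \<le> f x * u0 x powr (- \<alpha>) * \<phi> x"
      moreover have "0 \<le> Fl x * \<phi> x" using Fl0 \<phi>0 by simp
      ultimately show "norm (Fl x * \<phi> x) \<le> norm (f x * u0 x powr (- \<alpha>) * \<phi> x)" by simp
    qed
    have "(\<integral>x. Fl x * \<phi> x \<partial>lborel) = (\<integral>x. Fl x * \<phi> x \<partial>lebesgue_on \<Omega>)" by (simp add: T3)
    also have "\<dots> \<le> (\<integral>x. f x * u0 x powr (- \<alpha>) * \<phi> x \<partial>lebesgue_on \<Omega>)"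
      by (rule integral_mono_AE[OF i3 wf(3) dom])
    also have "\<dots> \<le> (\<integral>x. f x * u0 x powr (- \<alpha>) * \<phi> x \<partial>lebesgue_on \<Omega>) + (\<integral>x. g x * u0 x powr \<beta> * \<phi> x \<partial>lebesgue_on \<Omega>)"
    proof -
      have "0 \<le> (\<integral>x. g x * u0 x powr \<beta> * \<phi> x \<partial>lebesgue_on \<Omega>)"
        by (rule Bochner_Integration.integral_nonneg_AE, rule AE_I2) (use g \<phi>0 in \<open>auto simp: space_restrict_space\<close>)
      then show ?thesis by simp
    qed
    also note wf(5)[symmetric]
    finally have "(\<integral>x. Fl x * \<phi> x \<partial>lborel) 
        \<le> (\<integral>x. bracket_pow (G' x) (p - 1) \<bullet> grad \<phi> x \<partial>lborel) + (\<integral>z. nonlocal_integrand q s u \<phi> z \<partial>lborel)"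
      unfolding T1(2) T2(2) .
    then show ?thesis using wf(1,2) i3 T1(1) T2(1) T3(1) by blast
  qed
  have "ennreal (\<Lambda> * exp (-2) ^ Q) * (\<integral>\<^sup>+x. indicator (ball y (r / 2)) x * ennreal ((u x + \<kappa>) powr (- (q - 1 + \<alpha>))) \<partial>lborel)
    = (\<integral>\<^sup>+x. ennreal (\<Lambda> * exp (-2) ^ Q) * (indicator (ball y (r / 2)) x * ennreal ((u x + \<kappa>) powr (- (q - 1 + \<alpha>)))) \<partial>lborel)"
    by (rule nn_integral_cmult[symmetric]) (intro borel_measurable_times_ennreal borel_measurable_indicator; measurable)
  also have "\<dots> \<le> (\<integral>\<^sup>+x. ennreal (Fl x * (bump ((x - y) /\<^sub>R r) ^ Q * (u x + \<kappa>) powr (1 - q))) \<partial>lborel)"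
  proof (rule nn_integral_mono_AE, use pos in eventually_elim)
    fix x assume pos: "x \<in> \<Omega> \<longrightarrow> u x > 0"
    show "ennreal (\<Lambda> * exp (-2) ^ Q) * (indicator (ball y (r / 2)) x * ennreal ((u x + \<kappa>) powr (- (q - 1 + \<alpha>))))
        \<le> ennreal (Fl x * (bump ((x - y) /\<^sub>R r) ^ Q * (u x + \<kappa>) powr (1 - q)))"
    proof (cases "x \<in> ball y (r / 2)")
      case True
      then have xV: "x \<in> V" using r by (auto simp: V_def)
      then have ux: "u x > 0" using pos V by auto
      have "norm (x - y) / r \<le> 1 / 2" using True r by (simp add: dist_norm norm_minus_commute field_simps)
      then have "norm ((x - y) /\<^sub>R r) \<le> 1 / 2" by (subst norm_scaleR_inverse[OF r])
      from bump_ge[OF this] have b: "exp (-2) ^ Q \<le> bump ((x - y) /\<^sub>R r) ^ Q" by (rule power_mono) simp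
      have "\<Lambda> * exp (-2) ^ Q * (u x + \<kappa>) powr (- (q - 1 + \<alpha>)) = (\<Lambda> * (u x + \<kappa>) powr (- \<alpha>)) * (exp (-2) ^ Q * (u x + \<kappa>) powr (1 - q))"
        by (simp add: powr_add[symmetric] algebra_simps)
      also have "\<dots> \<le> (\<Lambda> * u x powr (- \<alpha>)) * (bump ((x - y) /\<^sub>R r) ^ Q * (u x + \<kappa>) powr (1 - q))"
        using b f(3) ux \<kappa> \<alpha> q by (intro mult_mono powr_mono2') (auto simp: bump_nonneg)
      also have "\<dots> = Fl x * (bump ((x - y) /\<^sub>R r) ^ Q * (u x + \<kappa>) powr (1 - q))" using xV by (simp add: Fl_def)
      finally show ?thesis using True f(3) by (simp add: ennreal_leI flip: ennreal_mult')
    qed simp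
  qed
  also have "\<dots> \<le> ennreal (real Q powr p / (q - 1) powr (p - 1) * (L / r) powr p) * 
         (\<integral>\<^sup>+x. indicator (ball y r) x * ennreal ((u x + \<kappa>) powr (p - q)) \<partial>lborel)
       + ennreal (r powr (real DIM('a) - s * q)) * bump_energy TYPE('a) q (real DIM('a) + s * q) (real Q / q)"
    by (rule caccioppoli_ball[OF s q p Q \<kappa> r u(1,2) G' Fl Fl0 weak' order_refl w(1,2) wu wG M Mfin wM L])
  finally show ?thesis .
qed

lemma small_powr:
  fixes a b D t :: real
  assumes "a > 0" "b > 0" "D \<ge> 0" "t > 0"
  obtains x where "0 < x" "x < b" "D * x powr a < t"
proof -
  define x where "x = min (b / 2) ((t / (D + 1)) powr (1 / a))"
  have x: "0 < x" "x < b" using assms by (auto simp: x_def)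
  have "x powr a \<le> ((t / (D + 1)) powr (1 / a)) powr a" using x assms by (intro powr_mono2) (auto simp: x_def)
  also have "\<dots> = t / (D + 1)" using assms by (simp add: powr_powr)
  finally have "D * x powr a \<le> D * (t / (D + 1))" using assms by (intro mult_left_mono) auto
  also have "\<dots> < t" using assms by (simp add: field_simps)
  finally show ?thesis using that x by blast
qed

text \<open>
  Both cases at once: \<open>v0\<close> is \<open>u\<close> itself for \<open>\<theta> = 1\<close>, and \<open>u powr \<theta>0\<close> for \<open>\<theta> = \<theta>0\<close>.
\<close>

lemma no_weak_solution:
  fixes \<Omega> :: "'a::euclidean_space set" and f g u v0 :: "'a \<Rightarrow> real"
  assumes \<Omega>: "open \<Omega>" "\<Omega> \<noteq> {}" "bounded \<Omega>" "C2_boundary \<Omega>"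
    and s: "0 < s" "s < 1" and q: "1 < q" "q \<le> p" and p: "p < real DIM('a)" and \<alpha>: "0 < \<alpha>"
    and g: "\<And>x. x \<in> \<Omega> \<Longrightarrow> 0 \<le> g x"
    and \<delta>: "p \<le> \<delta>" and C1: "0 < C1" and f: "\<And>x. x \<in> \<Omega> \<Longrightarrow> C1 * boundary_dist \<Omega> x powr (- \<delta>) \<le> f x"
    and \<theta>: "\<theta> \<ge> 1" and um: "u \<in> borel_measurable lebesgue" and u: "positive_in \<Omega> u"
    and W: "\<And>y r. cball y r \<subseteq> \<Omega> \<Longrightarrow> W1p p (ball y r) u G"
    and V: "W1p p UNIV v0 H" "AE x in lborel. v0 x = u x powr \<theta>"
    and weak: "weak_formulation \<Omega> p q s \<alpha> \<beta> f g u G"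
  shows False
proof -
  define N where "N = DIM('a)"
  \<comment> \<open>a natural exponent, so that the power of the bump in the test function is smooth\<close>
  define Q where "Q = nat \<lceil>p\<rceil>"
  have Q: "p \<le> real Q" unfolding Q_def by (rule real_nat_ceiling_ge)
  have p1: "p > 1" using q by simp
  define m where "m = q - 1 + \<alpha>"
  have m: "m > 0" using q \<alpha> by (simp add: m_def)
  have "\<exists>u'\<in>borel_measurable lborel. AE x in lborel. u x = u' x"
    by (rule completion_ex_borel_measurable_real[OF um])
  then obtain u1 where u1: "u1 \<in> borel_measurable borel" "AE x in lborel. u x = u1 x" by auto
  have pos: "AE x in lborel. x \<in> \<Omega> \<longrightarrow> u x > 0" "AE x in lborel. x \<notin> \<Omega> \<longrightarrow> u x = 0"
    using u by (auto simp: positive_in_def AE_completion_iff)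
  define u' where "u' x = \<bar>u1 x\<bar>" for x
  have u'm[measurable]: "u' \<in> borel_measurable borel" unfolding u'_def[abs_def] using u1(1) by measurable
  have u'0: "u' x \<ge> 0" for x by (simp add: u'_def)
  have uu': "AE x in lborel. u x = u' x"
    using u1(2) pos by eventually_elim (auto simp: u'_def)
  have pos': "AE x in lborel. x \<in> \<Omega> \<longrightarrow> u' x > 0" using uu' pos(1) by eventually_elim simp
  have zero': "AE x in lborel. x \<notin> \<Omega> \<longrightarrow> u' x = 0" using uu' pos(2) by eventually_elim simp
  define v where "v x = u' x powr \<theta>" for x
  have vm[measurable]: "v \<in> borel_measurable borel" unfolding v_def[abs_def] by measurable
  have v_nn: "v x \<ge> 0" for x by (simp add: v_def)
  have v0: "AE x in lborel. v0 x = v x" using V(2) uu' by eventually_elim (simp add: v_def)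
  have vz: "AE x in lborel. x \<notin> \<Omega> \<longrightarrow> v x = 0" using zero' by eventually_elim (simp add: v_def)
  obtain \<rho> L K where \<rho>: "\<rho> > 0" and L: "L \<ge> 1" and K: "K \<ge> 0"
    and small: "\<And>r. 0 < r \<Longrightarrow> r < \<rho> \<Longrightarrow> \<exists>y. cball y (4 * r) \<subseteq> \<Omega> \<and> (\<forall>x\<in>ball y (4 * r). boundary_dist \<Omega> x \<le> 10 * L * r) \<and>
      (\<integral>\<^sup>+x. indicator (ball y r) x * ennreal (v x powr p) \<partial>lborel) \<le> ennreal (K * r powr (real DIM('a) + p - 1))"
    by (rule ball_with_small_norm[OF \<Omega> V(1) less_imp_le[OF p1] vm v0 v_nn vz]) (rule that; (assumption | blast))
  obtain Lb where Lb: "Lb > 0" "\<And>x y :: 'a. \<bar>bump x - bump y\<bar> \<le> Lb * norm (x - y)" "\<And>x :: 'a. norm (grad bump x) \<le> Lb"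
    by (rule bump_Lipschitz[where 'a='a]) (rule that; (assumption | blast))
  define BE where "BE = bump_energy TYPE('a) q (real DIM('a) + s * q) (real Q / q)"
  have "BE < \<infinity>" unfolding BE_def
  proof (rule bump_energy_finite)
    have "s * q < 1 * q" using s q by (intro mult_strict_right_mono) auto
    then show "real DIM('a) + s * q - q < real DIM('a)" by simp
    have "0 < s * q" using s q by simp
    then show "real DIM('a) < real DIM('a) + s * q" "q < real DIM('a) + s * q" using p q by auto
  qed (use q Q in \<open>auto simp: field_simps\<close>)
  define E where "E = enn2real BE"
  have E: "BE = ennreal E" "E \<ge> 0" using \<open>BE < \<infinity>\<close> by (auto simp: E_def less_top)
  have front: "frontier \<Omega> \<noteq> {}"
    using \<Omega>(2,3) not_bounded_UNIV by (auto simp: frontier_eq_empty)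
  define \<omega> where "\<omega> = unit_ball_vol (real N)"
  have \<omega>: "\<omega> > 0" by (simp add: \<omega>_def unit_ball_vol_pos)
  define Cc where "Cc = real Q powr p / (q - 1) powr (p - 1)"
  have Cc: "Cc \<ge> 0" by (simp add: Cc_def)
  define D where "D = Cc * Lb powr p * (2 powr p * (2 * \<omega> + K)) + E"
  have D: "D \<ge> 0" using Cc \<omega> K E by (simp add: D_def)
  define lam where "lam = C1 * (10 * L) powr (- p) * exp (-2) ^ Q"
  have lam: "lam > 0" using C1 L by (simp add: lam_def)
  define D' where "D' = D / lam"
  have D': "D' \<ge> 0" using D lam by (simp add: D'_def)
  define \<tau> where "\<tau> = \<omega> / 2 ^ N / 2"
  have \<tau>: "\<tau> > 0" using \<omega> by (simp add: \<tau>_def)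
  \<comment> \<open>The constant \<open>D'\<close> depends neither on \<open>\<kappa>\<close> nor on \<open>r\<close>, so \<open>\<kappa>\<close> can be fixed first. The negative power of \<open>\<kappa>\<close> in the
    condition on \<open>r\<close> is then a constant.\<close>
  obtain \<kappa> where \<kappa>: "0 < \<kappa>" "\<kappa> < 1" "(2 powr m * D') * \<kappa> powr m < \<tau>"
    by (rule small_powr[of m 1 "2 powr m * D'" \<tau>]) (use m D' \<tau> in auto)
  obtain r where r: "0 < r" "r < min \<rho> (1 / (10 * L))" "(\<kappa> powr (- (\<theta> * p)) * K) * r powr (p - 1) < \<tau>"
    by (rule small_powr[of "p - 1" "min \<rho> (1 / (10 * L))" "\<kappa> powr (- (\<theta> * p)) * K" \<tau>]) (use p1 \<rho> L K \<tau> in auto)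
  have r\<rho>: "r < \<rho>" and r10: "10 * L * r \<le> 1" using r L by (auto simp: field_simps)
  have r1: "r \<le> 1" 
  proof -
    have "1 * r \<le> 10 * L * r" using L r by (intro mult_right_mono) auto
    then show ?thesis using r10 by simp
  qed
  obtain y where y: "cball y (4 * r) \<subseteq> \<Omega>" "\<And>x. x \<in> ball y (4 * r) \<Longrightarrow> boundary_dist \<Omega> x \<le> 10 * L * r"
    and vy: "(\<integral>\<^sup>+x. indicator (ball y r) x * ennreal (v x powr p) \<partial>lborel) \<le> ennreal (K * r powr (real DIM('a) + p - 1))"
    using small[OF r(1) r\<rho>] by blast
  define \<Lambda> where "\<Lambda> = C1 * (10 * L * r) powr (- p)"
  have \<Lambda>: "\<Lambda> \<ge> 0" using C1 by (simp add: \<Lambda>_def)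
  have f0: "0 \<le> f x" if "x \<in> \<Omega>" for x
    using f[OF that] C1 by (intro order_trans[OF _ f[OF that]]) simp
  have f\<Lambda>: "\<Lambda> \<le> f x" if x: "x \<in> ball y (4 * r)" for x
  proof -
    have x\<Omega>: "x \<in> \<Omega>" using x y(1) by auto
    define d where "d = boundary_dist \<Omega> x"
    have "x \<notin> frontier \<Omega>" using x\<Omega> \<Omega>(1) by (simp add: frontier_def interior_open)
    then have d: "d > 0" "d \<le> 10 * L * r" 
      using infdist_pos_not_in_closed[OF frontier_closed front] y(2)[OF x] by (auto simp: d_def boundary_dist_def)
    have "(10 * L * r) powr (- p) \<le> d powr (- p)" using d p1 by (intro powr_mono2') auto
    also have "\<dots> \<le> d powr (- \<delta>)" using d r10 \<delta> by (intro powr_mono') auto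
    finally have "\<Lambda> \<le> C1 * d powr (- \<delta>)" using C1 by (simp add: \<Lambda>_def)
    also have "\<dots> \<le> f x" using f[OF x\<Omega>] by (simp add: d_def)
    finally show ?thesis .
  qed
  define I where "I = (\<integral>\<^sup>+x. indicator (ball y (r / 2)) x * ennreal ((u' x + \<kappa>) powr (- m)) \<partial>lborel)"
  define R1 where "R1 = (\<integral>\<^sup>+x. indicator (ball y r) x * ennreal ((u' x + \<kappa>) powr (p - q)) \<partial>lborel)"
  have est: "ennreal (\<Lambda> * exp (-2) ^ Q) * I \<le> ennreal (Cc * (Lb / r) powr p) * R1 + ennreal (r powr (real DIM('a) - s * q)) * BE"
    unfolding I_def R1_def BE_def Cc_def m_def
    by (rule weak_solution_ball_estimate[OF s q p Q \<kappa>(1) r(1) \<alpha> u'm u'0 uu' pos' \<Omega>(1) y(1) f0 f\<Lambda> \<Lambda> g weak W[OF y(1)] Lb])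
  have ball_m: "(\<lambda>x. indicator (ball y R) x :: ennreal) \<in> borel_measurable borel" for R
    by (rule borel_measurable_indicator) simp
  have vol: "emeasure lborel (ball y R) = ennreal (\<omega> * R ^ N)" if "R \<ge> 0" for R
    using that by (simp add: emeasure_ball \<omega>_def N_def)
  have up: "u' x powr p \<le> 1 + v x powr p" for x
  proof (cases "u' x \<le> 1")
    case True
    then have "u' x powr p \<le> 1" using u'0 p1 by (intro powr_le1) auto
    then show ?thesis using powr_ge_zero[of "v x" p] by linarith
  next
    case False
    have "1 * p \<le> \<theta> * p" using \<theta> p1 by (intro mult_right_mono) auto
    then have "u' x powr p \<le> u' x powr (\<theta> * p)" using False by (intro powr_mono) auto
    then show ?thesis by (simp add: v_def powr_powr)
  qed
  have R1: "R1 \<le> ennreal (2 powr p * (2 * \<omega> + K) * r ^ N)"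
  proof -
    have pt: "(u' x + \<kappa>) powr (p - q) \<le> 2 powr p * (2 + v x powr p)" for x
    proof -
      have "(u' x + \<kappa>) powr (p - q) \<le> (u' x + 1) powr (p - q)" using u'0[of x] \<kappa> q by (intro powr_mono2) auto
      also have "\<dots> \<le> (u' x + 1) powr p" using u'0[of x] q by (intro powr_mono) auto
      also have "\<dots> \<le> 2 powr p * (u' x powr p + 1)" 
        using norm_powr_add_le[of p "u' x" 1] p1 u'0[of x] by simp
      also have "\<dots> \<le> 2 powr p * (2 + v x powr p)" using up[of x] by (intro mult_left_mono) auto
      finally show ?thesis .
    qed
    have "R1 \<le> (\<integral>\<^sup>+x. ennreal (2 powr p) * (2 * indicator (ball y r) x + indicator (ball y r) x * ennreal (v x powr p)) \<partial>lborel)"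
      unfolding R1_def
    proof (rule nn_integral_mono)
      fix x
      have "ennreal ((u' x + \<kappa>) powr (p - q)) \<le> ennreal (2 powr p * (2 + v x powr p))" by (rule ennreal_leI[OF pt])
      also have "\<dots> = ennreal (2 powr p) * (2 + ennreal (v x powr p))" by (simp add: ennreal_mult)
      finally show "indicator (ball y r) x * ennreal ((u' x + \<kappa>) powr (p - q)) 
        \<le> ennreal (2 powr p) * (2 * indicator (ball y r) x + indicator (ball y r) x * ennreal (v x powr p))"
        by (cases "x \<in> ball y r") auto
    qed
    also have "\<dots> = ennreal (2 powr p) * (2 * emeasure lborel (ball y r) 
        + (\<integral>\<^sup>+x. indicator (ball y r) x * ennreal (v x powr p) \<partial>lborel))"
    proof -
      have m1: "(\<lambda>x. 2 * indicator (ball y r) x :: ennreal) \<in> borel_measurable lborel"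
        and m2: "(\<lambda>x. indicator (ball y r) x * ennreal (v x powr p)) \<in> borel_measurable lborel"
        using ball_m[of r] by (auto intro!: borel_measurable_times_ennreal)
      have "(\<integral>\<^sup>+x. 2 * indicator (ball y r) x \<partial>lborel) = 2 * emeasure lborel (ball y r)"
        by (rule nn_integral_cmult_indicator) simp
      then show ?thesis
        by (simp only: nn_integral_cmult[OF borel_measurable_add[OF m1 m2]] nn_integral_add[OF m1 m2])
    qed
    also have "\<dots> \<le> ennreal (2 powr p) * (2 * ennreal (\<omega> * r ^ N) + ennreal (K * r ^ N))"
    proof (intro mult_left_mono add_mono order_refl)
      show "emeasure lborel (ball y r) \<le> ennreal (\<omega> * r ^ N)" using vol[of r] r by simp
      have "r powr (real N + p - 1) \<le> r powr real N" using r r1 p1 by (intro powr_mono') auto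
      then have "K * r powr (real DIM('a) + p - 1) \<le> K * r ^ N" 
        using K r by (intro mult_left_mono) (simp_all add: powr_realpow N_def)
      then show "(\<integral>\<^sup>+x. indicator (ball y r) x * ennreal (v x powr p) \<partial>lborel) \<le> ennreal (K * r ^ N)"
        using vy ennreal_leI order_trans by blast
    qed auto
    also have "\<dots> = ennreal (2 powr p * (2 * (\<omega> * r ^ N) + K * r ^ N))"
      using \<omega> K r by (simp add: ennreal_mult)
    also have "2 powr p * (2 * (\<omega> * r ^ N) + K * r ^ N) = 2 powr p * (2 * \<omega> + K) * r ^ N" by (simp add: algebra_simps)
    finally show ?thesis .
  qed
  have I: "I \<le> ennreal (D' * r ^ N)"
  proof -
    define x where "x = lam * r powr (- p)"
    have x: "x > 0" using lam r by (simp add: x_def)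
    have "\<Lambda> * exp (-2) ^ Q = x" by (simp add: \<Lambda>_def x_def lam_def powr_mult)
    then have "ennreal x * I \<le> ennreal (Cc * (Lb / r) powr p) * R1 + ennreal (r powr (real DIM('a) - s * q)) * BE"
      using est by simp
    also have "\<dots> \<le> ennreal (Cc * (Lb / r) powr p) * ennreal (2 powr p * (2 * \<omega> + K) * r ^ N) + ennreal (r powr (real N - p)) * ennreal E"
    proof (intro add_mono mult_mono)
      have "s * q \<le> 1 * q" using s q by (intro mult_right_mono) auto
      then have "s * q \<le> p" using q by linarith
      then show "ennreal (r powr (real DIM('a) - s * q)) \<le> ennreal (r powr (real N - p))"
        using r r1 by (intro ennreal_leI powr_mono') (auto simp: N_def)
    qed (use R1 E in auto)
    also have "\<dots> = ennreal (Cc * (Lb / r) powr p * (2 powr p * (2 * \<omega> + K) * r ^ N) + r powr (real N - p) * E)"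
      using Cc \<omega> K E r by (simp add: ennreal_mult)
    also have "Cc * (Lb / r) powr p * (2 powr p * (2 * \<omega> + K) * r ^ N) + r powr (real N - p) * E = D * r powr (real N - p)"
      using r by (simp add: D_def powr_divide powr_diff powr_realpow field_simps)
    also have "D * r powr (real N - p) = x * (D' * r ^ N)"
      using lam r by (simp add: x_def D'_def powr_diff powr_minus powr_realpow field_simps)
    also have "ennreal (x * (D' * r ^ N)) = ennreal x * ennreal (D' * r ^ N)"
      using x D' r by (intro ennreal_mult) auto
    finally show ?thesis using x by (simp add: ennreal_mult_le_mult_iff)
  qed
  \<comment> \<open>The two terms are at least \<open>1\<close> where \<open>u \<le> \<kappa>\<close> and where \<open>u > \<kappa>\<close>, respectively, so together they bound the volume of the ball.\<close>
  define A1 where "A1 = (2 * \<kappa>) powr m"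
  define A2 where "A2 = \<kappa> powr (- (\<theta> * p))"
  have pt: "1 \<le> A1 * (u' x + \<kappa>) powr (- m) + A2 * v x powr p" for x
  proof (cases "u' x \<le> \<kappa>")
    case True
    have "(2 * \<kappa>) powr (- m) \<le> (u' x + \<kappa>) powr (- m)" using True u'0[of x] \<kappa> m by (intro powr_mono2') auto
    then have "A1 * (2 * \<kappa>) powr (- m) \<le> A1 * (u' x + \<kappa>) powr (- m)" by (intro mult_left_mono) (auto simp: A1_def)
    moreover have "A1 * (2 * \<kappa>) powr (- m) = 1" using \<kappa> by (simp add: A1_def flip: powr_add)
    moreover have "0 \<le> A2 * v x powr p" by (simp add: A2_def)
    ultimately show ?thesis by linarith
  next
    case False
    have "\<kappa> powr (\<theta> * p) \<le> u' x powr (\<theta> * p)" using False \<kappa> \<theta> p1 by (intro powr_mono2) auto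
    then have "A2 * \<kappa> powr (\<theta> * p) \<le> A2 * v x powr p" by (intro mult_left_mono) (auto simp: A2_def v_def powr_powr)
    moreover have "A2 * \<kappa> powr (\<theta> * p) = 1" using \<kappa> by (simp add: A2_def flip: powr_add)
    moreover have "0 \<le> A1 * (u' x + \<kappa>) powr (- m)" by (simp add: A1_def)
    ultimately show ?thesis by linarith
  qed
  have "ennreal (\<omega> * (r / 2) ^ N) = emeasure lborel (ball y (r / 2))" using vol[of "r / 2"] r by simp
  also have "\<dots> = (\<integral>\<^sup>+x. indicator (ball y (r / 2)) x \<partial>lborel)" by simp
  also have "\<dots> \<le> (\<integral>\<^sup>+x. ennreal A1 * (indicator (ball y (r / 2)) x * ennreal ((u' x + \<kappa>) powr (- m))) 
      + ennreal A2 * (indicator (ball y r) x * ennreal (v x powr p)) \<partial>lborel)"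
  proof (rule nn_integral_mono)
    fix x
    show "indicator (ball y (r / 2)) x \<le> ennreal A1 * (indicator (ball y (r / 2)) x * ennreal ((u' x + \<kappa>) powr (- m))) 
      + ennreal A2 * (indicator (ball y r) x * ennreal (v x powr p))"
    proof (cases "x \<in> ball y (r / 2)")
      case True
      then have "x \<in> ball y r" using r by auto
      have "(1 :: ennreal) \<le> ennreal (A1 * (u' x + \<kappa>) powr (- m) + A2 * v x powr p)" using ennreal_leI[OF pt[of x]] by simp
      also have "\<dots> = ennreal A1 * ennreal ((u' x + \<kappa>) powr (- m)) + ennreal A2 * ennreal (v x powr p)"
        by (simp add: ennreal_mult A1_def A2_def)
      finally show ?thesis using True \<open>x \<in> ball y r\<close> by simp
    qed simp
  qed
  also have "\<dots> = ennreal A1 * I + ennreal A2 * (\<integral>\<^sup>+x. indicator (ball y r) x * ennreal (v x powr p) \<partial>lborel)"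
  proof -
    have m1: "(\<lambda>x. indicator (ball y (r / 2)) x * ennreal ((u' x + \<kappa>) powr (- m))) \<in> borel_measurable lborel"
      and m2: "(\<lambda>x. indicator (ball y r) x * ennreal (v x powr p)) \<in> borel_measurable lborel"
      using ball_m by (auto intro!: borel_measurable_times_ennreal)
    have "(\<integral>\<^sup>+x. ennreal A1 * (indicator (ball y (r / 2)) x * ennreal ((u' x + \<kappa>) powr (- m))) 
      + ennreal A2 * (indicator (ball y r) x * ennreal (v x powr p)) \<partial>lborel)
      = (\<integral>\<^sup>+x. ennreal A1 * (indicator (ball y (r / 2)) x * ennreal ((u' x + \<kappa>) powr (- m))) \<partial>lborel)
      + (\<integral>\<^sup>+x. ennreal A2 * (indicator (ball y r) x * ennreal (v x powr p)) \<partial>lborel)"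
      by (rule nn_integral_add) (intro borel_measurable_times_ennreal borel_measurable_const m1 m2)+
    then show ?thesis by (simp only: nn_integral_cmult[OF m1] nn_integral_cmult[OF m2] I_def)
  qed
  also have "\<dots> \<le> ennreal A1 * ennreal (D' * r ^ N) + ennreal A2 * ennreal (K * r powr (real DIM('a) + p - 1))"
    using I vy by (intro add_mono mult_left_mono) auto
  also have "\<dots> = ennreal (A1 * (D' * r ^ N) + A2 * (K * r powr (real DIM('a) + p - 1)))"
    using D' K r by (simp add: ennreal_mult A1_def A2_def)
  finally have "\<omega> * (r / 2) ^ N \<le> A1 * (D' * r ^ N) + A2 * (K * r powr (real DIM('a) + p - 1))"
    using D' K r by (subst (asm) ennreal_le_iff) (auto simp: A1_def A2_def)
  also have "r powr (real DIM('a) + p - 1) = r ^ N * r powr (p - 1)"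
    using r by (simp add: N_def powr_add powr_diff powr_realpow)
  also have "A1 * (D' * r ^ N) + A2 * (K * (r ^ N * r powr (p - 1))) 
      = ((2 powr m * D') * \<kappa> powr m + (A2 * K) * r powr (p - 1)) * r ^ N"
    by (simp add: A1_def powr_mult algebra_simps)
  also have "\<dots> < (\<tau> + \<tau>) * r ^ N"
    using \<kappa>(3) r(1,3) by (intro mult_strict_right_mono add_strict_mono) (auto simp: A2_def)
  also have "\<dots> = \<omega> * (r / 2) ^ N" by (simp add: \<tau>_def power_divide)
  finally show False by simp
qed

theorem theorem1p19:
  fixes \<Omega> :: "'a::euclidean_space set"
    and f g :: "'a \<Rightarrow> real"
    and s p q \<alpha> \<beta> \<delta> C1 C2 :: real
  assumes "open \<Omega>" "connected \<Omega>" "\<Omega> \<noteq> {}" "bounded \<Omega>" "C2_boundary \<Omega>"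
    and "0 < s" "s < 1"
    and "1 < q" "q \<le> p" "p < real DIM('a)"
    and "0 < \<beta>" "\<beta> < q - 1" "0 < \<alpha>"
    and "f \<in> borel_measurable (lebesgue_on \<Omega>)" "\<And>x. x \<in> \<Omega> \<Longrightarrow> 0 \<le> f x"
    and "g \<in> borel_measurable (lebesgue_on \<Omega>)" "\<And>x. x \<in> \<Omega> \<Longrightarrow> 0 \<le> g x"
    and "p \<le> \<delta>" "0 < C1" "0 < C2"
    and "\<And>x. x \<in> \<Omega> \<Longrightarrow> C1 * boundary_dist \<Omega> x powr (- \<delta>) \<le> f x"
    and "\<And>x. x \<in> \<Omega> \<Longrightarrow> f x \<le> C2 * boundary_dist \<Omega> x powr (- \<delta>)"
  shows "(in_Lp (conjugate_exponent (sobolev_exponent TYPE('a) p / (\<beta> + 1))) \<Omega> g \<longrightarrow>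
      \<not> (\<exists>u G. W1p_zero p \<Omega> u G \<and> positive_in \<Omega> u \<and>
            locally_bounded_below \<Omega> u \<and> weak_formulation \<Omega> p q s \<alpha> \<beta> f g u G))
    \<and> (\<forall>\<theta>0 > max 1 ((\<alpha> + p - 1) / p).
        in_Lp (conjugate_exponent
            (\<theta>0 * sobolev_exponent TYPE('a) p / (p * (\<theta>0 - 1) + \<beta> + 1))) \<Omega> g \<longrightarrow>
        \<not> (\<exists>u G. W1p_loc p \<Omega> u G \<and> (\<exists>H. W1p_zero p \<Omega> (\<lambda>x. u x powr \<theta>0) H) \<and>
              positive_in \<Omega> u \<and>
              locally_bounded_below \<Omega> u \<and> weak_formulation \<Omega> p q s \<alpha> \<beta> f g u G))"
proof (intro conjI impI allI notI)
  assume "\<exists>u G. W1p_zero p \<Omega> u G \<and> positive_in \<Omega> u \<and>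
            locally_bounded_below \<Omega> u \<and> weak_formulation \<Omega> p q s \<alpha> \<beta> f g u G"
  then obtain u G where u: "W1p p UNIV u G" "positive_in \<Omega> u" "weak_formulation \<Omega> p q s \<alpha> \<beta> f g u G"
    by (auto simp: W1p_zero_def)
  have um: "u \<in> borel_measurable lebesgue" using u(1) by (simp add: W1p_def in_Lp_def lebesgue_on_UNIV_eq)
  have balls: "W1p p (ball y r) u G" for y r by (rule W1p_subset[OF u(1)]) auto
  have nonneg: "AE x in lborel. u x = u x powr 1"
  proof -
    have "AE x in lborel. x \<in> \<Omega> \<longrightarrow> u x > 0" "AE x in lborel. x \<notin> \<Omega> \<longrightarrow> u x = 0"
      using u(2) by (auto simp: positive_in_def AE_completion_iff)
    then show ?thesis by eventually_elim (metis less_eq_real_def powr_one_gt_zero_iff powr_one powr_zero_eq_one powr_0)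
  qed
  show False
    by (rule no_weak_solution[OF assms(1,3,4,5,6,7,8,9,10,13,17,18,19,21) order_refl um u(2) balls u(1) nonneg u(3)])
next
  fix \<theta>0
  assume \<theta>: "max 1 ((\<alpha> + p - 1) / p) < \<theta>0"
  assume "\<exists>u G. W1p_loc p \<Omega> u G \<and> (\<exists>H. W1p_zero p \<Omega> (\<lambda>x. u x powr \<theta>0) H) \<and>
              positive_in \<Omega> u \<and> locally_bounded_below \<Omega> u \<and> weak_formulation \<Omega> p q s \<alpha> \<beta> f g u G"
  then obtain u G H where u: "W1p_loc p \<Omega> u G" "W1p p UNIV (\<lambda>x. u x powr \<theta>0) H" 
      "positive_in \<Omega> u" "weak_formulation \<Omega> p q s \<alpha> \<beta> f g u G"
    by (auto simp: W1p_zero_def)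
  have \<theta>1: "1 \<le> \<theta>0" using \<theta> by simp
  have balls: "W1p p (ball y r) u G" if "cball y r \<subseteq> \<Omega>" for y r
  proof -
    have "ball y r \<Subset> \<Omega>"
      using that closure_minimal[OF ball_subset_cball[of y r] closed_cball] by (auto simp: compactly_contained_def)
    then show ?thesis using u(1) by (simp add: W1p_loc_def)
  qed
  have um: "u \<in> borel_measurable lebesgue"
  proof (rule borel_measurable_AE)
    have [measurable]: "(\<lambda>x. u x powr \<theta>0) \<in> borel_measurable lebesgue"
      using u(2) by (simp add: W1p_def in_Lp_def lebesgue_on_UNIV_eq)
    show "(\<lambda>x. (u x powr \<theta>0) powr (1 / \<theta>0)) \<in> borel_measurable lebesgue" by measurable
    have "AE x in lebesgue. x \<in> \<Omega> \<longrightarrow> u x > 0" "AE x in lebesgue. x \<notin> \<Omega> \<longrightarrow> u x = 0"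
      using u(3) by (auto simp: positive_in_def)
    then show "AE x in lebesgue. (u x powr \<theta>0) powr (1 / \<theta>0) = u x"
    proof eventually_elim
      case (elim x)
      then show ?case using \<theta>1 by (cases "x \<in> \<Omega>") (auto simp: powr_powr)
    qed
  qed
  show False
    by (rule no_weak_solution[OF assms(1,3,4,5,6,7,8,9,10,13,17,18,19,21) \<theta>1 um u(3) balls u(2) _ u(4)]) auto
qed

end
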